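(* Let $f\in\mathcal{N}(\Omega)$ and $g\in\mathrm{Lip}(\Omega)$, with $g$ not necessarily in $\mathrm{Ker}(\mathcal{L}_f)$. Suppose $f=\zeta+(u-u\circ T)+c$ and $g=\eta+(v-v\circ T)$, with $\zeta,\eta\in\mathrm{Ker}(\mathcal{L}_f)$, $u,v\in\mathrm{Lip}(\Omega)$ and $c\in\mathbb{R}$. Then $$\frac{d}{dt}h(\mu_{f+tg})\Big|_{t=0}=-\int_\Omega\zeta\,\eta\,d\mu_f.$$
   Context: Let $(M,d_M)$ be a compact metric space with $\mathrm{diam}(M)=1$, $\Omega:=M^{\mathbb{N}}$ with metric $d(x,y)=\sum_{n\ge1}2^{-n}d_M(x_n,y_n)$, and $T:\Omega\to\Omega$ the shift. $\mathrm{Lip}(\Omega)$ is the space of real Lipschitz functions on $\Omega$. Fix a Borel probability $\nu$ on $M$ with support $M$. For $f\in\mathrm{Lip}(\Omega)$ the Ruelle operator on $\mathrm{Lip}(\Omega)$ is $\mathcal{L}_f(w)(x)=\int_M e^{f(ax)}w(ax)\,d\nu(a)$, where $ax=(a,x_1,x_2,\dots)$, and $\mathrm{Ker}(\mathcal{L}_f)=\{w\in\mathrm{Lip}(\Omega):\mathcal{L}_f w=0\}$. By the Ruelle-Perron-Frobenius (RPF) theorem there are $\lambda_f>0$, a strictly positive $w_f\in\mathrm{Lip}(\Omega)$ and a Borel probability $\rho_f$ with $\mathcal{L}_f w_f=\lambda_f w_f$, $\mathcal{L}_f^*\rho_f=\lambda_f\rho_f$, $\int w_f\,d\rho_f=1$.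 $\mathcal{N}(\Omega)$ is the set of normalized potentials, i.e. $f\in\mathrm{Lip}(\Omega)$ with $\mathcal{L}_f1=1$; for $f\in\mathrm{Lip}(\Omega)$, $N(f)=f+\log w_f-\log(w_f\circ T)-\log\lambda_f\in\mathcal{N}(\Omega)$. The Lipschitz-Gibbs probability $\mu_f$ is the unique Borel probability with $\mathcal{L}_{N(f)}^*\mu_f=\mu_f$; it is $T$-invariant. Its entropy is $h(\mu_f)=-\int_\Omega N(f)\,d\mu_f$. *)

theory Defs
  imports "HOL-Probability.Probability"
begin

text \<open>
  The space \<open>M\<close> is a type \<open>'a::metric_space\<close>, and \<open>\<Omega> = M\<^sup>\<nat>\<close> is the type \<open>nat \<Rightarrow> 'a\<close>, with
  coordinates indexed from \<open>0\<close>; this shifts the exponent in the weights by one. The library's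
  metric on function types is not used: it truncates distances and weights coordinates along an
  unspecified enumeration, so it has other Lipschitz functions. The topology, and hence the
  Borel sets, of \<open>nat \<Rightarrow> 'a\<close> are those of the library; see \<open>open_iff_seq_dist\<close> below.
\<close>

definition seq_dist :: "(nat \<Rightarrow> 'a::metric_space) \<Rightarrow> (nat \<Rightarrow> 'a) \<Rightarrow> real" where
  "seq_dist x y = (\<Sum>n. (1 / 2) ^ Suc n * dist (x n) (y n))"

definition Lip :: "((nat \<Rightarrow> 'a::metric_space) \<Rightarrow> real) set" where
  "Lip = {w. \<exists>C. \<forall>x y. \<bar>w x - w y\<bar> \<le> C * seq_dist x y}"

definition shift_map :: "(nat \<Rightarrow> 'a) \<Rightarrow> nat \<Rightarrow> 'a" where
  "shift_map x = (\<lambda>n. x (Suc n))"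

definition prepend :: "'a \<Rightarrow> (nat \<Rightarrow> 'a) \<Rightarrow> nat \<Rightarrow> 'a" where
  "prepend a x = case_nat a x"

definition borel_prob :: "'b::topological_space measure \<Rightarrow> bool" where
  "borel_prob \<mu> \<longleftrightarrow> prob_space \<mu> \<and> sets \<mu> = sets borel"

definition msupport :: "'b::topological_space measure \<Rightarrow> 'b set" where
  "msupport \<mu> = {x. \<forall>U. open U \<longrightarrow> x \<in> U \<longrightarrow> emeasure \<mu> U > 0}"

definition ruelle ::
  "'a::metric_space measure \<Rightarrow> ((nat \<Rightarrow> 'a) \<Rightarrow> real) \<Rightarrow> ((nat \<Rightarrow> 'a) \<Rightarrow> real) \<Rightarrow> (nat \<Rightarrow> 'a) \<Rightarrow> real" where
  "ruelle \<nu> f w x = (\<integral>a. exp (f (prepend a x)) * w (prepend a x) \<partial>\<nu>)"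

definition ruelle_kernel ::
  "'a::metric_space measure \<Rightarrow> ((nat \<Rightarrow> 'a) \<Rightarrow> real) \<Rightarrow> ((nat \<Rightarrow> 'a) \<Rightarrow> real) set" where
  "ruelle_kernel \<nu> f = {w \<in> Lip. \<forall>x. ruelle \<nu> f w x = 0}"

definition normalized_potentials ::
  "'a::metric_space measure \<Rightarrow> ((nat \<Rightarrow> 'a) \<Rightarrow> real) set" where
  "normalized_potentials \<nu> = {f \<in> Lip. \<forall>x. ruelle \<nu> f (\<lambda>_. 1) x = 1}"

text \<open>
  \<open>dual_eigenmeasure \<nu> f l \<rho>\<close> says that \<open>\<rho>\<close> is a Borel probability with \<open>\<L>\<^sub>f\<^sup>* \<rho> = l \<rho>\<close>. Since \<open>\<L>\<^sub>f\<close>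
  acts on Lipschitz functions, the dual is tested against these.
\<close>

definition dual_eigenmeasure ::
  "'a::metric_space measure \<Rightarrow> ((nat \<Rightarrow> 'a) \<Rightarrow> real) \<Rightarrow> real \<Rightarrow> (nat \<Rightarrow> 'a) measure \<Rightarrow> bool" where
  "dual_eigenmeasure \<nu> f l \<rho> \<longleftrightarrow> borel_prob \<rho> \<and>
     (\<forall>w\<in>Lip. (\<integral>x. ruelle \<nu> f w x \<partial>\<rho>) = l * (\<integral>x. w x \<partial>\<rho>))"

definition rpf_triple ::
  "'a::metric_space measure \<Rightarrow> ((nat \<Rightarrow> 'a) \<Rightarrow> real) \<Rightarrow>
   real \<Rightarrow> ((nat \<Rightarrow> 'a) \<Rightarrow> real) \<Rightarrow> (nat \<Rightarrow> 'a) measure \<Rightarrow> bool" where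
  "rpf_triple \<nu> f l w \<rho> \<longleftrightarrow>
     l > 0 \<and> w \<in> Lip \<and> (\<forall>x. w x > 0) \<and> (\<forall>x. ruelle \<nu> f w x = l * w x) \<and>
     dual_eigenmeasure \<nu> f l \<rho> \<and> (\<integral>x. w x \<partial>\<rho>) = 1"

text \<open>The Ruelle-Perron-Frobenius theorem provides the triple chosen here.\<close>

definition rpf_data ::
  "'a::metric_space measure \<Rightarrow> ((nat \<Rightarrow> 'a) \<Rightarrow> real) \<Rightarrow>
   real \<times> ((nat \<Rightarrow> 'a) \<Rightarrow> real) \<times> (nat \<Rightarrow> 'a) measure" where
  "rpf_data \<nu> f = (SOME (l, w, \<rho>). rpf_triple \<nu> f l w \<rho>)"

definition rpf_eigenvalue :: "'a::metric_space measure \<Rightarrow> ((nat \<Rightarrow> 'a) \<Rightarrow> real) \<Rightarrow> real" where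
  "rpf_eigenvalue \<nu> f = fst (rpf_data \<nu> f)"

definition rpf_eigenfunction ::
  "'a::metric_space measure \<Rightarrow> ((nat \<Rightarrow> 'a) \<Rightarrow> real) \<Rightarrow> (nat \<Rightarrow> 'a) \<Rightarrow> real" where
  "rpf_eigenfunction \<nu> f = fst (snd (rpf_data \<nu> f))"

definition normalization ::
  "'a::metric_space measure \<Rightarrow> ((nat \<Rightarrow> 'a) \<Rightarrow> real) \<Rightarrow> (nat \<Rightarrow> 'a) \<Rightarrow> real" where
  "normalization \<nu> f x = f x + ln (rpf_eigenfunction \<nu> f x)
     - ln (rpf_eigenfunction \<nu> f (shift_map x)) - ln (rpf_eigenvalue \<nu> f)"

definition lipschitz_gibbs ::
  "'a::metric_space measure \<Rightarrow> ((nat \<Rightarrow> 'a) \<Rightarrow> real) \<Rightarrow> (nat \<Rightarrow> 'a) measure" where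
  "lipschitz_gibbs \<nu> f = (THE \<mu>. dual_eigenmeasure \<nu> (normalization \<nu> f) 1 \<mu>)"

definition gibbs_entropy :: "'a::metric_space measure \<Rightarrow> ((nat \<Rightarrow> 'a) \<Rightarrow> real) \<Rightarrow> real" where
  "gibbs_entropy \<nu> f = - (\<integral>x. normalization \<nu> f x \<partial>lipschitz_gibbs \<nu> f)"

lemma seq_dist_summable:
  fixes x y :: "nat \<Rightarrow> 'a::metric_space"
  assumes "\<And>a b :: 'a. dist a b \<le> 1"
  shows "summable (\<lambda>n. (1 / 2) ^ Suc n * dist (x n) (y n))"
proof (rule summable_comparison_test')
  show "summable (\<lambda>n. (1 / 2 :: real) ^ Suc n)"
    by (simp add: summable_mult summable_geometric)
  show "norm ((1 / 2) ^ Suc n * dist (x n) (y n)) \<le> (1 / 2) ^ Suc n" for n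
    using assms[of "x n" "y n"] by (simp add: abs_mult mult_left_le)
qed

lemma dist_le_seq_dist:
  fixes x y :: "nat \<Rightarrow> 'a::metric_space"
  assumes "\<And>a b :: 'a. dist a b \<le> 1"
  shows "dist (x n) (y n) \<le> 2 ^ Suc n * seq_dist x y"
proof -
  have "(\<Sum>k\<in>{n}. (1 / 2) ^ Suc k * dist (x k) (y k)) \<le> seq_dist x y"
    unfolding seq_dist_def by (rule sum_le_suminf[OF seq_dist_summable[OF assms]]) auto
  then show ?thesis
    by (simp add: field_simps)
qed

lemma seq_dist_le:
  fixes x y :: "nat \<Rightarrow> 'a::metric_space"
  assumes "\<And>a b :: 'a. dist a b \<le> 1" and "e \<ge> 0" and "\<And>n. n < N \<Longrightarrow> dist (x n) (y n) \<le> e"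
  shows "seq_dist x y \<le> e + (1 / 2) ^ N"
proof -
  let ?h = "\<lambda>n. (1 / 2 :: real) ^ Suc n"
  have sh: "summable ?h" by (simp add: summable_mult summable_geometric)
  have tot: "(\<Sum>n. ?h n) = 1"
    using power_half_series by (simp add: sums_iff)
  have tail: "(\<Sum>n. ?h (n + N)) = (1 / 2) ^ N"
  proof -
    have "(\<Sum>n. ?h (n + N)) = (\<Sum>n. (1 / 2) ^ N * ?h n)"
      by (simp add: power_add mult_ac)
    also have "\<dots> = (1 / 2) ^ N * (\<Sum>n. ?h n)" by (rule suminf_mult[OF sh])
    finally show ?thesis by (simp only: tot mult_1_right)
  qed
  have s: "summable (\<lambda>n. ?h n * dist (x n) (y n))" by (rule seq_dist_summable[OF assms(1)])
  have "seq_dist x y = (\<Sum>n. ?h (n + N) * dist (x (n + N)) (y (n + N)))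
      + (\<Sum>n<N. ?h n * dist (x n) (y n))"
    unfolding seq_dist_def by (rule suminf_split_initial_segment[OF s])
  also have "(\<Sum>n. ?h (n + N) * dist (x (n + N)) (y (n + N))) \<le> (\<Sum>n. ?h (n + N))"
    using assms(1) s sh by (intro suminf_le summable_ignore_initial_segment) (auto intro: mult_left_le)
  also have "(\<Sum>n<N. ?h n * dist (x n) (y n)) \<le> (\<Sum>n<N. ?h n * e)"
    using assms(3) by (intro sum_mono mult_left_mono) auto
  also have "\<dots> = e * (\<Sum>n<N. ?h n)" by (simp only: sum_distrib_left mult.commute)
  also have "\<dots> \<le> e * 1"
    using sum_le_suminf[OF sh, of "{..<N}"] tot assms(2) by (intro mult_left_mono) auto
  finally show ?thesis using tail by simp
qed

lemma open_iff_seq_dist: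
  fixes U :: "(nat \<Rightarrow> 'a::metric_space) set"
  assumes bd: "\<And>a b :: 'a. dist a b \<le> 1"
  shows "open U \<longleftrightarrow> (\<forall>x\<in>U. \<exists>e>0. \<forall>y. seq_dist x y < e \<longrightarrow> y \<in> U)"
proof
  assume U: "open U"
  show "\<forall>x\<in>U. \<exists>e>0. \<forall>y. seq_dist x y < e \<longrightarrow> y \<in> U"
  proof
    fix x assume "x \<in> U"
    then obtain X where X: "x \<in> Pi\<^sub>E UNIV X" "\<And>i. open (X i)" "finite {i. X i \<noteq> UNIV}" "Pi\<^sub>E UNIV X \<subseteq> U"
      using U product_topology_open_contains_basis[of "\<lambda>_. euclidean" UNIV U x]
      by (auto simp: open_fun_def)
    let ?F = "{i. X i \<noteq> UNIV}"
    have "\<forall>i. \<exists>e>0. \<forall>b. dist (x i) b < e \<longrightarrow> b \<in> X i"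
    proof
      fix i
      have "x i \<in> X i" using X(1) by (auto simp: PiE_def)
      then show "\<exists>e>0. \<forall>b. dist (x i) b < e \<longrightarrow> b \<in> X i"
        using X(2)[of i] unfolding open_dist by (metis dist_commute)
    qed
    then obtain e where e: "\<And>i. e i > 0" "\<And>i b. dist (x i) b < e i \<Longrightarrow> b \<in> X i"
      by metis
    define d where "d = Min (insert 1 ((\<lambda>i. e i / 2 ^ Suc i) ` ?F))"
    have "d > 0" using X(3) e(1) by (auto simp: d_def)
    moreover have "y \<in> U" if y: "seq_dist x y < d" for y
    proof -
      have "y i \<in> X i" for i
      proof (cases "i \<in> ?F")
        case True
        then have "d \<le> e i / 2 ^ Suc i" using X(3) by (auto simp: d_def intro!: Min_le)
        with y have "seq_dist x y < e i / 2 ^ Suc i" by linarith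
        then have "2 ^ Suc i * seq_dist x y < e i"
          by (simp only: pos_less_divide_eq[of "2 ^ Suc i"] zero_less_power zero_less_numeral mult.commute)
        then show ?thesis using dist_le_seq_dist[OF bd, of x i y] e(2)[of i "y i"] by linarith
      qed auto
      then show ?thesis using X(4) by (auto simp: PiE_def)
    qed
    ultimately show "\<exists>e>0. \<forall>y. seq_dist x y < e \<longrightarrow> y \<in> U" by blast
  qed
next
  assume R: "\<forall>x\<in>U. \<exists>e>0. \<forall>y. seq_dist x y < e \<longrightarrow> y \<in> U"
  show "open U"
  proof (subst open_subopen, intro ballI)
    fix x assume x: "x \<in> U"
    with R obtain e where e: "e > 0" "\<And>y. seq_dist x y < e \<Longrightarrow> y \<in> U" by blast
    obtain N where N: "(1 / 2 :: real) ^ N < e / 2"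
      using real_arch_pow_inv[of "e / 2" "1 / 2"] e(1) by auto
    define V where "V = Pi\<^sub>E UNIV (\<lambda>i. if i < N then ball (x i) (e / 2) else UNIV)"
    have "open V" unfolding V_def
      by (rule open_PiE) (auto intro: finite_subset[of _ "{..<N}"])
    moreover have "x \<in> V" using e(1) by (auto simp: V_def)
    moreover have "V \<subseteq> U"
    proof
      fix y assume "y \<in> V"
      then have "y i \<in> (if i < N then ball (x i) (e / 2) else UNIV)" for i
        unfolding V_def by (rule PiE_mem) simp
      then have "dist (x i) (y i) \<le> e / 2" if "i < N" for i
        using that by (smt (verit) mem_ball)
      then have "seq_dist x y \<le> e / 2 + (1 / 2) ^ N"
        using seq_dist_le[OF bd, of "e / 2" N x y] e(1) by simp
      then show "y \<in> U" using N by (intro e(2)) linarith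
    qed
    ultimately show "\<exists>V. open V \<and> x \<in> V \<and> V \<subseteq> U" by blast
  qed
qed

end

theory Submission
  imports Defs
begin

text \<open>
  For a normalized potential \<open>N\<close> with Lipschitz constant \<open>K\<close>, the transition probabilities
  \<open>exp (N (a x)) d\<nu>(a)\<close> and \<open>exp (N (a y)) d\<nu>(a)\<close> overlap in mass at least \<open>exp (- K d(x,y) / 2)\<close>,
  and prepending the same symbol halves \<open>d\<close>. Hence the Ruelle operator is, in a single step, a strict
  contraction for the Lipschitz seminorm of the metric \<open>1 - exp (- 2 K d)\<close>, with a rate depending
  only on \<open>K\<close>. This gives the Gibbs measure (as the limit of the iterates, represented by a measure),
  its uniqueness and its continuity in the potential, and the simplicity of the leading eigenvalue.

  Up to a coboundary, \<open>f + t g\<close> is \<open>f + t \<eta>\<close>. Since \<open>\<L>\<^sub>f \<eta> = 0\<close>, the function \<open>\<L>\<^sub>f (exp (t \<eta>))\<close>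
  is \<open>1 + O(t\<^sup>2)\<close>; iterating the normalized operator from the constant function \<open>1\<close> then yields an
  eigenfunction \<open>exp h\<close> and an eigenvalue \<open>exp l\<close> with \<open>h, l = O(t\<^sup>2)\<close>. Integrating the normalized
  potential against the invariant measure \<open>\<mu>\<^sub>t\<close> gives \<open>h(\<mu>\<^sub>t) = l - c - \<integral>\<zeta> d\<mu>\<^sub>t - t \<integral>\<eta> d\<mu>\<^sub>t\<close>, and
  \<open>\<integral>\<zeta> d\<mu>\<^sub>t = \<integral>\<L>\<^sub>N \<zeta> d\<mu>\<^sub>t = t \<integral>\<L>\<^sub>f (\<zeta> \<eta>) d\<mu>\<^sub>t + O(t\<^sup>2)\<close> because \<open>\<L>\<^sub>f \<zeta> = 0\<close>.
\<close>

section \<open>A Riesz representation theorem for Stone lattices on compact spaces\<close>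

text \<open>\<open>rpf_data\<close> and \<open>lipschitz_gibbs\<close> are chosen by
  \<open>SOME\<close> and \<open>THE\<close>, so nothing is known about the normalization of
  \<open>f + t g\<close> until some triple exists and all triples give the same result. Existence
  comes, for small \<open>t\<close>, from perturbing the eigenfunction 1 of \<open>f\<close>.
  Independence holds because positive Lipschitz eigenfunctions differ by a constant factor, which
  cancels in the difference of \<open>ln w\<close> and its shift.

  For \<open>d\<close> itself, the natural estimate adds a multiple of the oscillation to half the
  seminorm, which for large \<open>K\<close> is no contraction. With the metric
  \<open>1 - exp (- a K d)\<close> and \<open>z = exp (- K d / 2)\<close>, the overlap argument
  replaces \<open>1 - z^(2a)\<close> by \<open>(1 - z) + z (1 - z^a) = 1 - z^(1 + a)\<close>,
  smaller by a fixed factor as soon as \<open>a > 1\<close>; the choice \<open>a = 2\<close> keeps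
  the exponents integral.

  That the rate depends on \<open>K\<close> alone matters because the potentials met in the
  nonlinear iteration are held below one common Lipschitz constant. At the end, the coefficient of
  \<open>t\<close> is itself an integral against the measure at time \<open>t\<close>, so continuity
  of the measures at 0 yields the derivative.\<close>

locale compact_stone_lattice =
  fixes A :: "('b::topological_space \<Rightarrow> real) set" and I :: "('b \<Rightarrow> real) \<Rightarrow> real"
  assumes compact_space: "compact (UNIV :: 'b set)"
    and continuous: "h \<in> A \<Longrightarrow> continuous_on UNIV h"
    and const_mem: "(\<lambda>_. c) \<in> A"
    and add_mem: "h \<in> A \<Longrightarrow> k \<in> A \<Longrightarrow> (\<lambda>x. h x + k x) \<in> A"
    and scale_mem: "h \<in> A \<Longrightarrow> (\<lambda>x. c * h x) \<in> A"
    and max_mem: "h \<in> A \<Longrightarrow> k \<in> A \<Longrightarrow> (\<lambda>x. max (h x) (k x)) \<in> A"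
    and cozero: "open U \<Longrightarrow> \<exists>k\<in>A. \<forall>x. 0 \<le> k x \<and> (0 < k x \<longleftrightarrow> x \<in> U)"
    and I_add: "h \<in> A \<Longrightarrow> k \<in> A \<Longrightarrow> I (\<lambda>x. h x + k x) = I h + I k"
    and I_scale: "h \<in> A \<Longrightarrow> I (\<lambda>x. c * h x) = c * I h"
    and I_one: "I (\<lambda>_. 1) = 1"
    and I_nonneg: "h \<in> A \<Longrightarrow> (\<And>x. 0 \<le> h x) \<Longrightarrow> 0 \<le> I h"
begin

section \<open>Linearity and monotonicity of the functional\<close>

lemma I_const: "I (\<lambda>_. c) = c"
  using I_scale[OF const_mem, of c 1] I_one by simp

lemma diff_mem: "h \<in> A \<Longrightarrow> k \<in> A \<Longrightarrow> (\<lambda>x. h x - k x) \<in> A"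
  using add_mem[OF _ scale_mem, of h k "-1"] by simp

lemma min_mem: "h \<in> A \<Longrightarrow> k \<in> A \<Longrightarrow> (\<lambda>x. min (h x) (k x)) \<in> A"
  using scale_mem[OF max_mem[OF scale_mem scale_mem], of h k "-1" "-1" "-1"]
  by (simp add: minus_max_eq_min)

lemma I_diff: "h \<in> A \<Longrightarrow> k \<in> A \<Longrightarrow> I (\<lambda>x. h x - k x) = I h - I k"
  using I_add[OF _ scale_mem, of h k "-1"] I_scale[of k "-1"] by simp

lemma I_mono: "h \<in> A \<Longrightarrow> k \<in> A \<Longrightarrow> (\<And>x. h x \<le> k x) \<Longrightarrow> I h \<le> I k"
  using I_nonneg[OF diff_mem, of k h] by (simp add: I_diff)

lemma sum_mem: "finite S \<Longrightarrow> (\<And>i. i \<in> S \<Longrightarrow> h i \<in> A) \<Longrightarrow> (\<lambda>x. \<Sum>i\<in>S. h i x) \<in> A"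
  by (induction S rule: finite_induct) (auto intro: const_mem add_mem)

lemma I_sum: "finite S \<Longrightarrow> (\<And>i. i \<in> S \<Longrightarrow> h i \<in> A) \<Longrightarrow> I (\<lambda>x. \<Sum>i\<in>S. h i x) = (\<Sum>i\<in>S. I (h i))"
  by (induction S rule: finite_induct) (auto simp: I_const I_add sum_mem)

section \<open>Content of open sets and the induced outer measure\<close>

definition below :: "'b set \<Rightarrow> ('b \<Rightarrow> real) set" where
  "below U = {h \<in> A. \<forall>x. 0 \<le> h x \<and> h x \<le> indicator U x}"

text \<open>Functions in \<open>below U\<close> vanish off \<open>U\<close>, but their supports may
  reach the boundary of \<open>U\<close>. Truncation at a small height \<open>e\<close> takes over
  the role that compact supports have in the classical construction.\<close>

definition content :: "'b set \<Rightarrow> ennreal" where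
  "content U = (SUP h\<in>below U. ennreal (I h))"

definition outer :: "'b set \<Rightarrow> ennreal" where
  "outer E = (INF U\<in>{U. open U \<and> E \<subseteq> U}. content U)"

lemma zero_below: "(\<lambda>_. 0) \<in> below U"
  by (auto simp: below_def const_mem)

lemma content_upper: "h \<in> below U \<Longrightarrow> ennreal (I h) \<le> content U"
  unfolding content_def by (rule SUP_upper)

lemma content_mono: "U \<subseteq> V \<Longrightarrow> content U \<le> content V"
  unfolding content_def
proof (intro SUP_subset_mono subsetI)
  fix h assume "U \<subseteq> V" "h \<in> below U"
  moreover from \<open>U \<subseteq> V\<close> have "indicator U x \<le> (indicator V x :: real)" for x
    by (auto simp: indicator_def)
  ultimately show "h \<in> below V" unfolding below_def by (blast intro: order_trans)
qed simp

lemma outer_open: "open U \<Longrightarrow> outer U = content U"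
  unfolding outer_def by (intro antisym INF_lower INF_greatest) (auto intro: content_mono)

lemma outer_mono: "E \<subseteq> F \<Longrightarrow> outer E \<le> outer F"
  unfolding outer_def by (intro INF_superset_mono) auto

lemma content_UNIV: "content UNIV = 1"
proof (rule antisym)
  have "I h \<le> 1" if "h \<in> below UNIV" for h
    using that I_mono[OF _ const_mem, of h 1] by (simp add: I_const below_def)
  then show "content UNIV \<le> 1"
    unfolding content_def by (intro SUP_least) (auto simp: ennreal_le_1)
  have "(\<lambda>_. 1) \<in> below UNIV" by (auto simp: below_def const_mem)
  from content_upper[OF this] show "1 \<le> content UNIV" by (simp add: I_one)
qed

lemma content_empty: "content {} = 0"
proof -
  have "I h = 0" if "h \<in> below {}" for h
  proof -
    have "h = (\<lambda>_. 0)" using that by (auto simp: below_def intro!: ext antisym)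
    then show ?thesis by (simp add: I_const)
  qed
  then show ?thesis
    unfolding content_def using zero_below by (auto intro!: antisym SUP_least)
qed

text \<open>Dini's argument. The functions \<open>min 1 (n * k i)\<close> increase to the indicator
  of \<open>U i\<close>, so the open sets where \<open>h\<close> is less than \<open>S n + e\<close>
  increase and cover the space. By compactness a single \<open>n\<close> serves everywhere, and
  \<open>I\<close> can be applied to a finite sum.\<close>

lemma I_le_suminf_content:
  assumes h: "h \<in> below (\<Union>i::nat. U i)" and U: "\<And>i. open (U i)"
  shows "ennreal (I h) \<le> (\<Sum>i. content (U i))"
proof (rule ennreal_le_epsilon)
  fix e :: real assume e: "0 < e"
  have "\<forall>i. \<exists>k\<in>A. \<forall>x. 0 \<le> k x \<and> (0 < k x \<longleftrightarrow> x \<in> U i)" using cozero U by blast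
  then obtain k where k: "\<And>i. k i \<in> A" "\<And>i x. 0 \<le> k i x" "\<And>i x. 0 < k i x \<longleftrightarrow> x \<in> U i"
    by metis
  define g where "g n i x = min 1 (real n * k i x)" for n i x
  have gA: "g n i \<in> A" for n i
    unfolding g_def using min_mem[OF const_mem scale_mem[OF k(1)]] by simp
  have gb: "g n i \<in> below (U i)" for n i
  proof -
    have "k i x = 0" if "x \<notin> U i" for x using k(2)[of i x] k(3)[of i x] that by auto
    then show ?thesis
      using gA k(2) by (auto simp: below_def g_def indicator_def)
  qed
  have g0: "0 \<le> g n i x" for n i x using k(2) by (simp add: g_def)
  have gmono: "g m i x \<le> g n i x" if "m \<le> n" for m n i x
    unfolding g_def using that k(2)[of i x] by (intro min.mono mult_right_mono) auto
  have hA: "h \<in> A" and h1: "\<And>x. h x \<le> indicator (\<Union>i. U i) x" using h by (auto simp: below_def)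
  define S where "S n = (\<lambda>x. \<Sum>i<n. g n i x)" for n
  have SA: "S n \<in> A" for n unfolding S_def using sum_mem gA by auto
  have Smono: "S m x \<le> S n x" if "m \<le> n" for m n x
    unfolding S_def using that g0 gmono
    by (intro order_trans[OF sum_mono[of "{..<m}" "\<lambda>i. g m i x" "\<lambda>i. g n i x"] sum_mono2]) auto
  define V where "V n = {x. h x < S n x + e}" for n
  have "open (V n)" for n
  proof -
    have "continuous_on UNIV (\<lambda>x. S n x + e)"
      using continuous[OF SA] by (intro continuous_intros)
    then show ?thesis unfolding V_def using continuous[OF hA] by (intro open_Collect_less)
  qed
  moreover have "UNIV \<subseteq> (\<Union>n\<in>UNIV. V n)"
  proof (intro subsetI)
    fix x
    show "x \<in> (\<Union>n\<in>UNIV. V n)"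
    proof (cases "x \<in> (\<Union>i. U i)")
      case False
      then have "x \<in> V 0" using h1[of x] e by (simp add: V_def S_def)
      then show ?thesis by blast
    next
      case True
      then obtain i where "x \<in> U i" by blast
      then have kp: "0 < k i x" using k by blast
      obtain n where n: "1 / k i x < real n" using reals_Archimedean2 by blast
      \<comment> \<open>The index must be large enough both for the truncation to reach 1 at
        \<open>x\<close> and for the summand \<open>i\<close> to occur in
        \<open>S m\<close>.\<close>
      define m where "m = max n (Suc i)"
      have "1 < real m * k i x" using n kp
        by (smt (verit) divide_less_eq max.cobounded1 m_def mult_right_mono of_nat_le_iff)
      then have "g m i x = 1" by (simp add: g_def)
      moreover have "g m i x \<le> S m x" unfolding S_def
        by (rule member_le_sum) (auto simp: m_def g0)
      ultimately have "x \<in> V m" using h1[of x] e True by (auto simp: V_def)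
      then show ?thesis by blast
    qed
  qed
  ultimately obtain N where N: "finite N" "UNIV \<subseteq> (\<Union>n\<in>N. V n)"
    using compactE_image[OF compact_space, of UNIV V] by metis
  define n where "n = Max (insert 0 N)"
  have le: "h x \<le> S n x + e" for x
  proof -
    obtain m where "m \<in> N" "x \<in> V m" using N(2) by blast
    then have "m \<le> n" using N(1) by (simp add: n_def)
    with \<open>x \<in> V m\<close> Smono[of m n x] show ?thesis by (simp add: V_def)
  qed
  have "I h \<le> I (\<lambda>x. S n x + e)"
    by (rule I_mono) (auto intro: hA SA add_mem const_mem le)
  also have "\<dots> = (\<Sum>i<n. I (g n i)) + e"
    using I_add[OF SA const_mem, of n e] I_sum[of "{..<n}" "g n"] gA
    by (simp add: I_const S_def)
  finally have "ennreal (I h) \<le> ennreal ((\<Sum>i<n. I (g n i)) + e)" by (rule ennreal_leI)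
  also have "\<dots> = (\<Sum>i<n. ennreal (I (g n i))) + ennreal e"
    using e I_nonneg[OF gA g0] by (simp add: sum_nonneg)
  also have "\<dots> \<le> (\<Sum>i<n. content (U i)) + ennreal e"
    using content_upper[OF gb] by (intro add_right_mono sum_mono) auto
  also have "\<dots> \<le> (\<Sum>i. content (U i)) + ennreal e"
    by (intro add_right_mono sum_le_suminf) auto
  finally show "ennreal (I h) \<le> (\<Sum>i. content (U i)) + ennreal e" .
qed

lemma content_UN_le: "(\<And>i::nat. open (U i)) \<Longrightarrow> content (\<Union>i. U i) \<le> (\<Sum>i. content (U i))"
  using I_le_suminf_content unfolding content_def[of "\<Union>i. U i"] by (intro SUP_least) auto

lemma outer_UN_le: "outer (\<Union>i::nat. E i) \<le> (\<Sum>i. outer (E i))"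
proof (rule ennreal_le_epsilon)
  fix e :: real assume e: "0 < e" and fin: "(\<Sum>i. outer (E i)) < top"
  have "\<exists>U. open U \<and> E i \<subseteq> U \<and> content U \<le> outer (E i) + e * (1/2) ^ Suc i" for i
  proof -
    have "outer (E i) < outer (E i) + e * (1/2) ^ Suc i"
      using e fin by (auto simp add: less_top dest!: ennreal_suminf_lessD)
    then show ?thesis
      unfolding outer_def[of "E i"] INF_less_iff by (auto intro: less_imp_le)
  qed
  then obtain U where U: "\<And>i. open (U i)" "\<And>i. E i \<subseteq> U i"
      "\<And>i. content (U i) \<le> outer (E i) + e * (1/2) ^ Suc i"
    by metis
  have "outer (\<Union>i. E i) \<le> outer (\<Union>i. U i)" using U(2) by (intro outer_mono) blast
  also have "\<dots> = content (\<Union>i. U i)" using U(1) by (intro outer_open) auto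
  also have "\<dots> \<le> (\<Sum>i. content (U i))" using U(1) by (rule content_UN_le)
  also have "\<dots> \<le> (\<Sum>i. outer (E i) + e * (1/2) ^ Suc i)"
    using U(3) by (intro suminf_le) auto
  also have "\<dots> = (\<Sum>i. outer (E i)) + (\<Sum>i. ennreal e * ennreal ((1/2) ^ Suc i))"
    using e by (subst suminf_add[symmetric])
      (auto simp del: ennreal_suminf_cmult simp add: ennreal_mult[symmetric])
  also have "\<dots> = (\<Sum>i. outer (E i)) + e"
    unfolding ennreal_suminf_cmult
    by (subst suminf_ennreal_eq[OF zero_le_power power_half_series]) auto
  finally show "outer (\<Union>i. E i) \<le> (\<Sum>i. outer (E i)) + e" .
qed

section \<open>Caratheodory measurability of open sets\<close>

lemma outer_measure_space: "outer_measure_space UNIV outer"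
  using outer_open[of "{}"]
  by (auto simp: outer_measure_space_def positive_def increasing_def countably_subadditive_def
      content_empty intro: outer_mono outer_UN_le)

text \<open>The substantial half of Caratheodory's criterion. If \<open>h\<close> competes for the
  intersection, its part above height \<open>e\<close> and any \<open>k\<close> below
  \<open>W\<close> are never nonzero at the same point, so their sum competes for \<open>V\<close>.
  As \<open>h\<close> vanishes off \<open>U\<close>, the open set \<open>W\<close> contains
  \<open>V - U\<close>; only \<open>e\<close> is lost.\<close>

lemma content_split:
  assumes U: "open U" and V: "open V"
  shows "content (U \<inter> V) + outer (V - U) \<le> content V"
proof -
  have main: "ennreal (I h) + outer (V - U) \<le> content V" if h: "h \<in> below (U \<inter> V)" for h
  proof (rule ennreal_le_epsilon)
    fix e :: real assume e: "0 < e"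
    have hA: "h \<in> A" and h1: "\<And>x. 0 \<le> h x" "\<And>x. h x \<le> indicator (U \<inter> V) x"
      using h by (auto simp: below_def)
    define h' where "h' x = max (h x - e) 0" for x
    have h'A: "h' \<in> A" unfolding h'_def by (intro max_mem diff_mem hA const_mem)
    have h'0: "0 \<le> h' x" for x by (simp add: h'_def)
    define W where "W = V \<inter> {x. h x < e}"
    have W: "open W" unfolding W_def
      using V continuous[OF hA] by (intro open_Int open_Collect_less) auto
    have sub: "V - U \<subseteq> W"
    proof
      fix x assume "x \<in> V - U"
      then show "x \<in> W" using h1(2)[of x] e by (simp add: W_def)
    qed
    have "ennreal (I h') + ennreal (I k) \<le> content V" if k: "k \<in> below W" for k
    proof -
      have kA: "k \<in> A" and k1: "\<And>x. 0 \<le> k x" "\<And>x. k x \<le> indicator W x"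
        using k by (auto simp: below_def)
      have "0 \<le> h' x + k x \<and> h' x + k x \<le> indicator V x" for x
      proof (cases "h x < e")
        case True
        then have "h' x = 0" by (simp add: h'_def)
        moreover have "indicator W x \<le> (indicator V x :: real)" by (auto simp: W_def indicator_def)
        ultimately show ?thesis using k1[of x] by linarith
      next
        case False
        then have "k x = 0" using k1[of x] by (auto simp: W_def)
        then show ?thesis using False h1[of x] e
          by (cases "x \<in> U"; cases "x \<in> V") (auto simp: h'_def)
      qed
      then have "(\<lambda>x. h' x + k x) \<in> below V" using h'A kA by (auto simp: below_def add_mem)
      from content_upper[OF this] show ?thesis
        using I_add[OF h'A kA] I_nonneg[OF h'A h'0] I_nonneg[OF kA k1(1)] by simp
    qed
    then have "ennreal (I h') + content W \<le> content V"
      unfolding content_def[of W] using zero_below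
      by (subst ennreal_SUP_add_right) (auto intro!: SUP_least)
    moreover have "outer (V - U) \<le> content W"
      using outer_mono[OF sub] outer_open[OF W] by simp
    moreover have "I h \<le> I h' + e"
    proof -
      have "I h \<le> I (\<lambda>x. h' x + e)"
      proof (rule I_mono)
        show "(\<lambda>x. h' x + e) \<in> A" by (intro add_mem h'A const_mem)
      qed (auto intro: hA simp: h'_def)
      then show ?thesis using I_add[OF h'A const_mem] by (simp add: I_const)
    qed
    then have "ennreal (I h) \<le> ennreal (I h') + ennreal e"
      using e I_nonneg[OF h'A h'0] by (simp flip: ennreal_plus add: ennreal_leI)
    ultimately show "ennreal (I h) + outer (V - U) \<le> content V + ennreal e"
      by (smt (verit) add.assoc add.commute add_mono order_trans order_refl)
  qed
  have "below (U \<inter> V) \<noteq> {}" using zero_below by blast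
  then have "content (U \<inter> V) + outer (V - U) = (SUP h\<in>below (U \<inter> V). ennreal (I h) + outer (V - U))"
    unfolding content_def[of "U \<inter> V"] by (rule ennreal_SUP_add_left[symmetric])
  also have "\<dots> \<le> content V" using main by (intro SUP_least)
  finally show ?thesis .
qed

lemma outer_Un_le: "outer (E \<union> F) \<le> outer E + outer F"
proof -
  have "outer (\<Union>i. (\<lambda>n. case n of 0 \<Rightarrow> E | Suc m \<Rightarrow> (case m of 0 \<Rightarrow> F | Suc _ \<Rightarrow> {})) i)
     \<le> (\<Sum>i. outer ((\<lambda>n. case n of 0 \<Rightarrow> E | Suc m \<Rightarrow> (case m of 0 \<Rightarrow> F | Suc _ \<Rightarrow> {})) i))"
    by (rule outer_UN_le)
  moreover have "(\<Union>i. (\<lambda>n. case n of 0 \<Rightarrow> E | Suc m \<Rightarrow> (case m of 0 \<Rightarrow> F | Suc _ \<Rightarrow> {})) i) = E \<union> F"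
    by (auto split: nat.splits)
  moreover have "(\<Sum>i. outer ((\<lambda>n. case n of 0 \<Rightarrow> E | Suc m \<Rightarrow> (case m of 0 \<Rightarrow> F | Suc _ \<Rightarrow> {})) i))
      = outer E + outer F"
  proof -
    have "outer {} = 0" using outer_open[of "{}"] content_empty by simp
    then show ?thesis
      by (subst suminf_finite[of "{0, 1}"]) (auto split: nat.splits)
  qed
  ultimately show ?thesis by simp
qed

lemma open_in_lambda_system:
  assumes U: "open U"
  shows "U \<in> lambda_system UNIV UNIV outer"
proof -
  have "outer (U \<inter> E) + outer (E - U) \<le> outer E" for E
  proof -
    have "outer (U \<inter> E) + outer (E - U) \<le> content V" if V: "open V" "E \<subseteq> V" for V
    proof -
      have "outer (U \<inter> E) \<le> content (U \<inter> V)"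
        using outer_mono[of "U \<inter> E" "U \<inter> V"] outer_open[OF open_Int[OF U V(1)]] V(2) by auto
      moreover have "outer (E - U) \<le> outer (V - U)" using V by (intro outer_mono) auto
      ultimately show ?thesis
        using content_split[OF U V(1)] add_mono order_trans by blast
    qed
    then show ?thesis unfolding outer_def[of E] by (intro INF_greatest) auto
  qed
  moreover have "outer E \<le> outer (U \<inter> E) + outer (E - U)" for E
    using outer_Un_le[of "U \<inter> E" "E - U"] by (metis Int_commute Int_Diff_Un)
  moreover have "(UNIV - U) \<inter> E = E - U" for E by auto
  ultimately show ?thesis
    unfolding lambda_system_def by (auto intro: antisym)
qed

definition representing_measure :: "'b measure" where
  "representing_measure = measure_of UNIV (sets borel) outer"

lemma measure_space_outer: "measure_space UNIV (sets borel) outer"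
proof -
  have "measure_space UNIV (lambda_system UNIV UNIV outer) outer"
    using sigma_algebra.caratheodory_lemma[OF sigma_algebra_Pow[of "UNIV :: 'b set"], of outer]
      outer_measure_space by simp
  moreover have "sets borel \<subseteq> lambda_system UNIV UNIV outer"
  proof -
    have "sigma_algebra UNIV (lambda_system UNIV UNIV outer)"
      using calculation by (simp add: measure_space_def)
    then show ?thesis
      unfolding borel_def using open_in_lambda_system
      by (subst sets_measure_of) (auto dest: sigma_algebra.sigma_sets_subset[of _ _ "Collect open"])
  qed
  ultimately show ?thesis
    using measure_down[of UNIV] sets.sigma_algebra_axioms[of "borel :: 'b measure"]
    by (metis space_borel)
qed

lemma sets_representing [simp]: "sets representing_measure = sets borel"
  unfolding representing_measure_def
  using sets.sigma_sets_eq[of "borel :: 'b measure"] by (simp add: sets_measure_of)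

lemma emeasure_representing_open: "open U \<Longrightarrow> emeasure representing_measure U = content U"
  unfolding representing_measure_def
  using measure_space_outer outer_open[of U]
  by (subst emeasure_measure_of_sigma) (auto simp: measure_space_def)

section \<open>Total mass and the integral representation\<close>

lemma borel_prob_representing: "borel_prob representing_measure"
proof -
  have "space representing_measure = UNIV" using sets_eq_imp_space_eq[OF sets_representing] by simp
  then show ?thesis
    unfolding borel_prob_def
    by (auto intro!: prob_spaceI simp: emeasure_representing_open content_UNIV)
qed

text \<open>Layer-cake decomposition: \<open>p j\<close> is the slice of \<open>h\<close> between
  the levels \<open>j/n\<close> and \<open>(j+1)/n\<close>. Scaled by \<open>n\<close> it lies in
  \<open>below (U j)\<close>, so its value under \<open>I\<close> is at most
  \<open>measure (U j) / n\<close>; and the indicators of the sets \<open>U j\<close> add up to at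
  most \<open>n * h + 1\<close>, which costs \<open>1/n\<close>.\<close>

lemma I_le_integral:
  assumes h: "h \<in> A" and h01: "\<And>x. 0 \<le> h x" "\<And>x. h x \<le> 1"
  shows "I h \<le> (\<integral>x. h x \<partial>representing_measure)"
proof -
  let ?M = representing_measure
  interpret prob_space ?M using borel_prob_representing by (simp add: borel_prob_def)
  have meas: "k \<in> borel_measurable ?M" if "k \<in> A" for k
    using borel_measurable_continuous_onI[OF continuous[OF that]] measurable_cong_sets[OF sets_representing refl]
    by blast
  have inth: "integrable ?M h"
    using h01 by (intro integrable_const_bound[of _ 1] meas h) auto
  have "I h \<le> (\<integral>x. h x \<partial>?M) + 1 / real n" if n: "n > 0" for n :: nat
  proof -
    define p where "p j x = max 0 (min (1 / real n) (h x - real j / real n))" for j x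
    define U where "U j = {x. real j / real n < h x}" for j
    have pA: "p j \<in> A" for j
      unfolding p_def by (intro max_mem min_mem diff_mem const_mem h)
    have U: "open (U j)" for j
      unfolding U_def using continuous[OF h] by (intro open_Collect_less) auto
    have sum_p: "(\<Sum>j<m. p j x) = min (h x) (real m / real n)" for m x
    proof (induction m)
      case 0 then show ?case using h01(1)[of x] by simp
    next
      case (Suc m)
      define c where "c = 1 / real n"
      define d where "d = real m / real n"
      have "real (Suc m) / real n = d + c" by (simp add: add_divide_distrib c_def d_def)
      moreover have "c > 0" using n by (simp add: c_def)
      then have "min a d + max 0 (min c (a - d)) = min a (d + c)" for a by (auto simp: min_def max_def)
      ultimately show ?case using Suc by (simp add: p_def flip: c_def d_def)
    qed
    have "I h = I (\<lambda>x. \<Sum>j<n. p j x)"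
    proof -
      have "(\<Sum>j<n. p j x) = h x" for x using sum_p[of x n] h01(2)[of x] n by simp
      then show ?thesis by simp
    qed
    also have "\<dots> = (\<Sum>j<n. I (p j))" using pA by (intro I_sum) auto
    also have "\<dots> \<le> (\<Sum>j<n. measure ?M (U j) / real n)"
    proof (rule sum_mono)
      fix j
      have np: "real n * p j x = max 0 (min 1 (real n * h x - real j))" for x
        using n by (simp add: p_def max_mult_distrib_left min_mult_distrib_left right_diff_distrib)
      have "x \<in> U j \<longleftrightarrow> real j < real n * h x" for x using n by (simp add: U_def field_simps)
      then have "(\<lambda>x. real n * p j x) \<in> below (U j)"
        using scale_mem[OF pA, of "real n" j] unfolding np by (auto simp: below_def indicator_def)
      from content_upper[OF this] have "ennreal (real n * I (p j)) \<le> emeasure ?M (U j)"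
        using emeasure_representing_open[OF U] I_scale[OF pA] by simp
      then have "real n * I (p j) \<le> measure ?M (U j)"
        by (simp add: emeasure_eq_measure)
      then show "I (p j) \<le> measure ?M (U j) / real n" using n by (simp add: field_simps)
    qed
    also have "\<dots> = (\<integral>x. (\<Sum>j<n. indicator (U j) x / real n) \<partial>?M)"
      using U by (subst Bochner_Integration.integral_sum) (auto simp: integrable_real_indicator emeasure_eq_measure)
    also have "\<dots> \<le> (\<integral>x. h x + 1 / real n \<partial>?M)"
    proof (rule integral_mono)
      show "integrable ?M (\<lambda>x. \<Sum>j<n. indicator (U j) x / real n)"
        using U by (intro Bochner_Integration.integrable_sum integrable_divide integrable_real_indicator)
          (auto simp: emeasure_eq_measure)
      show "integrable ?M (\<lambda>x. h x + 1 / real n)" using inth by simp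
      fix x
      have "(\<Sum>j<m. indicator (U j) x) \<le> real n * h x + 1" for m
      proof (induction m)
        case 0 then show ?case using h01(1)[of x] n by simp
      next
        case (Suc m)
        show ?case
        proof (cases "x \<in> U m")
          case True
          have "(\<Sum>j<m. indicator (U j) x :: real) \<le> (\<Sum>j<m. 1)"
            by (intro sum_mono) (simp add: indicator_def)
          moreover have "real m < real n * h x" using True n by (simp add: U_def field_simps)
          ultimately show ?thesis using True by simp
        next
          case False then show ?thesis using Suc by simp
        qed
      qed
      then show "(\<Sum>j<n. indicator (U j) x / real n) \<le> h x + 1 / real n"
        using n by (simp add: sum_divide_distrib[symmetric] field_simps)
    qed
    also have "\<dots> = (\<integral>x. h x \<partial>?M) + 1 / real n" using inth by (simp add: prob_space)
    finally show ?thesis .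
  qed
  note le = this
  show ?thesis
  proof (rule field_le_epsilon)
    fix e :: real assume "0 < e"
    then obtain n where "n > 0" "1 / real n < e"
      using ex_inverse_of_nat_less[of e] by (auto simp: inverse_eq_divide)
    with le[of n] show "I h \<le> (\<integral>x. h x \<partial>?M) + e" by linarith
  qed
qed

text \<open>An affine change brings \<open>h\<close> into the unit interval as \<open>k\<close>. The
  reverse inequality is \<open>I_le_integral\<close> for \<open>1 - k\<close>, since both
  functionals send 1 to 1.\<close>

lemma integral_representing:
  assumes h: "h \<in> A"
  shows "(\<integral>x. h x \<partial>representing_measure) = I h"
proof -
  let ?M = representing_measure
  interpret prob_space ?M using borel_prob_representing by (simp add: borel_prob_def)
  have "bounded (range h)"
    using compact_continuous_image[OF continuous[OF h] compact_space] by (rule compact_imp_bounded)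
  then obtain b where b: "b > 0" "\<And>x. \<bar>h x\<bar> \<le> b" by (auto simp: bounded_pos)
  define k where "k x = (1 / (2 * b)) * (h x + b)" for x
  have kA: "k \<in> A" unfolding k_def by (intro scale_mem add_mem h const_mem)
  have k01: "0 \<le> k x" "k x \<le> 1" for x
    using b(1) b(2)[of x] by (auto simp: k_def field_simps abs_le_iff)
  have hk: "h x = 2 * b * k x - b" for x using b(1) by (simp add: k_def field_simps)
  have int: "integrable ?M k"
  proof (rule integrable_const_bound[of _ 1])
    show "k \<in> borel_measurable ?M"
      using borel_measurable_continuous_onI[OF continuous[OF kA]] measurable_cong_sets[OF sets_representing refl]
      by blast
  qed (use k01 in auto)
  have "I (\<lambda>x. 1 - k x) \<le> (\<integral>x. 1 - k x \<partial>?M)"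
    using k01 by (intro I_le_integral diff_mem const_mem kA) auto
  then have "(\<integral>x. k x \<partial>?M) \<le> I k"
    using int by (simp add: I_diff const_mem kA I_const prob_space)
  with I_le_integral[OF kA k01] have "(\<integral>x. k x \<partial>?M) = I k" by simp
  moreover have "I h = 2 * b * I k - b"
    unfolding hk using I_diff[OF scale_mem[OF kA] const_mem] by (simp add: I_scale kA I_const)
  ultimately show ?thesis unfolding hk using int by (simp add: prob_space)
qed

end

section \<open>The Ruelle operator on Lipschitz functions\<close>

text \<open>The set \<open>Lip\<close> hides the constant on which the contraction rate and the
  admissible perturbations depend; \<open>lip\<close> keeps it visible.\<close>

definition lip :: "real \<Rightarrow> ((nat \<Rightarrow> 'a::metric_space) \<Rightarrow> real) \<Rightarrow> bool" where
  "lip C w \<longleftrightarrow> 0 \<le> C \<and> (\<forall>x y. \<bar>w x - w y\<bar> \<le> C * seq_dist x y)"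

text \<open>
  \<open>exp_lip K r w\<close>: the function \<open>w\<close> is \<open>r\<close>-Lipschitz for the bounded metric \<open>1 - exp (- 2 K d)\<close>.
\<close>

definition exp_lip :: "real \<Rightarrow> real \<Rightarrow> ((nat \<Rightarrow> 'a::metric_space) \<Rightarrow> real) \<Rightarrow> bool" where
  "exp_lip K r w \<longleftrightarrow> 0 \<le> r \<and> (\<forall>x y. w x - w y \<le> r * (1 - exp (- (2 * K * seq_dist x y))))"

definition contraction_rate :: "real \<Rightarrow> real" where
  "contraction_rate K = 1 - exp (- (3 * K / 2)) / 4"

lemma contraction_rate_bounds: "0 \<le> K \<Longrightarrow> 0 < contraction_rate K" "contraction_rate K < 1"
proof -
  show "contraction_rate K < 1" by (simp add: contraction_rate_def)
  assume "0 \<le> K"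
  then have "exp (- (3 * K / 2)) \<le> 1" by simp
  then show "0 < contraction_rate K" unfolding contraction_rate_def by linarith
qed

text \<open>
  With \<open>z = exp (- K d / 2)\<close>, the contraction estimate loses nothing but the passage from \<open>1 - z\<^sup>3\<close>
  to \<open>1 - z\<^sup>4\<close>; this is where the rate \<open>1 - exp (- 3 K / 2) / 4\<close> comes from.
\<close>

lemma one_minus_exp_cube_le:
  assumes "0 \<le> K" "0 \<le> d" "d \<le> 1"
  shows "1 - exp (- (3 * (K * d / 2))) \<le> contraction_rate K * (1 - exp (- (2 * K * d)))"
proof -
  define z where "z = exp (- (K * d / 2))"
  have z: "0 < z" "z \<le> 1" using assms by (auto simp: z_def)
  have z3: "exp (- (3 * (K * d / 2))) = z ^ 3"
    unfolding z_def by (simp flip: exp_of_nat_mult)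
  have z4: "exp (- (2 * K * d)) = z ^ 4"
    unfolding z_def by (simp flip: exp_of_nat_mult)
  have "K * d \<le> K" using assms by (simp add: mult_left_le)
  then have e: "exp (- (3 * K / 2)) \<le> z ^ 3" unfolding z3[symmetric] by simp
  have "1 - z ^ 4 = (1 - z) * (1 + z + z ^ 2 + z ^ 3)" by (simp add: algebra_simps eval_nat_numeral)
  also have "\<dots> \<le> (1 - z) * 4"
    using z power_le_one[of z 2] power_le_one[of z 3] by (intro mult_left_mono) auto
  finally have "exp (- (3 * K / 2)) * (1 - z ^ 4) \<le> z ^ 3 * ((1 - z) * 4)"
    using e z by (intro mult_mono) (auto simp: power_le_one)
  also have "\<dots> = 4 * (z ^ 3 - z ^ 4)" by (simp add: algebra_simps eval_nat_numeral)
  finally have "exp (- (3 * K / 2)) / 4 * (1 - z ^ 4) \<le> z ^ 3 - z ^ 4" by simp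
  then show ?thesis
    unfolding z3 z4 contraction_rate_def by (subst left_diff_distrib) simp
qed

section \<open>Calculus of Lipschitz constants\<close>

lemma exp_lip_add: "exp_lip K r v \<Longrightarrow> exp_lip K s w \<Longrightarrow> exp_lip K (r + s) (\<lambda>x. v x + w x)"
  unfolding exp_lip_def by (auto simp: distrib_right add_diff_add intro!: add_mono)

lemma exp_lip_add_const: "exp_lip K r w \<Longrightarrow> exp_lip K r (\<lambda>x. w x + c)"
  unfolding exp_lip_def by simp

lemma seq_dist_self: "seq_dist x x = 0"
  by (simp add: seq_dist_def)

lemma seq_dist_commute: "seq_dist x y = seq_dist y x"
  by (simp add: seq_dist_def dist_commute)

lemma exp_lip_abs: "exp_lip K r w \<Longrightarrow> \<bar>w x - w y\<bar> \<le> r * (1 - exp (- (2 * K * seq_dist x y)))"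
  unfolding exp_lip_def by (metis abs_le_iff minus_diff_eq seq_dist_commute)

text \<open>The metric is bounded by 1, so one seminorm controls modulus of continuity and
  oscillation together.\<close>

lemma exp_lip_osc: "exp_lip K r w \<Longrightarrow> \<bar>w x - w y\<bar> \<le> r"
  using exp_lip_abs[of K r w x y] unfolding exp_lip_def
  by (smt (verit) exp_ge_zero mult_left_le)

lemma prepend_simps [simp]: "prepend a x 0 = a" "prepend a x (Suc n) = x n"
  by (auto simp: prepend_def)

lemma shift_prepend [simp]: "shift_map (prepend a x) = x"
  by (auto simp: shift_map_def)

lemma LipI: "lip C w \<Longrightarrow> w \<in> Lip"
  by (auto simp: lip_def Lip_def)

lemma lip_const: "lip 0 (\<lambda>_. c)"
  by (simp add: lip_def)

lemma lip_add: "lip C v \<Longrightarrow> lip D w \<Longrightarrow> lip (C + D) (\<lambda>x. v x + w x)"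
  unfolding lip_def by (smt (verit) distrib_right)

lemma lip_scale: "lip C w \<Longrightarrow> lip (\<bar>c\<bar> * C) (\<lambda>x. c * w x)"
  unfolding lip_def
  by (auto simp: abs_mult mult_left_mono mult.assoc simp flip: right_diff_distrib)

lemma lip_uminus: "lip C w \<Longrightarrow> lip C (\<lambda>x. - w x)"
  using lip_scale[of C w "-1"] by simp

lemma lip_diff: "lip C v \<Longrightarrow> lip D w \<Longrightarrow> lip (C + D) (\<lambda>x. v x - w x)"
  using lip_add[OF _ lip_uminus, of C v D w] by simp

lemma abs_exp_diff_le:
  fixes a b M :: real
  assumes "a \<le> M" "b \<le> M"
  shows "\<bar>exp a - exp b\<bar> \<le> exp M * \<bar>a - b\<bar>"
proof -
  have *: "exp p - exp q \<le> exp M * (p - q)" if "q \<le> p" "p \<le> M" for p q :: real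
  proof -
    have "exp p * (1 + (q - p)) \<le> exp p * exp (q - p)"
      by (intro mult_left_mono) (use exp_ge_add_one_self[of "q - p"] in auto)
    also have "\<dots> = exp q" by (simp flip: exp_add)
    finally have "exp p - exp q \<le> exp p * (p - q)" by (simp add: algebra_simps)
    also have "\<dots> \<le> exp M * (p - q)" using that by (intro mult_right_mono) auto
    finally show ?thesis .
  qed
  show ?thesis
    using *[of a b] *[of b a] assms by (cases "a \<le> b") auto
qed

lemma lip_exp:
  assumes "lip C w" "\<And>x. w x \<le> M"
  shows "lip (exp M * C) (\<lambda>x. exp (w x))"
  unfolding lip_def
proof (intro conjI allI)
  show "0 \<le> exp M * C" using assms by (auto simp: lip_def)
  fix x y
  have "\<bar>exp (w x) - exp (w y)\<bar> \<le> exp M * \<bar>w x - w y\<bar>" using assms by (intro abs_exp_diff_le)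
  also have "\<dots> \<le> exp M * (C * seq_dist x y)" using assms by (intro mult_left_mono) (auto simp: lip_def)
  finally show "\<bar>exp (w x) - exp (w y)\<bar> \<le> exp M * C * seq_dist x y" by (simp add: mult.assoc)
qed

lemma lip_mult:
  assumes v: "lip C v" "\<And>x. \<bar>v x\<bar> \<le> B" and w: "lip D w" "\<And>x. \<bar>w x\<bar> \<le> E"
  shows "lip (B * D + E * C) (\<lambda>x. v x * w x)"
  unfolding lip_def
proof (intro conjI allI)
  have BE: "0 \<le> B" "0 \<le> E"
    using v(2)[of undefined] w(2)[of undefined] by (auto intro: order_trans[OF abs_ge_zero])
  then show "0 \<le> B * D + E * C" using v(1) w(1) by (auto simp: lip_def)
  fix x y
  have "v x * w x - v y * w y = v x * (w x - w y) + w y * (v x - v y)" by (simp add: algebra_simps)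
  then have "\<bar>v x * w x - v y * w y\<bar> \<le> \<bar>v x\<bar> * \<bar>w x - w y\<bar> + \<bar>w y\<bar> * \<bar>v x - v y\<bar>"
    by (metis abs_mult abs_triangle_ineq)
  also have "\<dots> \<le> B * (D * seq_dist x y) + E * (C * seq_dist x y)"
    using v w BE by (intro add_mono mult_mono) (auto simp: lip_def)
  finally show "\<bar>v x * w x - v y * w y\<bar> \<le> (B * D + E * C) * seq_dist x y"
    by (simp add: algebra_simps)
qed

section \<open>Metric and topology of the sequence space\<close>

locale full_shift =
  fixes \<nu> :: "'a::metric_space measure"
  assumes compact_alphabet: "compact (UNIV :: 'a set)"
    and dist_le_1: "\<And>a b :: 'a. dist a b \<le> 1"
    and borel_prob_nu: "borel_prob \<nu>"
begin

sublocale nu: prob_space \<nu>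
  using borel_prob_nu by (simp add: borel_prob_def)

lemma sets_nu: "sets \<nu> = sets borel"
  using borel_prob_nu by (simp add: borel_prob_def)

lemma seq_dist_nonneg: "0 \<le> seq_dist (x :: nat \<Rightarrow> 'a) y"
  unfolding seq_dist_def by (intro suminf_nonneg seq_dist_summable dist_le_1) auto

lemma seq_dist_le_1: "seq_dist (x :: nat \<Rightarrow> 'a) y \<le> 1"
  using seq_dist_le[OF dist_le_1, of 0 0 x y] by simp

lemma seq_dist_triangle: "seq_dist (x :: nat \<Rightarrow> 'a) z \<le> seq_dist x y + seq_dist y z"
proof -
  note s = seq_dist_summable[OF dist_le_1]
  have "seq_dist x z \<le> (\<Sum>n. (1/2) ^ Suc n * dist (x n) (y n) + (1/2) ^ Suc n * dist (y n) (z n))"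
    unfolding seq_dist_def
    by (intro suminf_le s summable_add) (auto simp: dist_triangle mult_left_mono simp flip: distrib_left)
  also have "\<dots> = seq_dist x y + seq_dist y z"
    unfolding seq_dist_def by (intro suminf_add[symmetric] s)
  finally show ?thesis .
qed

lemma seq_dist_prepend: "seq_dist (prepend a x) (prepend a y) = seq_dist x y / 2" for a :: 'a
proof -
  note s = seq_dist_summable[OF dist_le_1]
  have "seq_dist (prepend a x) (prepend a y)
      = (\<Sum>n. (1/2) * ((1/2) ^ Suc n * dist (x n) (y n)))"
    unfolding seq_dist_def
    using suminf_split_head[OF s[of "prepend a x" "prepend a y"]] by (simp add: mult_ac)
  also have "\<dots> = (1/2) * seq_dist x y"
    unfolding seq_dist_def by (intro suminf_mult s)
  finally show ?thesis by simp
qed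

lemma seq_dist_shift: "seq_dist (shift_map x) (shift_map y) \<le> 2 * seq_dist (x :: nat \<Rightarrow> 'a) y"
proof -
  note s = seq_dist_summable[OF dist_le_1]
  have "seq_dist x y = (\<Sum>n. (1/2) * ((1/2) ^ Suc n * dist (shift_map x n) (shift_map y n)))
      + 1/2 * dist (x 0) (y 0)"
    unfolding seq_dist_def
    using suminf_split_head[OF s[of x y]] by (simp add: shift_map_def mult_ac)
  also have "(\<Sum>n. (1/2) * ((1/2) ^ Suc n * dist (shift_map x n) (shift_map y n)))
      = (1/2) * seq_dist (shift_map x) (shift_map y)"
    unfolding seq_dist_def by (intro suminf_mult s)
  finally show ?thesis using zero_le_dist[of "x 0" "y 0"] by simp
qed

lemma lipE:
  fixes w :: "(nat \<Rightarrow> 'a) \<Rightarrow> real"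
  assumes "w \<in> Lip"
  obtains C where "0 \<le> C" "lip C w"
proof -
  from assms obtain C where C: "\<And>x y. \<bar>w x - w y\<bar> \<le> C * seq_dist x y" by (auto simp: Lip_def)
  have "C * seq_dist x y \<le> max C 0 * seq_dist x y" for x y :: "nat \<Rightarrow> 'a"
    using seq_dist_nonneg by (intro mult_right_mono) auto
  then have "lip (max C 0) w" unfolding lip_def using C order_trans by (metis max.cobounded2)
  then show ?thesis using that[of "max C 0"] by simp
qed

lemma exp_lip_mono:
  fixes w :: "(nat \<Rightarrow> 'a) \<Rightarrow> real"
  assumes "exp_lip K r w" "0 \<le> K" "r \<le> r'"
  shows "exp_lip K r' w"
  unfolding exp_lip_def
proof (intro conjI allI)
  show "0 \<le> r'" using assms by (auto simp: exp_lip_def)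
  fix x y :: "nat \<Rightarrow> 'a"
  have "r * (1 - exp (- (2 * K * seq_dist x y))) \<le> r' * (1 - exp (- (2 * K * seq_dist x y)))"
    using assms seq_dist_nonneg[of x y] by (intro mult_right_mono) auto
  moreover have "w x - w y \<le> r * (1 - exp (- (2 * K * seq_dist x y)))"
    using assms(1) by (simp add: exp_lip_def)
  ultimately show "w x - w y \<le> r' * (1 - exp (- (2 * K * seq_dist x y)))" by linarith
qed

lemma lip_mono: "lip C w \<Longrightarrow> C \<le> D \<Longrightarrow> lip D w" for w :: "(nat \<Rightarrow> 'a) \<Rightarrow> real"
  unfolding lip_def by (smt (verit) mult_right_mono seq_dist_nonneg)

lemma Lip_bounded:
  fixes w :: "(nat \<Rightarrow> 'a) \<Rightarrow> real"
  assumes "w \<in> Lip"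
  obtains B where "0 \<le> B" "\<And>x. \<bar>w x\<bar> \<le> B"
proof -
  obtain C where C: "0 \<le> C" "lip C w" using lipE[OF assms] by blast
  have "\<bar>w x\<bar> \<le> \<bar>w undefined\<bar> + C" for x
  proof -
    have "\<bar>w x - w undefined\<bar> \<le> C * seq_dist x undefined" using C by (auto simp: lip_def)
    also have "\<dots> \<le> C" using C(1) seq_dist_le_1[of x undefined] by (simp add: mult_left_le)
    finally show ?thesis by linarith
  qed
  then show ?thesis using that[of "\<bar>w undefined\<bar> + C"] C(1) by auto
qed

lemma Lip_const: "(\<lambda>_ :: nat \<Rightarrow> 'a. c) \<in> Lip"
  using lip_const LipI by blast

lemma Lip_add: "v \<in> Lip \<Longrightarrow> w \<in> Lip \<Longrightarrow> (\<lambda>x. v x + w x) \<in> Lip" for v :: "(nat \<Rightarrow> 'a) \<Rightarrow> real"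
  by (metis LipI lipE lip_add)

lemma Lip_diff: "v \<in> Lip \<Longrightarrow> w \<in> Lip \<Longrightarrow> (\<lambda>x. v x - w x) \<in> Lip" for v :: "(nat \<Rightarrow> 'a) \<Rightarrow> real"
  by (metis LipI lipE lip_diff)

lemma Lip_scale: "w \<in> Lip \<Longrightarrow> (\<lambda>x. c * w x) \<in> Lip" for w :: "(nat \<Rightarrow> 'a) \<Rightarrow> real"
  by (metis LipI lipE lip_scale)

lemma Lip_uminus: "w \<in> Lip \<Longrightarrow> (\<lambda>x. - w x) \<in> Lip" for w :: "(nat \<Rightarrow> 'a) \<Rightarrow> real"
  by (metis LipI lipE lip_uminus)

lemma Lip_mult: "v \<in> Lip \<Longrightarrow> w \<in> Lip \<Longrightarrow> (\<lambda>x. v x * w x) \<in> Lip" for v :: "(nat \<Rightarrow> 'a) \<Rightarrow> real"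
  by (metis LipI lipE lip_mult Lip_bounded)

lemma Lip_exp: "w \<in> Lip \<Longrightarrow> (\<lambda>x. exp (w x)) \<in> Lip" for w :: "(nat \<Rightarrow> 'a) \<Rightarrow> real"
  by (metis LipI lipE lip_exp Lip_bounded abs_le_D1)

lemma Lip_max:
  fixes v w :: "(nat \<Rightarrow> 'a) \<Rightarrow> real"
  assumes "v \<in> Lip" "w \<in> Lip"
  shows "(\<lambda>x. max (v x) (w x)) \<in> Lip"
proof -
  obtain C D where C: "lip C v" "lip D w" using lipE assms by metis
  have "\<bar>max (v x) (w x) - max (v y) (w y)\<bar> \<le> max C D * seq_dist x y" for x y
  proof -
    have "C * seq_dist x y \<le> max C D * seq_dist x y" "D * seq_dist x y \<le> max C D * seq_dist x y"
      by (auto intro!: mult_right_mono seq_dist_nonneg)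
    moreover have "\<bar>v x - v y\<bar> \<le> C * seq_dist x y" "\<bar>w x - w y\<bar> \<le> D * seq_dist x y"
      using C by (auto simp: lip_def)
    ultimately show ?thesis by linarith
  qed
  then show ?thesis by (auto simp: Lip_def)
qed

lemma lip_shift: "lip C w \<Longrightarrow> lip (2 * C) (\<lambda>x. w (shift_map x))" for w :: "(nat \<Rightarrow> 'a) \<Rightarrow> real"
  unfolding lip_def
proof (intro conjI allI)
  fix x y :: "nat \<Rightarrow> 'a"
  assume a: "0 \<le> C \<and> (\<forall>x y. \<bar>w x - w y\<bar> \<le> C * seq_dist x y)"
  then have "\<bar>w (shift_map x) - w (shift_map y)\<bar> \<le> C * seq_dist (shift_map x) (shift_map y)" by blast
  also have "\<dots> \<le> C * (2 * seq_dist x y)" using a seq_dist_shift by (intro mult_left_mono) auto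
  finally show "\<bar>w (shift_map x) - w (shift_map y)\<bar> \<le> 2 * C * seq_dist x y" by simp
qed auto

lemma Lip_shift: "w \<in> Lip \<Longrightarrow> (\<lambda>x. w (shift_map x)) \<in> Lip" for w :: "(nat \<Rightarrow> 'a) \<Rightarrow> real"
  by (metis LipI lipE lip_shift)

lemma Lip_continuous:
  fixes w :: "(nat \<Rightarrow> 'a) \<Rightarrow> real"
  assumes "w \<in> Lip"
  shows "continuous_on UNIV w"
proof -
  obtain C where C: "0 \<le> C" "lip C w" using lipE[OF assms] by blast
  have "open (w -` B)" if B: "open B" for B
    unfolding open_iff_seq_dist[OF dist_le_1]
  proof
    fix x assume "x \<in> w -` B"
    then obtain e where e: "e > 0" "\<And>s. dist s (w x) < e \<Longrightarrow> s \<in> B"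
      using B by (auto simp: open_dist)
    \<comment> \<open>The denominator \<open>C + 1\<close> covers constant functions, where
      \<open>C\<close> may be 0.\<close>
    have "w y \<in> B" if "seq_dist x y < e / (C + 1)" for y
    proof -
      have "\<bar>w x - w y\<bar> \<le> C * seq_dist x y" using C by (auto simp: lip_def)
      also have "\<dots> \<le> (C + 1) * seq_dist x y" using seq_dist_nonneg by (intro mult_right_mono) auto
      also have "\<dots> < e" using that C(1) by (simp add: field_simps)
      finally show ?thesis using e(2)[of "w y"] by (simp add: dist_real_def)
    qed
    then show "\<exists>e>0. \<forall>y. seq_dist x y < e \<longrightarrow> y \<in> w -` B"
      using e(1) C(1) by (intro exI[of _ "e / (C + 1)"]) auto
  qed
  then show ?thesis by (simp add: continuous_on_open_vimage)
qed

lemma Lip_measurable: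
  fixes w :: "(nat \<Rightarrow> 'a) \<Rightarrow> real"
  assumes "w \<in> Lip" "borel_prob \<mu>"
  shows "w \<in> borel_measurable \<mu>"
  using borel_measurable_continuous_onI[OF Lip_continuous[OF assms(1)]] assms(2)
    measurable_cong_sets[of \<mu> borel borel borel] by (auto simp: borel_prob_def)

lemma Lip_integrable:
  fixes w :: "(nat \<Rightarrow> 'a) \<Rightarrow> real"
  assumes "w \<in> Lip" "borel_prob \<mu>"
  shows "integrable \<mu> w"
proof -
  interpret prob_space \<mu> using assms(2) by (simp add: borel_prob_def)
  obtain B where B: "\<And>x. \<bar>w x\<bar> \<le> B" using Lip_bounded[OF assms(1)] by blast
  show ?thesis by (rule integrable_const_bound[of _ B]) (use B Lip_measurable[OF assms] in auto)
qed

lemma prepend_continuous: "continuous_on UNIV (\<lambda>a. prepend a (x :: nat \<Rightarrow> 'a))"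
proof (rule continuous_on_coordinatewise_then_product)
  show "continuous_on UNIV (\<lambda>a. prepend a x i)" for i
    by (cases i) (auto intro: continuous_intros)
qed

lemma prepend_measurable:
  fixes w :: "(nat \<Rightarrow> 'a) \<Rightarrow> real"
  assumes "continuous_on UNIV w"
  shows "(\<lambda>a. w (prepend a x)) \<in> borel_measurable \<nu>"
proof -
  have "continuous_on UNIV (\<lambda>a. w (prepend a x))"
    by (rule continuous_on_compose2[OF assms prepend_continuous]) auto
  then show ?thesis
    using borel_measurable_continuous_onI measurable_cong_sets[OF sets_nu refl] by blast
qed

lemma prepend_integrable:
  fixes w :: "(nat \<Rightarrow> 'a) \<Rightarrow> real"
  assumes "w \<in> Lip"
  shows "integrable \<nu> (\<lambda>a. w (prepend a x))"
proof -
  obtain B where B: "\<And>x. \<bar>w x\<bar> \<le> B" using Lip_bounded[OF assms(1)] by blast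
  show ?thesis
    by (rule nu.integrable_const_bound[of _ B])
      (use B prepend_measurable[OF Lip_continuous[OF assms]] in auto)
qed

lemma compact_sequences: "compact (UNIV :: (nat \<Rightarrow> 'a) set)"
proof -
  have "compact_space (product_topology (\<lambda>_ :: nat. euclidean :: 'a topology) UNIV)"
    unfolding compact_space_product_topology
    using compact_alphabet by (simp add: compact_space_def)
  then show ?thesis
    by (simp add: euclidean_product_topology compact_space_def)
qed

section \<open>Elementary properties of the Ruelle operator\<close>

lemma ruelle_integrable:
  assumes "f \<in> Lip" "w \<in> Lip"
  shows "integrable \<nu> (\<lambda>a. exp (f (prepend a x)) * w (prepend a x))"
  using prepend_integrable[OF Lip_mult[OF Lip_exp[OF assms(1)] assms(2)]] by simp

lemma ruelle_add:
  "f \<in> Lip \<Longrightarrow> v \<in> Lip \<Longrightarrow> w \<in> Lip \<Longrightarrow>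
    ruelle \<nu> f (\<lambda>x. v x + w x) x = ruelle \<nu> f v x + ruelle \<nu> f w x"
  unfolding ruelle_def by (simp add: distrib_left ruelle_integrable)

lemma ruelle_diff:
  "f \<in> Lip \<Longrightarrow> v \<in> Lip \<Longrightarrow> w \<in> Lip \<Longrightarrow>
    ruelle \<nu> f (\<lambda>x. v x - w x) x = ruelle \<nu> f v x - ruelle \<nu> f w x"
  unfolding ruelle_def by (simp add: right_diff_distrib ruelle_integrable)

lemma ruelle_scale: "ruelle \<nu> f (\<lambda>x. c * w x) x = c * ruelle \<nu> f w x"
  unfolding ruelle_def by (simp add: mult.left_commute[of _ c])

lemma ruelle_mono:
  "f \<in> Lip \<Longrightarrow> v \<in> Lip \<Longrightarrow> w \<in> Lip \<Longrightarrow> (\<And>a. v (prepend a x) \<le> w (prepend a x)) \<Longrightarrow>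
    ruelle \<nu> f v x \<le> ruelle \<nu> f w x"
  unfolding ruelle_def by (intro integral_mono ruelle_integrable) auto

lemma ruelle_lip:
  assumes f: "f \<in> Lip" and w: "w \<in> Lip" and C: "lip C (\<lambda>x. exp (f x) * w x)"
  shows "lip (C / 2) (ruelle \<nu> f w)"
  unfolding lip_def
proof (intro conjI allI)
  show "0 \<le> C / 2" using C by (simp add: lip_def)
  fix x y
  have "\<bar>ruelle \<nu> f w x - ruelle \<nu> f w y\<bar>
      = \<bar>\<integral>a. exp (f (prepend a x)) * w (prepend a x) - exp (f (prepend a y)) * w (prepend a y) \<partial>\<nu>\<bar>"
    unfolding ruelle_def by (simp add: ruelle_integrable f w)
  also have "\<dots> \<le> (\<integral>a. \<bar>exp (f (prepend a x)) * w (prepend a x) - exp (f (prepend a y)) * w (prepend a y)\<bar> \<partial>\<nu>)"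
    by (rule integral_abs_bound)
  also have "\<dots> \<le> (\<integral>a. C / 2 * seq_dist x y \<partial>\<nu>)"
  proof (rule integral_mono)
    show "integrable \<nu> (\<lambda>a. \<bar>exp (f (prepend a x)) * w (prepend a x) - exp (f (prepend a y)) * w (prepend a y)\<bar>)"
      using ruelle_integrable[OF f w] by simp
    show "\<bar>exp (f (prepend a x)) * w (prepend a x) - exp (f (prepend a y)) * w (prepend a y)\<bar> \<le> C / 2 * seq_dist x y" for a
      using C seq_dist_prepend[of a x y] unfolding lip_def by (metis times_divide_eq_left times_divide_eq_right)
  qed simp
  finally show "\<bar>ruelle \<nu> f w x - ruelle \<nu> f w y\<bar> \<le> C / 2 * seq_dist x y"
    by (simp add: nu.prob_space)
qed

lemma ruelle_Lip:
  assumes "f \<in> Lip" "w \<in> Lip"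
  shows "ruelle \<nu> f w \<in> Lip"
proof -
  obtain C where "lip C (\<lambda>x. exp (f x) * w x)" using lipE[OF Lip_mult[OF Lip_exp[OF assms(1)] assms(2)]] by blast
  from LipI[OF ruelle_lip[OF assms this]] show ?thesis .
qed

text \<open>The factor comes from \<open>s <= (1 - exp (- s)) * (1 + s)\<close> at
  \<open>s = 2 K d\<close>, where \<open>s\<close> is at most \<open>2 K\<close> because distances
  are at most 1.\<close>

lemma lip_exp_lip:
  assumes "lip C (w :: (nat \<Rightarrow> 'a) \<Rightarrow> real)" "0 < K"
  shows "exp_lip K (C * ((1 + 2 * K) / (2 * K))) w"
  unfolding exp_lip_def
proof (intro conjI allI)
  have C: "0 \<le> C" using assms by (simp add: lip_def)
  then show "0 \<le> C * ((1 + 2 * K) / (2 * K))" using assms by auto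
  fix x y :: "nat \<Rightarrow> 'a"
  define s where "s = 2 * K * seq_dist x y"
  have s: "0 \<le> s" "s \<le> 2 * K" using assms seq_dist_nonneg[of x y] seq_dist_le_1[of x y] by (auto simp: s_def)
  have "exp (- s) * (1 + s) \<le> exp (- s) * exp s"
    using exp_ge_add_one_self[of s] by (intro mult_left_mono) auto
  then have "exp (- s) * (1 + s) \<le> 1" by (simp flip: exp_add)
  then have "s \<le> (1 - exp (- s)) * (1 + s)" by (simp add: algebra_simps)
  also have "\<dots> \<le> (1 - exp (- s)) * (1 + 2 * K)" using s by (intro mult_left_mono) auto
  finally have "seq_dist x y \<le> (1 + 2 * K) / (2 * K) * (1 - exp (- s))"
    using assms(2) by (simp add: s_def field_simps)
  then have "C * seq_dist x y \<le> C * ((1 + 2 * K) / (2 * K) * (1 - exp (- s)))"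
    using C by (rule mult_left_mono)
  moreover have "w x - w y \<le> C * seq_dist x y" using assms(1) abs_le_D1 by (auto simp: lip_def)
  ultimately show "w x - w y \<le> C * ((1 + 2 * K) / (2 * K)) * (1 - exp (- (2 * K * seq_dist x y)))"
    by (simp add: s_def mult.assoc)
qed

lemma exp_lip_lip:
  assumes "exp_lip K r (w :: (nat \<Rightarrow> 'a) \<Rightarrow> real)" "0 \<le> K"
  shows "lip (2 * K * r) w"
  unfolding lip_def
proof (intro conjI allI)
  have r: "0 \<le> r" using assms by (simp add: exp_lip_def)
  then show "0 \<le> 2 * K * r" using assms by simp
  fix x y :: "nat \<Rightarrow> 'a"
  have "r * (1 - exp (- (2 * K * seq_dist x y))) \<le> r * (2 * K * seq_dist x y)"
    using r exp_ge_add_one_self[of "- (2 * K * seq_dist x y)"] by (intro mult_left_mono) linarith+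
  then show "\<bar>w x - w y\<bar> \<le> 2 * K * r * seq_dist x y"
    using exp_lip_abs[OF assms(1), of x y] by (simp add: mult_ac)
qed

section \<open>Normalized potentials and the one-step contraction\<close>

lemma normalized_Lip: "N \<in> normalized_potentials \<nu> \<Longrightarrow> N \<in> Lip"
  and ruelle_one: "N \<in> normalized_potentials \<nu> \<Longrightarrow> ruelle \<nu> N (\<lambda>_. 1) x = 1"
  by (auto simp: normalized_potentials_def)

lemma ruelle_const: "N \<in> normalized_potentials \<nu> \<Longrightarrow> ruelle \<nu> N (\<lambda>_. c) x = c"
  using ruelle_one[of N x] ruelle_scale[of N c "\<lambda>_. 1" x] by simp

lemma ruelle_le_const:
  "N \<in> normalized_potentials \<nu> \<Longrightarrow> w \<in> Lip \<Longrightarrow> (\<And>a. w (prepend a x) \<le> c) \<Longrightarrow> ruelle \<nu> N w x \<le> c"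
  using ruelle_mono[OF normalized_Lip _ Lip_const, of N w x c] ruelle_const[of N c x] by simp

lemma ruelle_ge_const:
  "N \<in> normalized_potentials \<nu> \<Longrightarrow> w \<in> Lip \<Longrightarrow> (\<And>a. c \<le> w (prepend a x)) \<Longrightarrow> c \<le> ruelle \<nu> N w x"
  using ruelle_mono[OF normalized_Lip Lip_const, of N w c x] ruelle_const[of N c x] by simp

lemma exp_lip_sup:
  fixes w :: "(nat \<Rightarrow> 'a) \<Rightarrow> real"
  assumes w: "w \<in> Lip" "exp_lip K r w"
  obtains S where "\<And>x. w x \<le> S" "\<And>x. S - w x \<le> r"
proof
  obtain B where "\<And>x. \<bar>w x\<bar> \<le> B" using Lip_bounded[OF w(1)] by blast
  then have "bdd_above (range w)" by (auto simp: bdd_above_def abs_le_iff)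
  then show "w x \<le> (SUP x. w x)" for x by (rule cSUP_upper[OF UNIV_I])
  have "(SUP x. w x) \<le> w x + r" for x
    using exp_lip_osc[OF w(2), of _ x] by (intro cSUP_least) (auto simp: abs_le_iff algebra_simps)
  then show "(SUP x. w x) - w x \<le> r" for x by (simp add: algebra_simps)
qed

text \<open>
  The part \<open>z = exp (- K d / 2)\<close> of the transition probability at \<open>x\<close> shared with the one at \<open>y\<close>
  is transported by prepending the same symbol; the remainder is estimated by the oscillation of \<open>w\<close>.
\<close>

lemma ruelle_contraction:
  assumes N: "N \<in> normalized_potentials \<nu>" "lip K N" and w: "w \<in> Lip" "exp_lip K r w"
  shows "exp_lip K (contraction_rate K * r) (ruelle \<nu> N w)"
  unfolding exp_lip_def
proof (intro conjI allI)
  have K: "0 \<le> K" using N(2) by (simp add: lip_def)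
  have r: "0 \<le> r" using w(2) by (simp add: exp_lip_def)
  show "0 \<le> contraction_rate K * r" using contraction_rate_bounds(1)[OF K] r by simp
  note NL = normalized_Lip[OF N(1)]
  fix x y :: "nat \<Rightarrow> 'a"
  define d where "d = seq_dist x y"
  define z where "z = exp (- (K * d / 2))"
  obtain S where S: "\<And>x. w x \<le> S" and Sr: "\<And>x. S - w x \<le> r"
    using exp_lip_sup[OF w] by blast
  have d: "0 \<le> d" "d \<le> 1" by (auto simp: d_def seq_dist_nonneg seq_dist_le_1)
  have z: "0 < z" "z \<le> 1" using K d by (auto simp: z_def)
  \<comment> \<open>Prepending halves the distance, and at distance \<open>d / 2\<close> the bounded
    metric has the value \<open>1 - z^2\<close>.\<close>
  define \<delta> where "\<delta> = r * (1 - z ^ 2)"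
  have \<delta>: "w (prepend a x) - w (prepend a y) \<le> \<delta>" for a
  proof -
    have "z ^ 2 = exp (- (2 * K * seq_dist (prepend a x) (prepend a y)))"
      unfolding z_def seq_dist_prepend d_def by (simp flip: exp_of_nat_mult)
    then show ?thesis using w(2) unfolding exp_lip_def \<delta>_def by metis
  qed
  \<comment> \<open>The comparison of transition weights may be multiplied only by nonnegative
    functions; \<open>S - w\<close> is nonnegative and at most \<open>r\<close>.\<close>
  let ?v = "\<lambda>x. S - w x"
  have vL: "?v \<in> Lip" by (intro Lip_diff Lip_const w)
  have v: "ruelle \<nu> N ?v u = S - ruelle \<nu> N w u" for u
    using ruelle_diff[OF NL Lip_const[of S] w(1), of u] ruelle_const[OF N(1)] by simp
  have "z * ruelle \<nu> N (\<lambda>x. ?v x - \<delta>) y \<le> ruelle \<nu> N ?v x"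
  proof -
    have "z * ruelle \<nu> N (\<lambda>x. ?v x - \<delta>) y
        = (\<integral>a. z * (exp (N (prepend a y)) * (?v (prepend a y) - \<delta>)) \<partial>\<nu>)"
      unfolding ruelle_def by simp
    also have "\<dots> \<le> (\<integral>a. exp (N (prepend a x)) * ?v (prepend a x) \<partial>\<nu>)"
    proof (rule integral_mono)
      show "integrable \<nu> (\<lambda>a. z * (exp (N (prepend a y)) * (?v (prepend a y) - \<delta>)))"
        using ruelle_integrable[OF NL Lip_diff[OF vL Lip_const[of \<delta>]], of y] by simp
      show "integrable \<nu> (\<lambda>a. exp (N (prepend a x)) * ?v (prepend a x))"
        by (rule ruelle_integrable[OF NL vL])
      fix a
      have "z * exp (N (prepend a y)) \<le> exp (N (prepend a x))"
      proof -
        have "\<bar>N (prepend a x) - N (prepend a y)\<bar> \<le> K * (d / 2)"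
          using N(2) seq_dist_prepend[of a x y] unfolding lip_def d_def by metis
        then have "- (K * d / 2) + N (prepend a y) \<le> N (prepend a x)"
          unfolding times_divide_eq_right by linarith
        then show ?thesis unfolding z_def by (simp flip: exp_add)
      qed
      then have "z * exp (N (prepend a y)) * ?v (prepend a x) \<le> exp (N (prepend a x)) * ?v (prepend a x)"
        using S by (intro mult_right_mono) auto
      moreover have "z * exp (N (prepend a y)) * (?v (prepend a y) - \<delta>) \<le> z * exp (N (prepend a y)) * ?v (prepend a x)"
        using z \<delta>[of a] by (intro mult_left_mono) auto
      ultimately show "z * (exp (N (prepend a y)) * (?v (prepend a y) - \<delta>)) \<le> exp (N (prepend a x)) * ?v (prepend a x)"
        by (simp add: mult.assoc)
    qed
    finally show ?thesis by (simp add: ruelle_def)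
  qed
  then have "z * (S - ruelle \<nu> N w y - \<delta>) \<le> S - ruelle \<nu> N w x"
    using ruelle_diff[OF NL vL Lip_const[of \<delta>], of y] ruelle_const[OF N(1)] v by simp
  then have "ruelle \<nu> N w x - ruelle \<nu> N w y \<le> (1 - z) * (S - ruelle \<nu> N w y) + z * \<delta>"
    by (simp add: algebra_simps)
  also have "\<dots> \<le> (1 - z) * r + z * \<delta>"
  proof -
    have "S - r \<le> ruelle \<nu> N w y" using Sr by (intro ruelle_ge_const[OF N(1) w(1)]) (auto simp: algebra_simps)
    then show ?thesis using z by (intro add_right_mono mult_left_mono) auto
  qed
  also have "\<dots> = r * (1 - z ^ 3)" by (simp add: \<delta>_def algebra_simps eval_nat_numeral)
  also have "z ^ 3 = exp (- (3 * (K * d / 2)))" unfolding z_def by (simp flip: exp_of_nat_mult)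
  also have "r * (1 - \<dots>) \<le> r * (contraction_rate K * (1 - exp (- (2 * K * d))))"
    using one_minus_exp_cube_le[OF K d] r by (rule mult_left_mono)
  finally show "ruelle \<nu> N w x - ruelle \<nu> N w y \<le> contraction_rate K * r * (1 - exp (- (2 * K * seq_dist x y)))"
    by (simp add: d_def mult_ac)
qed

end

section \<open>Existence and uniqueness of the Gibbs measure\<close>

context full_shift
begin

section \<open>Lipschitz functions determine Borel probabilities\<close>

lemma exists_exp_lip:
  fixes w :: "(nat \<Rightarrow> 'a) \<Rightarrow> real"
  assumes "w \<in> Lip" "0 < K"
  obtains r where "0 \<le> r" "exp_lip K r w"
  using assms lipE lip_exp_lip by (metis exp_lip_def)

text \<open>The witness is the distance to the complement, which is 1-Lipschitz by the triangle
  inequality. The whole space is treated apart, as the infimum would then run over the empty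
  set.\<close>

lemma Lip_cozero:
  fixes U :: "(nat \<Rightarrow> 'a) set"
  assumes U: "open U"
  shows "\<exists>k\<in>Lip. \<forall>x. 0 \<le> k x \<and> (0 < k x \<longleftrightarrow> x \<in> U)"
proof (cases "U = UNIV")
  case True
  then show ?thesis by (intro bexI[OF _ Lip_const[of 1]]) auto
next
  case False
  define k where "k x = (INF y\<in>-U. seq_dist x y)" for x
  have ne: "- U \<noteq> {}" using False by auto
  have bdd: "bdd_below ((\<lambda>y. seq_dist x y) ` (- U))" for x
    using seq_dist_nonneg by (auto simp: bdd_below_def)
  have le: "k x \<le> k y + seq_dist x y" for x y
  proof -
    have "k x - seq_dist x y \<le> k y"
      unfolding k_def[of y]
    proof (rule cINF_greatest[OF ne])
      fix z assume "z \<in> - U"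
      then have "k x \<le> seq_dist x z" unfolding k_def by (rule cINF_lower[OF bdd])
      then show "k x - seq_dist x y \<le> seq_dist y z" using seq_dist_triangle[of x z y] by linarith
    qed
    then show ?thesis by linarith
  qed
  have "\<bar>k x - k y\<bar> \<le> 1 * seq_dist x y" for x y
    using le[of x y] le[of y x] seq_dist_commute[of x y] by linarith
  then have "k \<in> Lip" unfolding Lip_def by blast
  moreover have "0 \<le> k x" for x unfolding k_def by (intro cINF_greatest ne seq_dist_nonneg)
  moreover have "0 < k x" if "x \<in> U" for x
  proof -
    have "\<exists>e>0. \<forall>y. seq_dist x y < e \<longrightarrow> y \<in> U"
      using U that open_iff_seq_dist[OF dist_le_1, of U] by simp
    then obtain e where e: "e > 0" "\<And>y. seq_dist x y < e \<Longrightarrow> y \<in> U" by auto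
    have "e \<le> k x" unfolding k_def by (intro cINF_greatest ne) (use e(2) in \<open>auto simp: not_less[symmetric]\<close>)
    then show ?thesis using e(1) by linarith
  qed
  moreover have "k x \<le> 0" if "x \<notin> U" for x
    unfolding k_def using cINF_lower[OF bdd[of x], of x] that by (simp add: seq_dist_self)
  ultimately show ?thesis by (metis not_less)
qed

text \<open>Open sets form an intersection-stable generator, and the indicator of an open set is the
  bounded limit of the Lipschitz functions \<open>min 1 (n * k)\<close>.\<close>

lemma borel_prob_eqI:
  assumes \<mu>: "borel_prob \<mu>" and \<mu>': "borel_prob \<mu>'"
    and eq: "\<And>w :: (nat \<Rightarrow> 'a) \<Rightarrow> real. w \<in> Lip \<Longrightarrow> (\<integral>x. w x \<partial>\<mu>) = (\<integral>x. w x \<partial>\<mu>')"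
  shows "\<mu> = \<mu>'"
proof -
  have open_measure: "(\<lambda>n. \<integral>x. min 1 (real n * k x) \<partial>\<kappa>) \<longlonglongrightarrow> measure \<kappa> U"
    if \<kappa>: "borel_prob \<kappa>" and U: "open U" and k: "k \<in> Lip" "\<And>x. 0 \<le> k x" "\<And>x. 0 < k x \<longleftrightarrow> x \<in> U"
    for \<kappa> and U :: "(nat \<Rightarrow> 'a) set" and k
  proof -
    interpret prob_space \<kappa> using \<kappa> by (simp add: borel_prob_def)
    have sets: "sets \<kappa> = sets borel" using \<kappa> by (simp add: borel_prob_def)
    have "(\<lambda>n. \<integral>x. min 1 (real n * k x) \<partial>\<kappa>) \<longlonglongrightarrow> (\<integral>x. indicator U x \<partial>\<kappa>)"
    proof (rule integral_dominated_convergence[where w="\<lambda>_. 1"])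
      show "indicator U \<in> borel_measurable \<kappa>" using U sets by (intro borel_measurable_indicator) auto
      show "(\<lambda>x. min 1 (real n * k x)) \<in> borel_measurable \<kappa>" for n
        using Lip_measurable[OF k(1) \<kappa>] by measurable
      show "AE x in \<kappa>. (\<lambda>n. min 1 (real n * k x)) \<longlonglongrightarrow> indicator U x"
      proof (rule AE_I2)
        fix x
        show "(\<lambda>n. min 1 (real n * k x)) \<longlonglongrightarrow> indicator U x"
        proof (cases "x \<in> U")
          case True
          then have "0 < k x" using k by blast
          then obtain m where "1 / k x < real m" using reals_Archimedean2 by blast
          then have "min 1 (real n * k x) = 1" if "m \<le> n" for n
          proof -
            have "1 / k x < real n" using that \<open>1 / k x < real m\<close> by linarith
            then show ?thesis using \<open>0 < k x\<close> by (simp add: divide_less_eq)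
          qed
          then have "\<forall>\<^sub>F n in sequentially. min 1 (real n * k x) = 1"
            unfolding eventually_sequentially by blast
          then show ?thesis using True by (simp add: tendsto_eventually)
        next
          case False
          then have "k x = 0" using k(2)[of x] k(3)[of x] by auto
          then show ?thesis using False by simp
        qed
      qed
      show "AE x in \<kappa>. norm (min 1 (real n * k x)) \<le> 1" for n
        using mult_nonneg_nonneg[OF of_nat_0_le_iff k(2)] by (intro AE_I2) (simp add: min_def)
    qed simp
    then show ?thesis using U sets by simp
  qed
  have "emeasure \<mu> U = emeasure \<mu>' U" if U: "open U" for U
  proof -
    obtain k where k: "k \<in> Lip" "\<And>x. 0 \<le> k x" "\<And>x. 0 < k x \<longleftrightarrow> x \<in> U"
      using Lip_cozero[OF U] by blast
    have "(\<lambda>x. min 1 (real n * k x)) \<in> Lip" for n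
      using Lip_uminus[OF Lip_max[OF Lip_const[of "-1"] Lip_scale[OF k(1), of "- real n"]]]
      by (simp add: minus_max_eq_min)
    then have "measure \<mu> U = measure \<mu>' U"
      using LIMSEQ_unique[OF open_measure[OF \<mu> U k]] open_measure[OF \<mu>' U k] eq by simp
    then show ?thesis using \<mu> \<mu>'
      by (simp add: borel_prob_def prob_space_def finite_measure.emeasure_eq_measure)
  qed
  then show ?thesis
  proof (intro measure_eqI_generator_eq[where E="{U. open U}" and \<Omega>=UNIV and A="\<lambda>_. UNIV"])
    show "Int_stable {U :: (nat \<Rightarrow> 'a) set. open U}" by (auto simp: Int_stable_def)
    show "sets \<mu> = sigma_sets UNIV {U. open U}" "sets \<mu>' = sigma_sets UNIV {U. open U}"
      using \<mu> \<mu>' by (auto simp: borel_prob_def borel_def)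
    show "emeasure \<mu> UNIV \<noteq> \<infinity>"
      using \<mu> by (simp add: borel_prob_def prob_space_def finite_measure.emeasure_finite)
  qed auto
qed

end

text \<open>For \<open>K = 0\<close> the metric \<open>1 - exp (- 2 K d)\<close> degenerates to 0,
  and not every Lipschitz function would have a finite seminorm. Instances therefore enlarge a given
  constant by 1.\<close>

locale normalized_shift = full_shift \<nu> for \<nu> :: "'a::metric_space measure" +
  fixes N :: "(nat \<Rightarrow> 'a) \<Rightarrow> real" and K :: real
  assumes normalized: "N \<in> normalized_potentials \<nu>"
    and lip_N: "lip K N" and K_pos: "0 < K"
begin

lemmas N_Lip = normalized_Lip[OF normalized]
lemmas contraction = ruelle_contraction[OF normalized lip_N]

abbreviation \<kappa> :: real where "\<kappa> \<equiv> contraction_rate K"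

lemma \<kappa>_bounds: "0 < \<kappa>" "\<kappa> < 1"
  using contraction_rate_bounds[of K] K_pos by auto

section \<open>Iterates of the normalized operator and their limit\<close>

definition iter :: "nat \<Rightarrow> ((nat \<Rightarrow> 'a) \<Rightarrow> real) \<Rightarrow> (nat \<Rightarrow> 'a) \<Rightarrow> real" where
  "iter n = (ruelle \<nu> N ^^ n)"

lemma iter_simps [simp]: "iter 0 w = w" "iter (Suc n) w = ruelle \<nu> N (iter n w)"
  by (auto simp: iter_def)

lemma iter_Suc': "iter (Suc n) w = iter n (ruelle \<nu> N w)"
  by (simp only: iter_def funpow_Suc_right comp_def)

lemma iter_Lip: "w \<in> Lip \<Longrightarrow> iter n w \<in> Lip"
  by (induction n) (auto intro: ruelle_Lip N_Lip)

lemma iter_exp_lip: "w \<in> Lip \<Longrightarrow> exp_lip K r w \<Longrightarrow> exp_lip K (\<kappa> ^ n * r) (iter n w)"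
  by (induction n) (auto dest: contraction[OF iter_Lip] simp: mult.assoc)

lemma iter_add: "v \<in> Lip \<Longrightarrow> w \<in> Lip \<Longrightarrow> iter n (\<lambda>x. v x + w x) = (\<lambda>x. iter n v x + iter n w x)"
  by (induction n) (auto intro!: ext simp: ruelle_add N_Lip iter_Lip)

lemma iter_scale: "iter n (\<lambda>x. c * w x) = (\<lambda>x. c * iter n w x)"
  by (induction n) (auto intro!: ext simp: ruelle_scale)

lemma iter_const: "iter n (\<lambda>_. c) = (\<lambda>_. c)"
  by (induction n) (auto intro!: ext simp: ruelle_const normalized)

lemma iter_nonneg: "w \<in> Lip \<Longrightarrow> (\<And>x. 0 \<le> w x) \<Longrightarrow> 0 \<le> iter n w x"
  by (induction n arbitrary: x) (auto intro!: ruelle_ge_const normalized iter_Lip)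

text \<open>The value \<open>ruelle \<nu> N w x\<close> is an average of values of \<open>w\<close>,
  so its distance to any value of \<open>w\<close> is at most the oscillation.\<close>

lemma abs_ruelle_diff_le:
  assumes w: "w \<in> Lip" "exp_lip K r w"
  shows "\<bar>ruelle \<nu> N w x - w y\<bar> \<le> r"
proof -
  have *: "w z \<le> w y + r" "w y - r \<le> w z" for z
    using exp_lip_osc[OF w(2), of z y] by (auto simp: abs_le_iff algebra_simps)
  show ?thesis
    using ruelle_le_const[OF normalized w(1) *(1), of x] ruelle_ge_const[OF normalized w(1) *(2), of x]
    by (simp add: abs_le_iff)
qed

text \<open>The base point \<open>undefined\<close> is arbitrary: the oscillation of the iterates
  tends to 0, so the limit is the same at every point. This functional turns out to be integration
  against the Gibbs measure.\<close>

definition mean :: "((nat \<Rightarrow> 'a) \<Rightarrow> real) \<Rightarrow> real" where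
  "mean w = lim (\<lambda>n. iter n w undefined)"

lemma iter_tendsto_mean:
  assumes w: "w \<in> Lip"
  shows "(\<lambda>n. iter n w undefined) \<longlonglongrightarrow> mean w"
proof -
  obtain r where r: "0 \<le> r" "exp_lip K r w" using exists_exp_lip[OF w K_pos] by blast
  have "summable (\<lambda>n. iter (Suc n) w undefined - iter n w undefined)"
  proof (rule summable_comparison_test')
    show "summable (\<lambda>n. \<kappa> ^ n * r)" using \<kappa>_bounds by (intro summable_mult2 summable_geometric) auto
    show "norm (iter (Suc n) w undefined - iter n w undefined) \<le> \<kappa> ^ n * r" for n
      using abs_ruelle_diff_le[OF iter_Lip[OF w] iter_exp_lip[OF w r(2)]] by simp
  qed
  from summable_LIMSEQ[OF this]
  have "convergent (\<lambda>n. iter n w undefined - iter 0 w undefined)"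
    unfolding sum_lessThan_telescope[of "\<lambda>n. iter n w undefined"] by (rule convergentI)
  from convergent_add[OF this convergent_const[of "iter 0 w undefined"]]
  show ?thesis unfolding mean_def by (simp add: convergent_LIMSEQ_iff)
qed

lemma iter_diff_tendsto_0:
  assumes w: "w \<in> Lip" "exp_lip K r w"
  shows "(\<lambda>n. \<kappa> ^ n * r) \<longlonglongrightarrow> 0" "\<bar>iter n w x - iter n w y\<bar> \<le> \<kappa> ^ n * r"
proof -
  have "(\<lambda>n. \<kappa> ^ n * r) \<longlonglongrightarrow> 0 * r"
    using \<kappa>_bounds by (intro tendsto_mult_right LIMSEQ_power_zero) auto
  then show "(\<lambda>n. \<kappa> ^ n * r) \<longlonglongrightarrow> 0" by simp
  show "\<bar>iter n w x - iter n w y\<bar> \<le> \<kappa> ^ n * r"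
    using exp_lip_osc[OF iter_exp_lip[OF w]] .
qed

lemma mean_ruelle:
  assumes "w \<in> Lip"
  shows "mean (ruelle \<nu> N w) = mean w"
proof -
  have "(\<lambda>n. iter n (ruelle \<nu> N w) undefined) \<longlonglongrightarrow> mean w"
    using LIMSEQ_Suc[OF iter_tendsto_mean[OF assms]] by (simp only: iter_Suc')
  with iter_tendsto_mean[OF ruelle_Lip[OF N_Lip assms]] show ?thesis by (rule LIMSEQ_unique)
qed

sublocale mean: compact_stone_lattice Lip mean
proof
  show "mean (\<lambda>x. v x + w x) = mean v + mean w" if "v \<in> Lip" "w \<in> Lip" for v w
    using LIMSEQ_unique[OF iter_tendsto_mean[OF Lip_add[OF that]]]
      tendsto_add[OF iter_tendsto_mean[OF that(1)] iter_tendsto_mean[OF that(2)]]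
    by (simp add: iter_add that)
  show "mean (\<lambda>x. c * w x) = c * mean w" if "w \<in> Lip" for c w
    using LIMSEQ_unique[OF iter_tendsto_mean[OF Lip_scale[OF that]]]
      tendsto_mult_left[OF iter_tendsto_mean[OF that]]
    by (simp add: iter_scale)
  show "mean (\<lambda>_. 1) = 1" unfolding mean_def iter_const by simp
  show "0 \<le> mean w" if "w \<in> Lip" "\<And>x. 0 \<le> w x" for w
    using iter_tendsto_mean[OF that(1)] iter_nonneg[OF that] by (intro LIMSEQ_le_const) auto
qed (auto intro: compact_sequences Lip_continuous Lip_const Lip_add Lip_scale Lip_max Lip_cozero)

text \<open>Invariance allows \<open>w\<close> to be replaced by its iterates, which are within
  \<open>\<kappa> ^ n * r\<close> of a constant. This is the source of uniqueness.\<close>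

lemma integral_eq_mean:
  assumes \<mu>: "dual_eigenmeasure \<nu> N 1 \<mu>" and w: "w \<in> Lip"
  shows "(\<integral>x. w x \<partial>\<mu>) = mean w"
proof -
  have bp: "borel_prob \<mu>" using \<mu> by (simp add: dual_eigenmeasure_def)
  interpret prob_space \<mu> using bp by (simp add: borel_prob_def)
  obtain r where r: "0 \<le> r" "exp_lip K r w" using exists_exp_lip[OF w K_pos] by blast
  have inv: "(\<integral>x. iter n w x \<partial>\<mu>) = (\<integral>x. w x \<partial>\<mu>)" for n
    using \<mu> iter_Lip[OF w] by (induction n) (auto simp: dual_eigenmeasure_def)
  have "\<bar>(\<integral>x. w x \<partial>\<mu>) - iter n w undefined\<bar> \<le> \<kappa> ^ n * r" for n
  proof -
    have int: "integrable \<mu> (iter n w)" by (rule Lip_integrable[OF iter_Lip[OF w] bp])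
    have "(\<integral>x. w x \<partial>\<mu>) - iter n w undefined = (\<integral>x. iter n w x - iter n w undefined \<partial>\<mu>)"
      using int by (simp add: inv prob_space)
    also have "\<bar>\<dots>\<bar> \<le> (\<integral>x. \<bar>iter n w x - iter n w undefined\<bar> \<partial>\<mu>)" by (rule integral_abs_bound)
    also have "\<dots> \<le> (\<integral>x. \<kappa> ^ n * r \<partial>\<mu>)"
      using int iter_diff_tendsto_0(2)[OF w r(2)] by (intro integral_mono) auto
    finally show ?thesis by (simp add: prob_space)
  qed
  then have "norm (iter n w undefined - (\<integral>x. w x \<partial>\<mu>)) \<le> \<kappa> ^ n * r" for n
    by (metis abs_minus_commute real_norm_def)
  then have "(\<lambda>n. iter n w undefined - (\<integral>x. w x \<partial>\<mu>)) \<longlonglongrightarrow> 0"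
    by (rule Lim_null_comparison[OF always_eventually[OF allI] iter_diff_tendsto_0(1)[OF w r(2)]])
  then have "(\<lambda>n. iter n w undefined) \<longlonglongrightarrow> (\<integral>x. w x \<partial>\<mu>)" by (rule LIM_zero_cancel)
  then show ?thesis using iter_tendsto_mean[OF w] by (rule LIMSEQ_unique)
qed

lemma ex1_dual_eigenmeasure: "\<exists>!\<mu>. dual_eigenmeasure \<nu> N 1 \<mu>"
proof (rule ex_ex1I)
  have "dual_eigenmeasure \<nu> N 1 mean.representing_measure"
    unfolding dual_eigenmeasure_def
    by (simp add: mean.borel_prob_representing mean.integral_representing mean_ruelle ruelle_Lip N_Lip)
  then show "\<exists>\<mu>. dual_eigenmeasure \<nu> N 1 \<mu>" by blast
  show "\<mu> = \<mu>'" if "dual_eigenmeasure \<nu> N 1 \<mu>" "dual_eigenmeasure \<nu> N 1 \<mu>'" for \<mu> \<mu>'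
  proof (rule borel_prob_eqI)
    show "borel_prob \<mu>" "borel_prob \<mu>'" using that by (auto simp: dual_eigenmeasure_def)
  qed (simp add: integral_eq_mean that)
qed

text \<open>Integrating the eigenvalue equation against the invariant measure gives
  \<open>c = 1\<close>, since the integral of \<open>w\<close> is positive. Then \<open>w\<close>
  equals all its iterates, whose oscillation tends to 0.\<close>

lemma positive_eigenfunction_const:
  assumes w: "w \<in> Lip" "\<And>x. 0 < w x" and eig: "\<And>x. ruelle \<nu> N w x = c * w x"
  shows "c = 1" "w x = w y"
proof -
  obtain \<mu> where \<mu>: "dual_eigenmeasure \<nu> N 1 \<mu>" using ex1_dual_eigenmeasure by blast
  have bp: "borel_prob \<mu>" using \<mu> by (simp add: dual_eigenmeasure_def)
  interpret prob_space \<mu> using bp by (simp add: borel_prob_def)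
  have int: "integrable \<mu> w" by (rule Lip_integrable[OF w(1) bp])
  have "(\<integral>x. w x \<partial>\<mu>) = c * (\<integral>x. w x \<partial>\<mu>)"
  proof -
    have "(\<integral>x. ruelle \<nu> N w x \<partial>\<mu>) = (\<integral>x. w x \<partial>\<mu>)"
      using \<mu> w(1) by (simp add: dual_eigenmeasure_def)
    then show ?thesis by (simp add: eig)
  qed
  moreover have "0 < (\<integral>x. w x \<partial>\<mu>)"
    using integral_less_AE_space[of "\<lambda>_. 0" w] int w(2) emeasure_space_1 by simp
  ultimately show c: "c = 1" by simp
  obtain r where r: "0 \<le> r" "exp_lip K r w" using exists_exp_lip[OF w(1) K_pos] by blast
  have "ruelle \<nu> N w = w" using eig c by auto
  then have "iter n w = w" for n by (induction n) auto
  then have "\<bar>w x - w y\<bar> \<le> \<kappa> ^ n * r" for n using iter_diff_tendsto_0(2)[OF w(1) r(2), of n x y] by simp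
  then have "\<bar>w x - w y\<bar> \<le> 0"
    using iter_diff_tendsto_0(1)[OF w(1) r(2)] by (intro LIMSEQ_le_const) auto
  then show "w x = w y" by simp
qed

end

section \<open>Eigenfunctions of perturbed potentials\<close>

context full_shift
begin

section \<open>The operator in logarithmic coordinates\<close>

lemma ruelle_pos:
  assumes "f \<in> Lip" "w \<in> Lip" "\<And>x. 0 < w x"
  shows "0 < ruelle \<nu> f w x"
  unfolding ruelle_def
  using nu.integral_less_AE_space[of "\<lambda>_. 0" "\<lambda>a. exp (f (prepend a x)) * w (prepend a x)"]
    ruelle_integrable[OF assms(1,2)] assms(3) nu.emeasure_space_1 by simp

text \<open>Because \<open>exp_lip\<close> is one-sided, \<open>ln s <= s - 1\<close> at the
  quotient \<open>s = w x / w y\<close> is enough.\<close>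

lemma exp_lip_ln:
  assumes "exp_lip K r (w :: (nat \<Rightarrow> 'a) \<Rightarrow> real)" "0 \<le> K" "0 < m" "\<And>x. m \<le> w x"
  shows "exp_lip K (r / m) (\<lambda>x. ln (w x))"
  unfolding exp_lip_def
proof (intro conjI allI)
  have r: "0 \<le> r" using assms by (simp add: exp_lip_def)
  then show "0 \<le> r / m" using assms by simp
  fix x y :: "nat \<Rightarrow> 'a"
  define \<omega> where "\<omega> = 1 - exp (- (2 * K * seq_dist x y))"
  have \<omega>: "0 \<le> \<omega>" using assms(2) seq_dist_nonneg[of x y] by (simp add: \<omega>_def)
  have w: "0 < w x" "0 < w y" using assms(3,4) less_le_trans by blast+
  have "ln (w x) - ln (w y) = ln (w x / w y)" using w by (simp add: ln_div)
  also have "\<dots> \<le> w x / w y - 1" using w by (intro ln_le_minus_one) simp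
  also have "\<dots> = (w x - w y) / w y" using w by (simp add: diff_divide_distrib)
  also have "\<dots> \<le> r * \<omega> / w y"
    using assms(1) w by (intro divide_right_mono) (auto simp: exp_lip_def \<omega>_def)
  also have "\<dots> \<le> r * \<omega> / m"
    using assms(3,4) r \<omega> by (intro divide_left_mono) (auto intro: mult_pos_pos w)
  finally show "ln (w x) - ln (w y) \<le> r / m * (1 - exp (- (2 * K * seq_dist x y)))"
    by (simp add: \<omega>_def)
qed

text \<open>An eigenfunction \<open>exp h\<close> with eigenvalue \<open>exp l\<close> becomes a
  solution of \<open>log_ruelle F h = h + l\<close>, a fixed point up to an additive
  constant.\<close>

definition log_ruelle ::
  "((nat \<Rightarrow> 'a) \<Rightarrow> real) \<Rightarrow> ((nat \<Rightarrow> 'a) \<Rightarrow> real) \<Rightarrow> (nat \<Rightarrow> 'a) \<Rightarrow> real" where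
  "log_ruelle F h x = ln (ruelle \<nu> F (\<lambda>x. exp (h x)) x)"

lemma exp_log_ruelle:
  "F \<in> Lip \<Longrightarrow> h \<in> Lip \<Longrightarrow> exp (log_ruelle F h x) = ruelle \<nu> F (\<lambda>x. exp (h x)) x"
  unfolding log_ruelle_def using ruelle_pos[OF _ Lip_exp] by simp

lemma log_ruelle_add: "log_ruelle (\<lambda>x. F x + q x) h = log_ruelle F (\<lambda>x. q x + h x)"
  unfolding log_ruelle_def ruelle_def by (simp add: exp_add mult.assoc)

text \<open>Moving from \<open>x\<close> to \<open>y\<close> changes every integrand by a factor of
  at most \<open>exp (C / 2 * d)\<close>. In logarithmic form the constant is thus simply halved,
  without a factor from the size of \<open>F\<close> or \<open>h\<close>.\<close>

lemma log_ruelle_lip: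
  assumes F: "F \<in> Lip" and h: "h \<in> Lip" and C: "lip C (\<lambda>x. F x + h x)"
  shows "lip (C / 2) (log_ruelle F h)"
  unfolding lip_def
proof (intro conjI allI)
  show "0 \<le> C / 2" using C by (simp add: lip_def)
  have "log_ruelle F h x \<le> C / 2 * seq_dist x y + log_ruelle F h y" for x y
  proof -
    have "exp (log_ruelle F h x) \<le> exp (C / 2 * seq_dist x y) * exp (log_ruelle F h y)"
      unfolding exp_log_ruelle[OF F h]
    proof -
      have "ruelle \<nu> F (\<lambda>x. exp (h x)) x
          \<le> (\<integral>a. exp (C / 2 * seq_dist x y) * (exp (F (prepend a y)) * exp (h (prepend a y))) \<partial>\<nu>)"
        unfolding ruelle_def
      proof (rule integral_mono)
        show "integrable \<nu> (\<lambda>a. exp (F (prepend a x)) * exp (h (prepend a x)))"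
          by (intro ruelle_integrable F Lip_exp h)
        show "integrable \<nu> (\<lambda>a. exp (C / 2 * seq_dist x y) * (exp (F (prepend a y)) * exp (h (prepend a y))))"
          using ruelle_integrable[OF F Lip_exp[OF h]] by simp
        fix a
        have "\<bar>(F (prepend a x) + h (prepend a x)) - (F (prepend a y) + h (prepend a y))\<bar> \<le> C * (seq_dist x y / 2)"
          using C seq_dist_prepend[of a x y] unfolding lip_def by metis
        then have "F (prepend a x) + h (prepend a x) \<le> C / 2 * seq_dist x y + (F (prepend a y) + h (prepend a y))"
          unfolding times_divide_eq_right times_divide_eq_left by linarith
        then show "exp (F (prepend a x)) * exp (h (prepend a x))
            \<le> exp (C / 2 * seq_dist x y) * (exp (F (prepend a y)) * exp (h (prepend a y)))"
          by (simp flip: exp_add)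
      qed
      then show "ruelle \<nu> F (\<lambda>x. exp (h x)) x \<le> exp (C / 2 * seq_dist x y) * ruelle \<nu> F (\<lambda>x. exp (h x)) y"
        by (simp add: ruelle_def)
    qed
    then show ?thesis by (simp flip: exp_add)
  qed
  from this this[of y x for x y]
  show "\<bar>log_ruelle F h x - log_ruelle F h y\<bar> \<le> C / 2 * seq_dist x y" for x y
    by (smt (verit) seq_dist_commute)
qed

lemma log_ruelle_Lip:
  assumes "F \<in> Lip" "h \<in> Lip"
  shows "log_ruelle F h \<in> Lip"
proof -
  obtain C where "lip C (\<lambda>x. F x + h x)" using lipE[OF Lip_add[OF assms]] by blast
  from LipI[OF log_ruelle_lip[OF assms this]] show ?thesis .
qed

text \<open>For an eigenfunction \<open>exp h\<close> this is the usual normalization of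
  \<open>F\<close>. It is defined for every \<open>h\<close> because the iteration has to normalize
  at functions that are not yet eigenfunctions.\<close>

definition conjugate ::
  "((nat \<Rightarrow> 'a) \<Rightarrow> real) \<Rightarrow> ((nat \<Rightarrow> 'a) \<Rightarrow> real) \<Rightarrow> (nat \<Rightarrow> 'a) \<Rightarrow> real" where
  "conjugate F h x = F x + h x - log_ruelle F h (shift_map x)"

lemma ruelle_conjugate:
  assumes "F \<in> Lip" "h \<in> Lip"
  shows "ruelle \<nu> (conjugate F h) w x = ruelle \<nu> F (\<lambda>x. exp (h x) * w x) x / exp (log_ruelle F h x)"
  unfolding ruelle_def conjugate_def by (simp add: exp_add exp_diff mult.assoc)

text \<open>The shift doubles the constant that \<open>log_ruelle\<close> has halved, so
  \<open>F + h\<close> contributes \<open>C\<close> twice.\<close>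

lemma conjugate_lip:
  assumes "F \<in> Lip" "h \<in> Lip" "lip C (\<lambda>x. F x + h x)"
  shows "lip (2 * C) (conjugate F h)"
  using lip_diff[OF assms(3) lip_shift[OF log_ruelle_lip[OF assms]]]
  unfolding conjugate_def by simp

lemma conjugate_normalized:
  assumes "F \<in> Lip" "h \<in> Lip"
  shows "conjugate F h \<in> normalized_potentials \<nu>"
proof -
  obtain C where "lip C (\<lambda>x. F x + h x)" using lipE[OF Lip_add[OF assms]] by blast
  from LipI[OF conjugate_lip[OF assms this]] show ?thesis
    using ruelle_conjugate[OF assms, of "\<lambda>_. 1"] exp_log_ruelle[OF assms]
    by (simp add: normalized_potentials_def)
      (metis div_self exp_not_eq_zero)
qed

text \<open>
  The difference is \<open>ln\<close> of \<open>\<L>\<^sub>N (exp (h' - h))\<close> for the normalized potential \<open>N = conjugate F h\<close>, so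
  the linear contraction applies.
\<close>

lemma log_ruelle_contraction:
  assumes F: "F \<in> Lip" and h: "h \<in> Lip" and h': "h' \<in> Lip" and C: "lip (K / 2) (\<lambda>x. F x + h x)"
    and r: "exp_lip K r (\<lambda>x. h' x - h x)"
  shows "exp_lip K (contraction_rate K * exp r * r) (\<lambda>x. log_ruelle F h' x - log_ruelle F h x)"
proof -
  define g where "g x = h' x - h x" for x
  define N where "N = conjugate F h"
  have K: "0 \<le> K" using C by (simp add: lip_def)
  have N: "N \<in> normalized_potentials \<nu>" "lip K N"
    using conjugate_normalized[OF F h] conjugate_lip[OF F h C] by (auto simp: N_def)
  have gL: "g \<in> Lip" unfolding g_def by (intro Lip_diff h h')
  have g: "exp_lip K r g" using r by (simp add: g_def[abs_def])
  have r0: "0 \<le> r" using r by (simp add: exp_lip_def)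
  \<comment> \<open>The exponential has slope at most \<open>exp S\<close>, while its image under
    the operator is at least \<open>exp (S - r)\<close>. In the logarithm only the quotient
    \<open>exp r\<close> of the two survives, whatever \<open>S\<close> is.\<close>
  obtain S where S: "\<And>x. g x \<le> S" "\<And>x. S - g x \<le> r" using exp_lip_sup[OF gL g] by blast
  have "exp_lip K (exp S * r) (\<lambda>x. exp (g x))"
    unfolding exp_lip_def
  proof (intro conjI allI)
    show "0 \<le> exp S * r" using r0 by simp
    fix x y
    have "exp (g x) - exp (g y) \<le> exp S * \<bar>g x - g y\<bar>"
      using abs_exp_diff_le[OF S(1) S(1), of x y] by linarith
    also have "\<dots> \<le> exp S * (r * (1 - exp (- (2 * K * seq_dist x y))))"
      using exp_lip_abs[OF g] by (intro mult_left_mono) auto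
    finally show "exp (g x) - exp (g y) \<le> exp S * r * (1 - exp (- (2 * K * seq_dist x y)))"
      by (simp add: mult.assoc)
  qed
  from ruelle_contraction[OF N Lip_exp[OF gL] this]
  have 1: "exp_lip K (contraction_rate K * (exp S * r)) (ruelle \<nu> N (\<lambda>x. exp (g x)))" .
  have 2: "exp (S - r) \<le> ruelle \<nu> N (\<lambda>x. exp (g x)) x" for x
    using S(2) by (intro ruelle_ge_const[OF N(1) Lip_exp[OF gL]]) (auto simp: algebra_simps)
  have 3: "ln (ruelle \<nu> N (\<lambda>x. exp (g x)) x) = log_ruelle F h' x - log_ruelle F h x" for x
  proof -
    have "ruelle \<nu> N (\<lambda>x. exp (g x)) x = exp (log_ruelle F h' x) / exp (log_ruelle F h x)"
      unfolding N_def ruelle_conjugate[OF F h] exp_log_ruelle[OF F h']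
      by (simp add: g_def flip: exp_add)
    then show ?thesis by (simp flip: exp_diff)
  qed
  have 4: "contraction_rate K * (exp S * r) / exp (S - r) = contraction_rate K * exp r * r"
    by (simp add: exp_diff)
  show ?thesis
    using exp_lip_ln[OF 1 K _ 2] unfolding 3 4 by simp
qed

text \<open>This makes the choice in \<open>rpf_data\<close> meaningful. The operator of
  \<open>conjugate F h\<close> is that of \<open>F\<close> conjugated by multiplication with
  \<open>exp h\<close> and divided by \<open>exp l\<close>; hence the dual eigenmeasure of
  \<open>F\<close> has density \<open>exp (- h)\<close> with respect to \<mu>, up to the normalizing
  constant \<open>Z\<close>.\<close>

lemma rpf_triple_of_log_eigenfunction:
  assumes F: "F \<in> Lip" and h: "h \<in> Lip" and eig: "\<And>x. log_ruelle F h x = h x + l"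
    and \<mu>: "dual_eigenmeasure \<nu> (conjugate F h) 1 \<mu>"
  shows "\<exists>w \<rho>. rpf_triple \<nu> F (exp l) w \<rho>"
proof -
  have bp: "borel_prob \<mu>" using \<mu> by (simp add: dual_eigenmeasure_def)
  interpret prob_space \<mu> using bp by (simp add: borel_prob_def)
  have sets: "sets \<mu> = sets borel" using bp by (simp add: borel_prob_def)
  have eL: "(\<lambda>x. exp (- h x)) \<in> Lip" by (intro Lip_exp Lip_uminus h)
  define Z where "Z = (\<integral>x. exp (- h x) \<partial>\<mu>)"
  have inte: "integrable \<mu> (\<lambda>x. exp (- h x))" by (rule Lip_integrable[OF eL bp])
  have Z: "0 < Z" unfolding Z_def
    using integral_less_AE_space[of "\<lambda>_. 0" "\<lambda>x. exp (- h x)"] inte emeasure_space_1 by simp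
  define \<rho> where "\<rho> = density \<mu> (\<lambda>x. ennreal (exp (- h x) / Z))"
  define w where "w x = Z * exp (h x)" for x
  have meas: "(\<lambda>x. exp (- h x) / Z) \<in> borel_measurable \<mu>"
    using Lip_measurable[OF eL bp] by measurable
  have int\<rho>: "(\<integral>x. v x \<partial>\<rho>) = (\<integral>x. exp (- h x) / Z * v x \<partial>\<mu>)" if "v \<in> Lip" for v
    unfolding \<rho>_def using integral_density[OF Lip_measurable[OF that bp] meas] Z by simp
  have "borel_prob \<rho>"
    unfolding borel_prob_def
  proof
    show "sets \<rho> = sets borel" by (simp add: \<rho>_def sets)
    have "emeasure \<rho> (space \<rho>) = (\<integral>\<^sup>+x. ennreal (exp (- h x) / Z) \<partial>\<mu>)"
      unfolding \<rho>_def using meas by (subst emeasure_density) (auto intro!: nn_integral_cong)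
    also have "\<dots> = ennreal (\<integral>x. exp (- h x) / Z \<partial>\<mu>)"
      using inte Z by (intro nn_integral_eq_integral) auto
    also have "(\<integral>x. exp (- h x) / Z \<partial>\<mu>) = 1" using Z by (simp add: Z_def)
    finally show "prob_space \<rho>" by (intro prob_spaceI) simp
  qed
  moreover have "(\<integral>x. ruelle \<nu> F v x \<partial>\<rho>) = exp l * (\<integral>x. v x \<partial>\<rho>)" if v: "v \<in> Lip" for v
  proof -
    have evL: "(\<lambda>x. exp (- h x) * v x) \<in> Lip" by (intro Lip_mult eL v)
    have "exp (- h x) / Z * ruelle \<nu> F v x
        = exp l / Z * ruelle \<nu> (conjugate F h) (\<lambda>x. exp (- h x) * v x) x" for x
    proof -
      have "exp (h x) * (exp (- h x) * v x) = v x" for x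
        by (simp add: exp_minus)
      then show ?thesis
        unfolding ruelle_conjugate[OF F h] eig by (simp add: exp_add exp_minus field_simps)
    qed
    then have "(\<integral>x. ruelle \<nu> F v x \<partial>\<rho>)
        = exp l / Z * (\<integral>x. ruelle \<nu> (conjugate F h) (\<lambda>x. exp (- h x) * v x) x \<partial>\<mu>)"
      unfolding int\<rho>[OF ruelle_Lip[OF F v]] by (simp del: times_divide_eq_left)
    also have "\<dots> = exp l / Z * (\<integral>x. exp (- h x) * v x \<partial>\<mu>)"
      using \<mu> evL by (simp add: dual_eigenmeasure_def)
    also have "\<dots> = exp l * (\<integral>x. v x \<partial>\<rho>)"
      using int\<rho>[OF v] by simp
    finally show ?thesis .
  qed
  ultimately have "dual_eigenmeasure \<nu> F (exp l) \<rho>" by (simp add: dual_eigenmeasure_def)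
  moreover have wL: "w \<in> Lip" unfolding w_def by (intro Lip_scale Lip_exp h)
  moreover have "ruelle \<nu> F w x = exp l * w x" for x
    unfolding w_def ruelle_scale using exp_log_ruelle[OF F h, of x] by (simp add: eig exp_add mult_ac)
  moreover have "(\<integral>x. w x \<partial>\<rho>) = 1"
    using int\<rho>[OF wL] Z by (simp add: w_def exp_minus prob_space)
  ultimately show ?thesis
    using Z unfolding rpf_triple_def by (intro exI[of _ w] exI[of _ \<rho>]) (auto simp: w_def[abs_def])
qed

text \<open>Whatever triple \<open>rpf_data\<close> picks, \<open>\<psi> = exp (- h) * w\<close> is
  a positive eigenfunction of a normalized operator, hence constant. The constant cancels in the
  normalization, and the eigenvalue is forced to be \<open>exp l\<close>.\<close>

lemma normalization_eq_conjugate: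
  assumes F: "F \<in> Lip" and h: "h \<in> Lip" and eig: "\<And>x. log_ruelle F h x = h x + l"
  shows "normalization \<nu> F = conjugate F h"
    and "dual_eigenmeasure \<nu> (conjugate F h) 1 (lipschitz_gibbs \<nu> F)"
proof -
  obtain C where C: "0 \<le> C" "lip C (conjugate F h)"
    using lipE normalized_Lip[OF conjugate_normalized[OF F h]] by blast
  interpret normalized_shift \<nu> "conjugate F h" "C + 1"
    using conjugate_normalized[OF F h] C lip_mono[OF C(2), of "C + 1"] by unfold_locales auto
  obtain \<mu> where "dual_eigenmeasure \<nu> (conjugate F h) 1 \<mu>" using ex1_dual_eigenmeasure by blast
  then have "\<exists>p. case p of (l', w, \<rho>) \<Rightarrow> rpf_triple \<nu> F l' w \<rho>"
    using rpf_triple_of_log_eigenfunction[OF F h eig] by fast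
  then have "case rpf_data \<nu> F of (l', w, \<rho>) \<Rightarrow> rpf_triple \<nu> F l' w \<rho>"
    unfolding rpf_data_def by (rule someI_ex)
  then obtain \<rho> where "rpf_triple \<nu> F (rpf_eigenvalue \<nu> F) (rpf_eigenfunction \<nu> F) \<rho>"
    by (auto simp: rpf_eigenvalue_def rpf_eigenfunction_def split: prod.splits)
  moreover define l' where "l' = rpf_eigenvalue \<nu> F"
  moreover define w where "w = rpf_eigenfunction \<nu> F"
  ultimately have w: "w \<in> Lip" "\<And>x. 0 < w x" "\<And>x. ruelle \<nu> F w x = l' * w x"
    by (auto simp: rpf_triple_def)
  define \<psi> where "\<psi> x = exp (- h x) * w x" for x
  have \<psi>L: "\<psi> \<in> Lip" unfolding \<psi>_def by (intro Lip_mult Lip_exp Lip_uminus h w)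
  have \<psi>0: "0 < \<psi> x" for x using w(2) by (simp add: \<psi>_def)
  have w\<psi>: "w x = exp (h x) * \<psi> x" for x by (simp add: \<psi>_def exp_minus)
  have eq: "ruelle \<nu> (conjugate F h) \<psi> x = (l' / exp l) * \<psi> x" for x
  proof -
    have "ruelle \<nu> (conjugate F h) \<psi> x = l' * w x / exp (h x + l)"
      unfolding ruelle_conjugate[OF F h] eig using w(3)[of x] by (simp flip: w\<psi>)
    then show ?thesis by (simp add: w\<psi> exp_add)
  qed
  have l': "l' = exp l" using positive_eigenfunction_const(1)[OF \<psi>L \<psi>0 eq] by simp
  have ln_w: "ln (w x) = h x + ln (\<psi> undefined)" for x
    using positive_eigenfunction_const(2)[OF \<psi>L \<psi>0 eq, of x undefined] \<psi>0[of undefined]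
    by (simp add: w\<psi> ln_mult)
  show norm: "normalization \<nu> F = conjugate F h"
    unfolding normalization_def[abs_def] conjugate_def[abs_def]
    by (rule ext) (simp add: ln_w eig l' flip: w_def l'_def)
  show "dual_eigenmeasure \<nu> (conjugate F h) 1 (lipschitz_gibbs \<nu> F)"
    unfolding lipschitz_gibbs_def norm by (rule theI'[OF ex1_dual_eigenmeasure])
qed

text \<open>Picard iteration from 0 inside the ball of radius \<open>R = e / (1 - \<theta>)\<close>,
  the geometric sum of the increments. The constants fit together: \<open>f + q\<close> is
  \<open>K/4\<close>-Lipschitz, and \<open>R <= 1/8\<close> makes each iterate
  \<open>K/4\<close>-Lipschitz, so their sum meets the bound \<open>K/2\<close> that
  \<open>log_ruelle_contraction\<close> asks for.\<close>

lemma log_eigenfunction_exists: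
  assumes f: "f \<in> Lip" "lip K\<^sub>0 f" and q: "q \<in> Lip" "lip 1 q"
    and K: "K = 4 * K\<^sub>0 + 4"
    and \<theta>: "\<theta> = exp (- (1 - contraction_rate K) / 2)"
    and e: "exp_lip K e (log_ruelle f q)" "e / (1 - \<theta>) \<le> min (1 / 8) ((1 - contraction_rate K) / 2)"
  obtains h l where "h \<in> Lip" "exp_lip K (e / (1 - \<theta>)) h" "h undefined = 0"
    "\<And>x. log_ruelle (\<lambda>x. f x + q x) h x = h x + l"
proof -
  define F where "F x = f x + q x" for x
  have FL: "F \<in> Lip" unfolding F_def by (intro Lip_add f q)
  have K0: "0 \<le> K\<^sub>0" using f by (simp add: lip_def)
  have Kp: "0 < K" using K0 K by simp
  have Flip: "lip (K / 4) F" unfolding F_def[abs_def] using lip_add[OF f(2) q(2)] by (simp add: K add_divide_distrib)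
  have e0: "0 \<le> e" using e by (simp add: exp_lip_def)
  have c: "0 < contraction_rate K" "contraction_rate K < 1" using contraction_rate_bounds[of K] Kp by auto
  have \<theta>01: "0 < \<theta>" "\<theta> < 1" using c by (auto simp: \<theta>)
  define R where "R = e / (1 - \<theta>)"
  have R: "0 \<le> R" "R \<le> 1 / 8" "R \<le> (1 - contraction_rate K) / 2"
    using e(2) e0 \<theta>01 by (auto simp: R_def)
  have eR: "e \<le> R" using e0 \<theta>01 by (simp add: R_def le_divide_eq mult_left_le)
  \<comment> \<open>Since \<open>contraction_rate K <= exp (contraction_rate K - 1)\<close>, half of
    this exponent can be spent on the factor \<open>exp r\<close> of the nonlinear estimate; the
    other half remains as \<theta>.\<close>
  have rate: "contraction_rate K * exp r \<le> \<theta>" if "r \<le> R" for r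
  proof -
    have "contraction_rate K \<le> exp (contraction_rate K - 1)"
      using exp_ge_add_one_self[of "contraction_rate K - 1"] by simp
    moreover have "exp r \<le> exp ((1 - contraction_rate K) / 2)" using that R by simp
    ultimately have "contraction_rate K * exp r \<le> exp (contraction_rate K - 1) * exp ((1 - contraction_rate K) / 2)"
      using c by (intro mult_mono) auto
    also have "\<dots> = \<theta>" unfolding \<theta> by (simp add: field_simps flip: exp_add)
    finally show ?thesis .
  qed
  \<comment> \<open>Subtracting the value at a base point removes the unknown eigenvalue. All
    iterates vanish there, so oscillation bounds become uniform bounds.\<close>
  define T where "T h x = log_ruelle F h x - log_ruelle F h undefined" for h x
  define H where "H n = (T ^^ n) (\<lambda>_. 0)" for n
  have H0: "H 0 = (\<lambda>_. 0)" and HS: "H (Suc n) = T (H n)" for n by (auto simp: H_def)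
  have TL: "T h \<in> Lip" if "h \<in> Lip" for h
    unfolding T_def[abs_def] by (intro Lip_diff Lip_const log_ruelle_Lip FL that)
  have HL: "H n \<in> Lip" for n by (induction n) (auto simp: H0 HS intro: TL Lip_const)
  have Hx0: "H n undefined = 0" for n by (cases n) (auto simp: H0 HS T_def)
  have geom: "e * (\<Sum>i<n. \<theta> ^ i) \<le> R" for n
  proof -
    have "(\<Sum>i<n. \<theta> ^ i) \<le> 1 / (1 - \<theta>)"
      using sum_le_suminf[OF summable_geometric, of \<theta> "{..<n}"] \<theta>01 by (simp add: suminf_geometric)
    then show ?thesis using e0 mult_left_mono[of _ _ e] by (fastforce simp: R_def)
  qed
  \<comment> \<open>The two bounds depend on each other: the size of \<open>H n\<close> keeps the
    conjugated potential \<open>K\<close>-Lipschitz, which controls the next increment, and the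
    increments add up to the size.\<close>
  have inv: "exp_lip K (e * (\<Sum>i<n. \<theta> ^ i)) (H n) \<and> exp_lip K (e * \<theta> ^ n) (\<lambda>x. H (Suc n) x - H n x)" for n
  proof (induction n)
    case 0
    \<comment> \<open>Starting at 0, the first iterate is \<open>log_ruelle f q\<close> up to a
      constant, which is why \<open>e\<close> measures the first increment.\<close>
    have "log_ruelle F (\<lambda>_. 0) = log_ruelle f q"
      unfolding F_def[abs_def] log_ruelle_add by simp
    then have "exp_lip K e (H (Suc 0))"
      unfolding HS H0 T_def[abs_def] using exp_lip_add_const[OF e(1), of "- log_ruelle f q undefined"] by simp
    then show ?case by (simp add: H0 exp_lip_def)
  next
    case (Suc n)
    have 1: "exp_lip K (e * (\<Sum>i<Suc n. \<theta> ^ i)) (H (Suc n))"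
      using exp_lip_add[OF conjunct1[OF Suc] conjunct2[OF Suc]] by (simp add: distrib_left)
    have "exp_lip K R (H n)" using exp_lip_mono[OF conjunct1[OF Suc] _ geom] Kp by simp
    then have "lip (K / 4) (H n)"
      using lip_mono[OF exp_lip_lip, of K R "H n" "K / 4"] Kp R by simp
    then have "lip (K / 2) (\<lambda>x. F x + H n x)" using lip_add[OF Flip, of "K / 4" "H n"] by simp
    from log_ruelle_contraction[OF FL HL HL this conjunct2[OF Suc]]
    have "exp_lip K (contraction_rate K * exp (e * \<theta> ^ n) * (e * \<theta> ^ n))
       (\<lambda>x. (log_ruelle F (H (Suc n)) x - log_ruelle F (H n) x)
           + (log_ruelle F (H n) undefined - log_ruelle F (H (Suc n)) undefined))"
      by (rule exp_lip_add_const)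
    moreover have "contraction_rate K * exp (e * \<theta> ^ n) * (e * \<theta> ^ n) \<le> \<theta> * (e * \<theta> ^ n)"
    proof (intro mult_right_mono rate)
      have "e * \<theta> ^ n \<le> e" using e0 \<theta>01 by (intro mult_left_le power_le_one) auto
      then show "e * \<theta> ^ n \<le> R" using eR by simp
    qed (use e0 \<theta>01 in auto)
    ultimately have "exp_lip K (\<theta> * (e * \<theta> ^ n))
       (\<lambda>x. (log_ruelle F (H (Suc n)) x - log_ruelle F (H n) x)
           + (log_ruelle F (H n) undefined - log_ruelle F (H (Suc n)) undefined))"
      using Kp by (intro exp_lip_mono[where r'="\<theta> * (e * \<theta> ^ n)"]) auto
    then have 2: "exp_lip K (e * \<theta> ^ Suc n) (\<lambda>x. H (Suc (Suc n)) x - H (Suc n) x)"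
      unfolding HS[of "Suc n"] HS[of n, abs_def] T_def by (simp add: algebra_simps HS T_def)
    show ?case using 1 2 by blast
  qed
  have HR: "exp_lip K R (H n)" for n
    using exp_lip_mono[OF conjunct1[OF inv] _ geom] Kp by simp
  have bound: "\<bar>H n x\<bar> \<le> R" for n x
    using exp_lip_osc[OF HR, of n x undefined] by (simp add: Hx0)
  define h where "h x = lim (\<lambda>n. H n x)" for x
  have lim: "(\<lambda>n. H n x) \<longlonglongrightarrow> h x" for x
  proof -
    have "summable (\<lambda>n. H (Suc n) x - H n x)"
    proof (rule summable_comparison_test')
      show "summable (\<lambda>n. e * \<theta> ^ n)" using \<theta>01 by (intro summable_mult summable_geometric) auto
      show "norm (H (Suc n) x - H n x) \<le> e * \<theta> ^ n" for n
        using exp_lip_osc[OF conjunct2[OF inv], of n x undefined] by (simp add: Hx0)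
    qed
    from summable_LIMSEQ[OF this]
    have "convergent (\<lambda>n. H n x - H 0 x)"
      unfolding sum_lessThan_telescope[of "\<lambda>n. H n x"] by (rule convergentI)
    then show ?thesis unfolding h_def H0 by (simp add: convergent_LIMSEQ_iff)
  qed
  have h_exp: "exp_lip K R h"
    unfolding exp_lip_def
  proof (intro conjI allI)
    fix x y
    show "h x - h y \<le> R * (1 - exp (- (2 * K * seq_dist x y)))"
    proof (rule LIMSEQ_le_const2[OF tendsto_diff[OF lim lim]])
      show "\<exists>m. \<forall>n\<ge>m. H n x - H n y \<le> R * (1 - exp (- (2 * K * seq_dist x y)))"
        using HR by (auto simp: exp_lip_def)
    qed
  qed (use R in auto)
  have hL: "h \<in> Lip" using LipI[OF exp_lip_lip[OF h_exp]] Kp by simp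
  have log_lim: "(\<lambda>n. log_ruelle F (H n) x) \<longlonglongrightarrow> log_ruelle F h x" for x
    unfolding log_ruelle_def
  proof (rule tendsto_ln)
    obtain B where B: "\<And>x. \<bar>F x\<bar> \<le> B" using Lip_bounded[OF FL] by blast
    show "(\<lambda>n. ruelle \<nu> F (\<lambda>x. exp (H n x)) x) \<longlonglongrightarrow> ruelle \<nu> F (\<lambda>x. exp (h x)) x"
      unfolding ruelle_def
    proof (rule integral_dominated_convergence[where w="\<lambda>_. exp B * exp R"])
      show "AE a in \<nu>. (\<lambda>n. exp (F (prepend a x)) * exp (H n (prepend a x)))
          \<longlonglongrightarrow> exp (F (prepend a x)) * exp (h (prepend a x))"
        by (intro AE_I2 tendsto_mult tendsto_const tendsto_exp lim)
      show "AE a in \<nu>. norm (exp (F (prepend a x)) * exp (H n (prepend a x))) \<le> exp B * exp R" for n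
        using abs_le_D1[OF B] abs_le_D1[OF bound] by (intro AE_I2) (simp add: mult_mono)
    qed (use ruelle_integrable[OF FL Lip_exp] hL HL in auto)
    show "ruelle \<nu> F (\<lambda>x. exp (h x)) x \<noteq> 0"
      using ruelle_pos[OF FL Lip_exp[OF hL], of x] by simp
  qed
  have fix_h: "h x = log_ruelle F h x - log_ruelle F h undefined" for x
  proof (rule LIMSEQ_unique)
    show "(\<lambda>n. H (Suc n) x) \<longlonglongrightarrow> h x" using lim by (rule LIMSEQ_Suc)
    show "(\<lambda>n. H (Suc n) x) \<longlonglongrightarrow> log_ruelle F h x - log_ruelle F h undefined"
      unfolding HS T_def by (intro tendsto_diff log_lim)
  qed
  show ?thesis
  proof (rule that[of h "log_ruelle F h undefined"])
    show "exp_lip K (e / (1 - \<theta>)) h" using h_exp by (simp add: R_def)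
    show "h undefined = 0" using fix_h[of undefined] by simp
    show "log_ruelle (\<lambda>x. f x + q x) h x = h x + log_ruelle F h undefined" for x
      using fix_h[of x] by (simp add: F_def[abs_def])
  qed (rule hL)
qed

end

section \<open>Derivative of the entropy\<close>

text \<open>The function \<open>exp s - s\<close> has derivative \<open>exp s - 1\<close>, of size
  at most \<open>2 m\<close> on the interval from \<open>- m\<close> to \<open>m\<close>.\<close>

lemma abs_exp_remainder_diff_le:
  fixes a b m :: real
  assumes "\<bar>a\<bar> \<le> m" "\<bar>b\<bar> \<le> m" "m \<le> 1"
  shows "\<bar>(exp a - a) - (exp b - b)\<bar> \<le> 2 * m * \<bar>a - b\<bar>"
proof -
  have m: "0 \<le> m" using assms(1) by linarith
  have e: "\<bar>exp s - 1\<bar> \<le> 2 * m" if "\<bar>s\<bar> \<le> m" for s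
  proof (cases "0 \<le> s")
    case True
    then have "exp s \<le> 1 + s + s\<^sup>2" using that assms by (intro exp_bound) auto
    moreover have "s\<^sup>2 \<le> s" using True that assms by (simp add: power2_eq_square mult_left_le)
    ultimately show ?thesis using True that by simp
  next
    case False
    then have "exp s \<le> 1" by simp
    then show ?thesis using exp_ge_add_one_self[of s] that m by linarith
  qed
  have *: "\<bar>(exp p - p) - (exp q - q)\<bar> \<le> 2 * m * (p - q)" if "q \<le> p" "\<bar>p\<bar> \<le> m" "\<bar>q\<bar> \<le> m" for p q
  proof -
    have "exp p * (1 + (q - p)) \<le> exp p * exp (q - p)" "exp q * (1 + (p - q)) \<le> exp q * exp (p - q)"
      using exp_ge_add_one_self[of "q - p"] exp_ge_add_one_self[of "p - q"] by auto
    then have "exp p * (1 + (q - p)) \<le> exp q" "exp q * (1 + (p - q)) \<le> exp p"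
      by (auto simp flip: exp_add)
    then have 1: "(exp p - p) - (exp q - q) \<le> (exp p - 1) * (p - q)"
      and 2: "(exp q - 1) * (p - q) \<le> (exp p - p) - (exp q - q)"
      by (auto simp: algebra_simps)
    have "(exp p - 1) * (p - q) \<le> 2 * m * (p - q)"
      using e[OF that(2)] that(1) by (intro mult_right_mono) auto
    moreover have "- (2 * m) * (p - q) \<le> (exp q - 1) * (p - q)"
      using e[OF that(3)] that(1) by (intro mult_right_mono) (auto simp: abs_le_iff)
    ultimately show ?thesis using 1 2 by (simp add: abs_le_iff)
  qed
  show ?thesis
    using *[of a b] *[of b a] assms by (cases "a \<le> b") (auto simp: abs_minus_commute)
qed

lemma abs_exp_minus_one_minus_le:
  fixes s :: real
  assumes "\<bar>s\<bar> \<le> 1"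
  shows "\<bar>exp s - 1 - s\<bar> \<le> 2 * s\<^sup>2"
  using abs_exp_remainder_diff_le[of s "\<bar>s\<bar>" 0] assms by (simp add: power2_eq_square mult.assoc)

context full_shift
begin

text \<open>As \<eta> lies in the kernel, \<open>exp (t \<eta>)\<close> may be replaced by
  \<open>p = exp (t \<eta>) - t \<eta>\<close> under the operator. The Lipschitz constant of
  \<open>p\<close>, and not only its deviation from 1, is of order \<open>t^2\<close>. The lower
  bound 0 comes from \<open>p >= 1\<close>.\<close>

lemma log_perturbation_bounds:
  assumes f: "f \<in> normalized_potentials \<nu>" "lip K f" "0 < K"
    and \<eta>: "\<eta> \<in> ruelle_kernel \<nu> f" "lip D \<eta>" "\<And>x. \<bar>\<eta> x\<bar> \<le> B"
    and t: "\<bar>t\<bar> * B \<le> 1"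
  shows "exp_lip K (2 * B * D * ((1 + 2 * K) / (2 * K)) * t\<^sup>2) (log_ruelle f (\<lambda>x. t * \<eta> x))"
    and "0 \<le> log_ruelle f (\<lambda>x. t * \<eta> x) x" "log_ruelle f (\<lambda>x. t * \<eta> x) x \<le> 2 * B\<^sup>2 * t\<^sup>2"
proof -
  note fL = normalized_Lip[OF f(1)]
  have \<eta>L: "\<eta> \<in> Lip" and \<eta>0: "\<And>x. ruelle \<nu> f \<eta> x = 0" using \<eta>(1) by (auto simp: ruelle_kernel_def)
  define c where "c = (1 + 2 * K) / (2 * K)"
  have B: "0 \<le> B" using \<eta>(3)[of undefined] by linarith
  have D: "0 \<le> D" using \<eta>(2) by (simp add: lip_def)
  define p where "p x = exp (t * \<eta> x) - t * \<eta> x" for x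
  have pL: "p \<in> Lip" unfolding p_def[abs_def] by (intro Lip_diff Lip_exp Lip_scale \<eta>L)
  have b: "\<bar>t * \<eta> x\<bar> \<le> \<bar>t\<bar> * B" for x using \<eta>(3) by (simp add: abs_mult mult_left_mono)
  have ruelle_p: "ruelle \<nu> f p x = ruelle \<nu> f (\<lambda>x. exp (t * \<eta> x)) x" for x
    unfolding p_def[abs_def]
    using ruelle_diff[OF fL Lip_exp[OF Lip_scale[OF \<eta>L]] Lip_scale[OF \<eta>L], of t t x]
    by (simp add: ruelle_scale \<eta>0)
  have "lip (2 * B * D * t\<^sup>2) p"
    unfolding lip_def
  proof (intro conjI allI)
    show "0 \<le> 2 * B * D * t\<^sup>2" using B D by simp
    fix x y
    have "\<bar>p x - p y\<bar> \<le> 2 * (\<bar>t\<bar> * B) * \<bar>t * \<eta> x - t * \<eta> y\<bar>"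
      unfolding p_def using b t by (intro abs_exp_remainder_diff_le)
    also have "\<dots> = 2 * (\<bar>t\<bar> * B) * (\<bar>t\<bar> * \<bar>\<eta> x - \<eta> y\<bar>)"
      by (simp flip: abs_mult right_diff_distrib)
    also have "\<dots> \<le> 2 * (\<bar>t\<bar> * B) * (\<bar>t\<bar> * (D * seq_dist x y))"
      using \<eta>(2) B by (intro mult_left_mono) (auto simp: lip_def)
    also have "\<dots> = 2 * B * D * t\<^sup>2 * seq_dist x y" by (simp add: power2_eq_square algebra_simps)
    finally show "\<bar>p x - p y\<bar> \<le> 2 * B * D * t\<^sup>2 * seq_dist x y" .
  qed
  from lip_exp_lip[OF this f(3)] have p: "exp_lip K (2 * B * D * t\<^sup>2 * c) p" by (simp add: c_def)
  have r: "0 \<le> 2 * B * D * t\<^sup>2 * c" using p by (simp add: exp_lip_def)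
  have "contraction_rate K * (2 * B * D * t\<^sup>2 * c) \<le> 2 * B * D * t\<^sup>2 * c"
    using contraction_rate_bounds(2)[of K] r mult_right_mono[of "contraction_rate K" 1] by simp
  from exp_lip_mono[OF ruelle_contraction[OF f(1,2) pL p] _ this]
  have 1: "exp_lip K (2 * B * D * t\<^sup>2 * c) (ruelle \<nu> f p)" using f(3) by simp
  have 2: "1 \<le> ruelle \<nu> f p x" for x
    by (intro ruelle_ge_const[OF f(1) pL]) (simp add: p_def exp_ge_add_one_self add.commute le_diff_eq)
  show "exp_lip K (2 * B * D * ((1 + 2 * K) / (2 * K)) * t\<^sup>2) (log_ruelle f (\<lambda>x. t * \<eta> x))"
  proof -
    have "2 * B * D * t\<^sup>2 * c / 1 = 2 * B * D * c * t\<^sup>2" by simp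
    then show ?thesis
      using exp_lip_ln[OF 1 _ _ 2] f(3) unfolding log_ruelle_def[abs_def] ruelle_p c_def[symmetric]
      by (simp del: div_by_1)
  qed
  show "0 \<le> log_ruelle f (\<lambda>x. t * \<eta> x) x"
    unfolding log_ruelle_def using 2[of x] by (simp add: ruelle_p)
  have "p y \<le> 1 + 2 * B\<^sup>2 * t\<^sup>2" for y
  proof -
    have "\<bar>exp (t * \<eta> y) - 1 - t * \<eta> y\<bar> \<le> 2 * (t * \<eta> y)\<^sup>2"
      using b[of y] t by (intro abs_exp_minus_one_minus_le) linarith
    moreover have "(t * \<eta> y)\<^sup>2 \<le> (\<bar>t\<bar> * B)\<^sup>2" using power_mono[OF b[of y], of 2] by simp
    ultimately have "exp (t * \<eta> y) - 1 - t * \<eta> y \<le> 2 * (\<bar>t\<bar> * B)\<^sup>2" by linarith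
    then show ?thesis by (simp add: p_def power_mult_distrib mult_ac)
  qed
  then have "ruelle \<nu> f p x \<le> 1 + 2 * B\<^sup>2 * t\<^sup>2" by (intro ruelle_le_const[OF f(1) pL])
  moreover have "ln (ruelle \<nu> f p x) \<le> ruelle \<nu> f p x - 1"
    using 2[of x] by (intro ln_le_minus_one) linarith
  ultimately show "log_ruelle f (\<lambda>x. t * \<eta> x) x \<le> 2 * B\<^sup>2 * t\<^sup>2"
    unfolding log_ruelle_def ruelle_p by linarith
qed

lemma log_ruelle_mono:
  assumes "F \<in> Lip" "h \<in> Lip" "h' \<in> Lip" "\<And>x. h x \<le> h' x + c"
  shows "log_ruelle F h x \<le> log_ruelle F h' x + c"
proof -
  have "ruelle \<nu> F (\<lambda>x. exp (h x)) x \<le> ruelle \<nu> F (\<lambda>x. exp c * exp (h' x)) x"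
    using assms by (intro ruelle_mono Lip_scale Lip_exp) (auto simp: add.commute simp flip: exp_add)
  then have "exp (log_ruelle F h x) \<le> exp (log_ruelle F h' x + c)"
    using assms by (simp add: exp_log_ruelle exp_add ruelle_scale mult.commute)
  then show ?thesis by simp
qed

lemma perturbed_log_eigenfunction:
  assumes f: "f \<in> normalized_potentials \<nu>" and \<eta>: "\<eta> \<in> ruelle_kernel \<nu> f"
  obtains A t\<^sub>0 where "0 \<le> A" "0 < t\<^sub>0"
    "\<And>t. \<bar>t\<bar> < t\<^sub>0 \<Longrightarrow> \<exists>h l. h \<in> Lip \<and> (\<forall>x. \<bar>h x\<bar> \<le> A * t\<^sup>2) \<and> \<bar>l\<bar> \<le> A * t\<^sup>2 \<and>
       (\<forall>x. log_ruelle (\<lambda>x. f x + t * \<eta> x) h x = h x + l)"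
proof -
  note fL = normalized_Lip[OF f]
  have \<eta>L: "\<eta> \<in> Lip" using \<eta> by (auto simp: ruelle_kernel_def)
  obtain K\<^sub>0 where K0: "0 \<le> K\<^sub>0" "lip K\<^sub>0 f" using lipE[OF fL] by blast
  obtain D where D: "0 \<le> D" "lip D \<eta>" using lipE[OF \<eta>L] by blast
  obtain B where B: "0 \<le> B" "\<And>x. \<bar>\<eta> x\<bar> \<le> B" using Lip_bounded[OF \<eta>L] by blast
  define K where "K = 4 * K\<^sub>0 + 4"
  have Kp: "0 < K" and fK: "lip K f" using K0 lip_mono[OF K0(2), of K] by (auto simp: K_def)
  define \<theta> where "\<theta> = exp (- (1 - contraction_rate K) / 2)"
  have c: "0 < contraction_rate K" "contraction_rate K < 1" using contraction_rate_bounds[of K] Kp by auto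
  have \<theta>: "\<theta> < 1" using c by (simp add: \<theta>_def)
  define C where "C = 2 * B * D * ((1 + 2 * K) / (2 * K))"
  have C: "0 \<le> C" using B D Kp by (simp add: C_def)
  define A\<^sub>1 where "A\<^sub>1 = C / (1 - \<theta>)"
  have A1: "0 \<le> A\<^sub>1" using C \<theta> by (simp add: A\<^sub>1_def)
  define R where "R = min (1 / 8) ((1 - contraction_rate K) / 2)"
  have R: "0 < R" "R \<le> 1 / 8" using c by (auto simp: R_def)
  \<comment> \<open>The first entry makes \<open>t \<eta>\<close> bounded by 1 and 1-Lipschitz, and
    \<open>t\<close> itself at most 1 in size; the second then gives
    \<open>A\<^sub>1 * t\<^sup>2 <= R\<close>.\<close>
  define t\<^sub>0 where "t\<^sub>0 = min (1 / (B + D + 1)) (R / (A\<^sub>1 + 1))"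
  have t0: "0 < t\<^sub>0" using B D A1 R by (simp add: t\<^sub>0_def)
  show ?thesis
  proof (rule that[of "A\<^sub>1 + 2 * B\<^sup>2" t\<^sub>0])
    show "0 \<le> A\<^sub>1 + 2 * B\<^sup>2" "0 < t\<^sub>0" using A1 t0 by auto
    fix t :: real assume "\<bar>t\<bar> < t\<^sub>0"
    then have "\<bar>t\<bar> < 1 / (B + D + 1)" "\<bar>t\<bar> < R / (A\<^sub>1 + 1)" by (auto simp: t\<^sub>0_def)
    then have *: "\<bar>t\<bar> * (B + D + 1) < 1" "\<bar>t\<bar> * (A\<^sub>1 + 1) < R"
      using B D A1 by (simp_all add: pos_less_divide_eq)
    have "0 \<le> \<bar>t\<bar> * B" "0 \<le> \<bar>t\<bar> * D" "0 \<le> \<bar>t\<bar> * A\<^sub>1" using B D A1 by auto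
    with * have tB: "\<bar>t\<bar> * B \<le> 1" and tD: "\<bar>t\<bar> * D \<le> 1" and t1: "\<bar>t\<bar> \<le> 1" and tA: "\<bar>t\<bar> * A\<^sub>1 \<le> R"
      unfolding distrib_left mult_1_right by linarith+
    have "A\<^sub>1 * t\<^sup>2 = (\<bar>t\<bar> * A\<^sub>1) * \<bar>t\<bar>" by (simp add: power2_eq_square mult_ac flip: abs_mult)
    also have "\<dots> \<le> \<bar>t\<bar> * A\<^sub>1" using t1 A1 by (intro mult_left_le) auto
    finally have A1R: "A\<^sub>1 * t\<^sup>2 \<le> R" using tA by linarith
    note lp = log_perturbation_bounds[OF f fK Kp \<eta> D(2) B(2) tB, folded C_def]
    have q: "(\<lambda>x. t * \<eta> x) \<in> Lip" "lip 1 (\<lambda>x. t * \<eta> x)"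
      using Lip_scale[OF \<eta>L] lip_mono[OF lip_scale[OF D(2), of t]] tD by auto
    have A1': "C * t\<^sup>2 / (1 - \<theta>) = A\<^sub>1 * t\<^sup>2" by (simp add: A\<^sub>1_def)
    obtain h l where h: "h \<in> Lip" "exp_lip K (A\<^sub>1 * t\<^sup>2) h" "h undefined = 0"
        "\<And>x. log_ruelle (\<lambda>x. f x + t * \<eta> x) h x = h x + l"
      using log_eigenfunction_exists[OF fL K0(2) q K_def \<theta>_def lp(1)] A1R unfolding A1' R_def by blast
    have hb: "\<bar>h x\<bar> \<le> A\<^sub>1 * t\<^sup>2" for x using exp_lip_osc[OF h(2), of x undefined] h(3) by simp
    \<comment> \<open>At the base point \<open>h\<close> vanishes, so \<open>l\<close> can be read
      off there. Monotonicity compares it with the value for \<open>h = 0\<close>, at the cost of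
      the uniform bound on \<open>h\<close>.\<close>
    have "l = log_ruelle f (\<lambda>x. t * \<eta> x + h x) undefined"
      using h(3,4) log_ruelle_add[of f "\<lambda>x. t * \<eta> x" h] by simp
    moreover have "log_ruelle f (\<lambda>x. t * \<eta> x + h x) undefined \<le> log_ruelle f (\<lambda>x. t * \<eta> x) undefined + A\<^sub>1 * t\<^sup>2"
      using hb by (intro log_ruelle_mono fL Lip_add q h(1)) (auto dest: abs_le_D1)
    moreover have "log_ruelle f (\<lambda>x. t * \<eta> x) undefined \<le> log_ruelle f (\<lambda>x. t * \<eta> x + h x) undefined + A\<^sub>1 * t\<^sup>2"
      using abs_le_D2[OF hb] by (intro log_ruelle_mono fL Lip_add q h(1)) (smt (verit))
    ultimately have "\<bar>l\<bar> \<le> A\<^sub>1 * t\<^sup>2 + 2 * B\<^sup>2 * t\<^sup>2"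
      using lp(2,3)[of undefined] by linarith
    then have "\<bar>l\<bar> \<le> (A\<^sub>1 + 2 * B\<^sup>2) * t\<^sup>2" by (simp add: distrib_right)
    moreover have "\<bar>h x\<bar> \<le> (A\<^sub>1 + 2 * B\<^sup>2) * t\<^sup>2" for x
      using hb[of x] by (simp add: distrib_right add_increasing2)
    ultimately show "\<exists>h l. h \<in> Lip \<and> (\<forall>x. \<bar>h x\<bar> \<le> (A\<^sub>1 + 2 * B\<^sup>2) * t\<^sup>2) \<and> \<bar>l\<bar> \<le> (A\<^sub>1 + 2 * B\<^sup>2) * t\<^sup>2 \<and>
       (\<forall>x. log_ruelle (\<lambda>x. f x + t * \<eta> x) h x = h x + l)"
      using h by blast
  qed
qed

text \<open>In the integrand at \<open>prepend a x\<close>, the term \<open>v (prepend a x)\<close>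
  cancels against the change of \<open>h\<close>, and \<open>- v x\<close> does not depend on
  \<open>a\<close>. The eigenvalue is therefore unchanged by a coboundary.\<close>

lemma log_ruelle_coboundary:
  assumes "F \<in> Lip" "h \<in> Lip"
  shows "log_ruelle (\<lambda>x. F x + (v x - v (shift_map x))) (\<lambda>x. h x - v x) x = log_ruelle F h x - v x"
proof -
  have "ruelle \<nu> (\<lambda>x. F x + (v x - v (shift_map x))) (\<lambda>x. exp (h x - v x)) x
      = exp (- v x) * ruelle \<nu> F (\<lambda>x. exp (h x)) x"
    unfolding ruelle_def
    by (subst Bochner_Integration.integral_mult_right_zero[symmetric], intro Bochner_Integration.integral_cong refl)
      (simp flip: exp_add)
  then show ?thesis
    unfolding log_ruelle_def using ruelle_pos[OF assms(1) Lip_exp[OF assms(2)], of x]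
    by (simp add: ln_mult)
qed

text \<open>For normalized \<open>N\<close>, the operator is a left inverse of composition with the
  shift.\<close>

lemma dual_eigenmeasure_shift_invariant:
  assumes N: "N \<in> normalized_potentials \<nu>" and \<mu>: "dual_eigenmeasure \<nu> N 1 \<mu>" and w: "w \<in> Lip"
  shows "(\<integral>x. w (shift_map x) \<partial>\<mu>) = (\<integral>x. w x \<partial>\<mu>)"
proof -
  have "ruelle \<nu> N (\<lambda>x. w (shift_map x)) x = w x" for x
    using ruelle_const[OF N, of "w x" x] by (simp add: ruelle_def)
  then have "(\<integral>x. w x \<partial>\<mu>) = (\<integral>x. ruelle \<nu> N (\<lambda>x. w (shift_map x)) x \<partial>\<mu>)" by simp
  also have "\<dots> = (\<integral>x. w (shift_map x) \<partial>\<mu>)"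
    using \<mu> Lip_shift[OF w] by (simp add: dual_eigenmeasure_def)
  finally show ?thesis by simp
qed

lemma integral_coboundary:
  assumes N: "N \<in> normalized_potentials \<nu>" and \<mu>: "dual_eigenmeasure \<nu> N 1 \<mu>" and w: "w \<in> Lip"
  shows "(\<integral>x. w x - w (shift_map x) \<partial>\<mu>) = 0"
proof -
  have bp: "borel_prob \<mu>" using \<mu> by (simp add: dual_eigenmeasure_def)
  show ?thesis
    using dual_eigenmeasure_shift_invariant[OF assms]
    by (simp add: Lip_integrable[OF w bp] Lip_integrable[OF Lip_shift[OF w] bp])
qed

text \<open>The operator of \<open>N\<close> is that of \<open>f\<close> applied to
  \<open>exp (N - f) * w\<close>, and the latter averages, so uniform errors are preserved. With
  \<open>q = 1\<close> this gives continuity of the Gibbs measure, with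
  \<open>q = 1 + t \<eta>\<close> the first-order expansion.\<close>

lemma ruelle_approx:
  assumes f: "f \<in> normalized_potentials \<nu>" and N: "N \<in> Lip" and w: "w \<in> Lip" "\<And>x. \<bar>w x\<bar> \<le> S"
    and q: "q \<in> Lip" and d: "\<And>x. \<bar>exp (N x - f x) - q x\<bar> \<le> \<delta>"
  shows "\<bar>ruelle \<nu> N w x - ruelle \<nu> f (\<lambda>x. q x * w x) x\<bar> \<le> \<delta> * S"
proof -
  note fL = normalized_Lip[OF f]
  define p where "p x = (exp (N x - f x) - q x) * w x" for x
  have pL: "p \<in> Lip" unfolding p_def[abs_def] by (intro Lip_mult Lip_diff Lip_exp N fL q w)
  have "\<bar>p x\<bar> \<le> \<delta> * S" for x
    unfolding p_def abs_mult using d w(2) order_trans[OF abs_ge_zero d] by (intro mult_mono) auto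
  then have pb: "p x \<le> \<delta> * S" "- (\<delta> * S) \<le> p x" for x by (auto simp: abs_le_iff minus_le_iff)
  have "ruelle \<nu> N w x = ruelle \<nu> f (\<lambda>x. p x + q x * w x) x"
    unfolding ruelle_def p_def by (simp add: distrib_right[symmetric] mult.assoc[symmetric] flip: exp_add)
  also have "\<dots> = ruelle \<nu> f p x + ruelle \<nu> f (\<lambda>x. q x * w x) x"
    by (intro ruelle_add fL pL Lip_mult q w)
  finally show ?thesis
    using ruelle_le_const[OF f pL pb(1), of x] ruelle_ge_const[OF f pL pb(2), of x]
    by (simp add: abs_le_iff)
qed

end

context normalized_shift
begin

section \<open>Continuity of the Gibbs measure in the potential\<close>

lemma abs_iter_le: "w \<in> Lip \<Longrightarrow> (\<And>x. \<bar>w x\<bar> \<le> S) \<Longrightarrow> \<bar>iter n w x\<bar> \<le> S"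
proof (induction n arbitrary: x)
  case (Suc n)
  then have "- S \<le> iter n w y" "iter n w y \<le> S" for y by (auto simp: abs_le_iff minus_le_iff)
  then have "- S \<le> iter (Suc n) w x" "iter (Suc n) w x \<le> S"
    using ruelle_le_const[OF normalized iter_Lip[OF Suc(2)]] ruelle_ge_const[OF normalized iter_Lip[OF Suc(2)]]
    by simp_all
  then show ?case by (simp add: abs_le_iff)
qed simp

text \<open>Under \<open>\<mu>'\<close>, each application of the operator of \<open>N\<close>
  instead of that of \<open>N'\<close> costs at most \<open>\<delta> * S\<close>. After
  \<open>n\<close> applications the function is nearly constant, and the two integrals nearly
  agree.\<close>

lemma integral_dual_eigenmeasure_close:
  assumes \<mu>: "dual_eigenmeasure \<nu> N 1 \<mu>" and \<mu>': "dual_eigenmeasure \<nu> N' 1 \<mu>'"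
    and N': "N' \<in> Lip" "\<And>x. \<bar>exp (N' x - N x) - 1\<bar> \<le> \<delta>"
    and w: "w \<in> Lip" "exp_lip K r w" "\<And>x. \<bar>w x\<bar> \<le> S"
  shows "\<bar>(\<integral>x. w x \<partial>\<mu>') - (\<integral>x. w x \<partial>\<mu>)\<bar> \<le> real n * (\<delta> * S) + \<kappa> ^ n * r"
proof -
  have bp: "borel_prob \<mu>" "borel_prob \<mu>'" using \<mu> \<mu>' by (auto simp: dual_eigenmeasure_def)
  interpret prob_space \<mu> using bp by (simp add: borel_prob_def)
  interpret P': prob_space \<mu>' using bp by (simp add: borel_prob_def)
  note iL = iter_Lip[OF w(1)]
  have int: "integrable \<mu>' (iter n w)" "integrable \<mu> (iter n w)" for n
    using Lip_integrable[OF iL] bp by auto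
  have step: "\<bar>(\<integral>x. iter n w x \<partial>\<mu>') - (\<integral>x. iter (Suc n) w x \<partial>\<mu>')\<bar> \<le> \<delta> * S" for n
  proof -
    have d: "\<bar>ruelle \<nu> N' (iter n w) x - iter (Suc n) w x\<bar> \<le> \<delta> * S" for x
      using ruelle_approx[OF normalized N'(1) iL abs_iter_le[OF w(1,3)] Lip_const[of 1] N'(2)] by simp
    have int': "integrable \<mu>' (ruelle \<nu> N' (iter n w))"
      by (rule Lip_integrable[OF ruelle_Lip[OF N'(1) iL] bp(2)])
    have "(\<integral>x. iter n w x \<partial>\<mu>') - (\<integral>x. iter (Suc n) w x \<partial>\<mu>')
        = (\<integral>x. ruelle \<nu> N' (iter n w) x - iter (Suc n) w x \<partial>\<mu>')"
      using \<mu>' iL[of n] int' int(1)[of "Suc n"] by (simp add: dual_eigenmeasure_def)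
    also have "\<bar>\<dots>\<bar> \<le> (\<integral>x. \<bar>ruelle \<nu> N' (iter n w) x - iter (Suc n) w x\<bar> \<partial>\<mu>')"
      by (rule integral_abs_bound)
    also have "\<dots> \<le> (\<integral>x. \<delta> * S \<partial>\<mu>')"
      using d int' int(1)[of "Suc n"] by (intro integral_mono) auto
    finally show ?thesis by (simp add: P'.prob_space)
  qed
  have tele: "\<bar>(\<integral>x. w x \<partial>\<mu>') - (\<integral>x. iter n w x \<partial>\<mu>')\<bar> \<le> real n * (\<delta> * S)" for n
  proof (induction n)
    case (Suc n)
    then show ?case using step[of n] unfolding of_nat_Suc distrib_right by linarith
  qed simp
  have inv: "(\<integral>x. iter n w x \<partial>\<mu>) = (\<integral>x. w x \<partial>\<mu>)" for n
    using \<mu> iL by (induction n) (auto simp: dual_eigenmeasure_def)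
  have both: "\<bar>(\<integral>x. iter n w x \<partial>\<mu>') - (\<integral>x. iter n w x \<partial>\<mu>)\<bar> \<le> \<kappa> ^ n * r"
  proof -
    have "\<bar>iter n w y - (\<integral>x. iter n w x \<partial>\<mu>)\<bar> \<le> \<kappa> ^ n * r" for y
    proof -
      have "iter n w y - (\<integral>x. iter n w x \<partial>\<mu>) = (\<integral>x. iter n w y - iter n w x \<partial>\<mu>)"
        using int by (simp add: prob_space)
      also have "\<bar>\<dots>\<bar> \<le> (\<integral>x. \<bar>iter n w y - iter n w x\<bar> \<partial>\<mu>)" by (rule integral_abs_bound)
      also have "\<dots> \<le> (\<integral>x. \<kappa> ^ n * r \<partial>\<mu>)"
        using int iter_diff_tendsto_0(2)[OF w(1,2)] by (intro integral_mono) auto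
      finally show ?thesis by (simp add: prob_space)
    qed
    note b = this
    have "(\<integral>x. iter n w x \<partial>\<mu>') - (\<integral>x. iter n w x \<partial>\<mu>) = (\<integral>y. iter n w y - (\<integral>x. iter n w x \<partial>\<mu>) \<partial>\<mu>')"
      using int by (simp add: P'.prob_space)
    also have "\<bar>\<dots>\<bar> \<le> (\<integral>y. \<bar>iter n w y - (\<integral>x. iter n w x \<partial>\<mu>)\<bar> \<partial>\<mu>')" by (rule integral_abs_bound)
    also have "\<dots> \<le> (\<integral>y. \<kappa> ^ n * r \<partial>\<mu>')"
      using int b by (intro integral_mono) auto
    finally show ?thesis by (simp add: P'.prob_space)
  qed
  show ?thesis using tele[of n] both inv[of n] by linarith
qed

lemma integral_dual_eigenmeasure_tendsto:
  assumes \<mu>: "dual_eigenmeasure \<nu> N 1 \<mu>"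
    and ev: "\<forall>\<^sub>F i in F. \<exists>N'. dual_eigenmeasure \<nu> N' 1 (\<mu>' i) \<and> N' \<in> Lip \<and> (\<forall>x. \<bar>exp (N' x - N x) - 1\<bar> \<le> \<delta> i)"
    and \<delta>: "(\<delta> \<longlongrightarrow> 0) F" and w: "w \<in> Lip"
  shows "((\<lambda>i. \<integral>x. w x \<partial>\<mu>' i) \<longlongrightarrow> (\<integral>x. w x \<partial>\<mu>)) F"
proof (rule tendstoI)
  fix e :: real assume e: "0 < e"
  obtain r where r: "exp_lip K r w" using exists_exp_lip[OF w K_pos] by blast
  obtain S where S: "\<And>x. \<bar>w x\<bar> \<le> S" using Lip_bounded[OF w] by blast
  have "\<forall>\<^sub>F n in sequentially. \<kappa> ^ n * r < e / 2"
    using order_tendstoD(2)[OF iter_diff_tendsto_0(1)[OF w r], of "e / 2"] e by simp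
  \<comment> \<open>The number of iterations is fixed before \<open>i\<close> varies, so that the
    first error term is a fixed multiple of \<open>\<delta> i\<close>.\<close>
  then obtain n where n: "\<kappa> ^ n * r < e / 2" by (auto simp: eventually_sequentially)
  have "((\<lambda>i. real n * (\<delta> i * S)) \<longlongrightarrow> real n * (0 * S)) F"
    by (intro tendsto_mult_left tendsto_mult_right \<delta>)
  then have "\<forall>\<^sub>F i in F. real n * (\<delta> i * S) < e / 2"
    using order_tendstoD(2)[of _ 0 F "e / 2"] e by simp
  with ev show "\<forall>\<^sub>F i in F. dist (\<integral>x. w x \<partial>\<mu>' i) (\<integral>x. w x \<partial>\<mu>) < e"
  proof eventually_elim
    case (elim i)
    then obtain N' where N': "dual_eigenmeasure \<nu> N' 1 (\<mu>' i)" "N' \<in> Lip" "\<And>x. \<bar>exp (N' x - N x) - 1\<bar> \<le> \<delta> i"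
      by blast
    show ?case
      using integral_dual_eigenmeasure_close[OF \<mu> N' w r S, of n] elim(2) n
      by (simp add: dist_real_def)
  qed
qed

end

context full_shift
begin

section \<open>First-order expansion of the entropy\<close>

lemma kernel_Lip: "\<zeta> \<in> ruelle_kernel \<nu> f \<Longrightarrow> \<zeta> \<in> Lip"
  and ruelle_kernel_eq: "\<zeta> \<in> ruelle_kernel \<nu> f \<Longrightarrow> ruelle \<nu> f \<zeta> x = 0"
  by (auto simp: ruelle_kernel_def)

text \<open>Adjusting the eigenfunction by \<open>exp (- t v)\<close> removes the coboundary of
  \<open>v\<close> from the normalized potential. The coboundaries of \<open>u\<close> and
  \<open>h\<close> remain in it, but integrate to 0 against an invariant measure.\<close>

lemma gibbs_entropy_perturbation:
  assumes f: "f \<in> normalized_potentials \<nu>"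
    and \<zeta>: "\<zeta> \<in> ruelle_kernel \<nu> f" and \<eta>: "\<eta> \<in> ruelle_kernel \<nu> f"
    and u: "u \<in> Lip" and v: "v \<in> Lip"
    and f_eq: "\<And>x. f x = \<zeta> x + (u x - u (shift_map x)) + c"
    and g_eq: "\<And>x. g x = \<eta> x + (v x - v (shift_map x))"
  obtains A t\<^sub>0 where "0 \<le> A" "0 < t\<^sub>0"
    "\<And>t. \<bar>t\<bar> < t\<^sub>0 \<Longrightarrow> \<exists>N l. N \<in> normalized_potentials \<nu> \<and>
       dual_eigenmeasure \<nu> N 1 (lipschitz_gibbs \<nu> (\<lambda>x. f x + t * g x)) \<and>
       (\<forall>x. \<bar>N x - f x - t * \<eta> x\<bar> \<le> A * t\<^sup>2) \<and> \<bar>l\<bar> \<le> A * t\<^sup>2 \<and>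
       gibbs_entropy \<nu> (\<lambda>x. f x + t * g x) = l - c
         - (\<integral>x. \<zeta> x \<partial>lipschitz_gibbs \<nu> (\<lambda>x. f x + t * g x))
         - t * (\<integral>x. \<eta> x \<partial>lipschitz_gibbs \<nu> (\<lambda>x. f x + t * g x))"
proof -
  note fL = normalized_Lip[OF f] and \<zeta>L = kernel_Lip[OF \<zeta>] and \<eta>L = kernel_Lip[OF \<eta>]
  obtain A t\<^sub>0 where A: "0 \<le> A" "0 < t\<^sub>0" and
    pert: "\<And>t. \<bar>t\<bar> < t\<^sub>0 \<Longrightarrow> \<exists>h l. h \<in> Lip \<and> (\<forall>x. \<bar>h x\<bar> \<le> A * t\<^sup>2) \<and> \<bar>l\<bar> \<le> A * t\<^sup>2 \<and>
       (\<forall>x. log_ruelle (\<lambda>x. f x + t * \<eta> x) h x = h x + l)"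
    using perturbed_log_eigenfunction[OF f \<eta>] by blast
  show ?thesis
  \<comment> \<open>The normalized potential contains \<open>h x\<close>,
    \<open>h (shift_map x)\<close> and \<open>l\<close>, each of size at most
    \<open>A * t\<^sup>2\<close>.\<close>
  proof (rule that[of "3 * A" t\<^sub>0])
    show "0 \<le> 3 * A" "0 < t\<^sub>0" using A by auto
    fix t :: real assume t: "\<bar>t\<bar> < t\<^sub>0"
    from pert[OF t] obtain h l where h: "h \<in> Lip" "\<And>x. \<bar>h x\<bar> \<le> A * t\<^sup>2" "\<bar>l\<bar> \<le> A * t\<^sup>2"
      and eig: "\<And>x. log_ruelle (\<lambda>x. f x + t * \<eta> x) h x = h x + l" by blast
    define G where "G x = f x + t * g x" for x
    have FL: "(\<lambda>x. f x + t * \<eta> x) \<in> Lip" by (intro Lip_add Lip_scale fL \<eta>L)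
    have G_eq: "G = (\<lambda>x. f x + t * \<eta> x + (t * v x - t * v (shift_map x)))"
      by (rule ext) (simp add: G_def g_eq algebra_simps)
    have GL: "G \<in> Lip"
      unfolding G_eq by (intro Lip_add Lip_diff Lip_scale Lip_shift fL \<eta>L v)
    define k where "k x = h x - t * v x" for x
    have kL: "k \<in> Lip" unfolding k_def[abs_def] by (intro Lip_diff Lip_scale h v)
    have eig': "log_ruelle G k x = k x + l" for x
      unfolding G_eq k_def[abs_def]
      using log_ruelle_coboundary[OF FL h(1), of "\<lambda>x. t * v x" x] by (simp add: eig)
    define N where "N = conjugate G k"
    define \<mu> where "\<mu> = lipschitz_gibbs \<nu> G"
    have N_eq: "N x = f x + t * \<eta> x + (h x - h (shift_map x)) - l" for x
      unfolding N_def conjugate_def eig' by (simp add: G_eq k_def)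
    have N: "N \<in> normalized_potentials \<nu>" unfolding N_def by (rule conjugate_normalized[OF GL kL])
    have \<mu>: "dual_eigenmeasure \<nu> N 1 \<mu>" and norm: "normalization \<nu> G = N"
      unfolding N_def \<mu>_def using normalization_eq_conjugate[OF GL kL eig'] by auto
    have bp: "borel_prob \<mu>" using \<mu> by (simp add: dual_eigenmeasure_def)
    interpret prob_space \<mu> using bp by (simp add: borel_prob_def)
    note int = Lip_integrable[OF _ bp]
    have "\<bar>N x - f x - t * \<eta> x\<bar> \<le> 3 * A * t\<^sup>2" for x
      using h(2)[of x] h(2)[of "shift_map x"] h(3) unfolding N_eq by linarith
    moreover have "\<bar>l\<bar> \<le> 3 * A * t\<^sup>2"
      using h(3) mult_right_mono[of A "3 * A" "t\<^sup>2"] A by linarith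
    moreover have "gibbs_entropy \<nu> G = l - c - (\<integral>x. \<zeta> x \<partial>\<mu>) - t * (\<integral>x. \<eta> x \<partial>\<mu>)"
    proof -
      have 1: "integrable \<mu> \<zeta>" "integrable \<mu> \<eta>"
          "integrable \<mu> (\<lambda>x. u x - u (shift_map x))" "integrable \<mu> (\<lambda>x. h x - h (shift_map x))"
        by (intro int \<zeta>L \<eta>L Lip_diff Lip_shift u h)+
      have "(\<integral>x. N x \<partial>\<mu>) = (\<integral>x. \<zeta> x + (u x - u (shift_map x)) + c + t * \<eta> x + (h x - h (shift_map x)) - l \<partial>\<mu>)"
        unfolding N_eq f_eq ..
      also have "\<dots> = (\<integral>x. \<zeta> x \<partial>\<mu>) + (\<integral>x. u x - u (shift_map x) \<partial>\<mu>) + c + t * (\<integral>x. \<eta> x \<partial>\<mu>)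
          + (\<integral>x. h x - h (shift_map x) \<partial>\<mu>) - l"
      proof -
        define U where "U x = u x - u (shift_map x)" for x
        define H where "H x = h x - h (shift_map x)" for x
        have "integrable \<mu> U" "integrable \<mu> H" using 1 by (auto simp: U_def[abs_def] H_def[abs_def])
        with 1(1,2) show ?thesis
          unfolding U_def[symmetric] H_def[symmetric] by (simp add: prob_space)
      qed
      finally show ?thesis
        unfolding gibbs_entropy_def norm \<mu>_def[symmetric]
        by (simp add: integral_coboundary[OF N \<mu>] u h)
    qed
    ultimately show "\<exists>N l. N \<in> normalized_potentials \<nu> \<and>
       dual_eigenmeasure \<nu> N 1 (lipschitz_gibbs \<nu> (\<lambda>x. f x + t * g x)) \<and>
       (\<forall>x. \<bar>N x - f x - t * \<eta> x\<bar> \<le> 3 * A * t\<^sup>2) \<and> \<bar>l\<bar> \<le> 3 * A * t\<^sup>2 \<and>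
       gibbs_entropy \<nu> (\<lambda>x. f x + t * g x) = l - c
         - (\<integral>x. \<zeta> x \<partial>lipschitz_gibbs \<nu> (\<lambda>x. f x + t * g x))
         - t * (\<integral>x. \<eta> x \<partial>lipschitz_gibbs \<nu> (\<lambda>x. f x + t * g x))"
      using N \<mu> unfolding \<mu>_def G_def[abs_def] by blast
  qed
qed

lemma gibbs_entropy_derivative:
  assumes f: "f \<in> normalized_potentials \<nu>"
    and \<zeta>: "\<zeta> \<in> ruelle_kernel \<nu> f" and \<eta>: "\<eta> \<in> ruelle_kernel \<nu> f"
    and u: "u \<in> Lip" and v: "v \<in> Lip"
    and f_eq: "\<And>x. f x = \<zeta> x + (u x - u (shift_map x)) + c"
    and g_eq: "\<And>x. g x = \<eta> x + (v x - v (shift_map x))"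
  shows "((\<lambda>t. gibbs_entropy \<nu> (\<lambda>x. f x + t * g x)) has_real_derivative
           - (\<integral>x. \<zeta> x * \<eta> x \<partial>lipschitz_gibbs \<nu> f)) (at 0)"
proof -
  note fL = normalized_Lip[OF f] and \<zeta>L = kernel_Lip[OF \<zeta>] and \<eta>L = kernel_Lip[OF \<eta>]
  define \<mu> where "\<mu> t = lipschitz_gibbs \<nu> (\<lambda>x. f x + t * g x)" for t
  define E where "E t = gibbs_entropy \<nu> (\<lambda>x. f x + t * g x)" for t
  obtain A t\<^sub>0 where A: "0 \<le> A" "0 < t\<^sub>0" and
    pert: "\<And>t. \<bar>t\<bar> < t\<^sub>0 \<Longrightarrow> \<exists>N l. N \<in> normalized_potentials \<nu> \<and> dual_eigenmeasure \<nu> N 1 (\<mu> t) \<and>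
       (\<forall>x. \<bar>N x - f x - t * \<eta> x\<bar> \<le> A * t\<^sup>2) \<and> \<bar>l\<bar> \<le> A * t\<^sup>2 \<and>
       E t = l - c - (\<integral>x. \<zeta> x \<partial>\<mu> t) - t * (\<integral>x. \<eta> x \<partial>\<mu> t)"
    using gibbs_entropy_perturbation[OF f \<zeta> \<eta> u v f_eq g_eq] unfolding \<mu>_def E_def by blast
  obtain B where B: "0 \<le> B" "\<And>x. \<bar>\<eta> x\<bar> \<le> B" using Lip_bounded[OF \<eta>L] by blast
  obtain S where S: "0 \<le> S" "\<And>x. \<bar>\<zeta> x\<bar> \<le> S" using Lip_bounded[OF \<zeta>L] by blast
  obtain C where C: "0 \<le> C" "lip C f" using lipE[OF fL] by blast
  interpret normalized_shift \<nu> f "C + 1"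
    using f C lip_mono[OF C(2), of "C + 1"] by unfold_locales auto
  have \<mu>0: "dual_eigenmeasure \<nu> f 1 (\<mu> 0)" and E0: "E 0 = - c - (\<integral>x. \<zeta> x \<partial>\<mu> 0)"
  proof -
    \<comment> \<open>At \<open>t = 0\<close> the quadratic error bounds are 0, which forces
      \<open>N = f\<close> and \<open>l = 0\<close>.\<close>
    from pert[of 0] A obtain N l where N: "dual_eigenmeasure \<nu> N 1 (\<mu> 0)" "\<And>x. N x = f x" "l = 0"
        "E 0 = l - c - (\<integral>x. \<zeta> x \<partial>\<mu> 0)" by auto
    then have "N = f" by auto
    with N show "dual_eigenmeasure \<nu> f 1 (\<mu> 0)" "E 0 = - c - (\<integral>x. \<zeta> x \<partial>\<mu> 0)" by auto
  qed
  have kernel0: "(\<integral>x. w x \<partial>\<mu> 0) = 0" if "w \<in> ruelle_kernel \<nu> f" for w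
    using \<mu>0 that by (auto simp: dual_eigenmeasure_def ruelle_kernel_def)
  define t\<^sub>1 where "t\<^sub>1 = min t\<^sub>0 (1 / (B + A + 1))"
  have t1: "0 < t\<^sub>1" using A B by (simp add: t\<^sub>1_def)
  \<comment> \<open>For \<open>t\<close> of size at most 1, \<open>A * t\<^sup>2\<close> is at most
    \<open>A\<close> times the size of \<open>t\<close>; so \<open>M\<close> bounds the rate at
    which \<open>N - f\<close> grows with \<open>t\<close>.\<close>
  define M where "M = B + A"
  have dev: "\<bar>N x - f x\<bar> \<le> \<bar>t\<bar> * M" "\<bar>t\<bar> * M \<le> 1" if "\<bar>t\<bar> < t\<^sub>1" "\<And>x. \<bar>N x - f x - t * \<eta> x\<bar> \<le> A * t\<^sup>2" for t N x
  proof -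
    have "\<bar>t\<bar> < 1 / (B + A + 1)" using that by (simp add: t\<^sub>1_def)
    then have "\<bar>t\<bar> * (B + A + 1) < 1" using A B by (simp add: pos_less_divide_eq)
    moreover have "0 \<le> \<bar>t\<bar> * (B + A)" using A B by simp
    ultimately have "\<bar>t\<bar> * (B + A) \<le> 1" "\<bar>t\<bar> \<le> 1" unfolding distrib_left mult_1_right by linarith+
    then show "\<bar>t\<bar> * M \<le> 1" by (simp add: M_def)
    have "A * t\<^sup>2 = A * \<bar>t\<bar> * \<bar>t\<bar>" by (simp add: power2_eq_square mult.assoc flip: abs_mult)
    also have "\<dots> \<le> A * \<bar>t\<bar>" using \<open>\<bar>t\<bar> \<le> 1\<close> A by (intro mult_left_le) auto
    finally have "A * t\<^sup>2 \<le> \<bar>t\<bar> * A" by (simp add: mult.commute)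
    moreover have "\<bar>t * \<eta> x\<bar> \<le> \<bar>t\<bar> * B" using B by (simp add: abs_mult mult_left_mono)
    ultimately show "\<bar>N x - f x\<bar> \<le> \<bar>t\<bar> * M"
      using that(2)[of x] unfolding M_def distrib_left by linarith
  qed
  have small: "\<forall>\<^sub>F t in at 0. \<bar>t\<bar> < t\<^sub>1"
    using t1 unfolding eventually_at by (intro exI[of _ t\<^sub>1]) (auto simp: dist_real_def)
  have lim: "((\<lambda>t. \<integral>x. w x \<partial>\<mu> t) \<longlongrightarrow> (\<integral>x. w x \<partial>\<mu> 0)) (at 0)" if w: "w \<in> Lip" for w
  proof (rule integral_dual_eigenmeasure_tendsto[OF \<mu>0 _ _ w])
    show "((\<lambda>t. 2 * (\<bar>t\<bar> * M)) \<longlongrightarrow> 0) (at 0)" by (auto intro!: tendsto_eq_intros)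
    show "\<forall>\<^sub>F t in at 0. \<exists>N'. dual_eigenmeasure \<nu> N' 1 (\<mu> t) \<and> N' \<in> Lip \<and>
        (\<forall>x. \<bar>exp (N' x - f x) - 1\<bar> \<le> 2 * (\<bar>t\<bar> * M))"
      using small
    proof eventually_elim
      case (elim t)
      then have "\<bar>t\<bar> < t\<^sub>0" by (simp add: t\<^sub>1_def)
      from pert[OF this] obtain N where N: "N \<in> normalized_potentials \<nu>" "dual_eigenmeasure \<nu> N 1 (\<mu> t)"
          "\<And>x. \<bar>N x - f x - t * \<eta> x\<bar> \<le> A * t\<^sup>2" by blast
      have "\<bar>exp (N x - f x) - 1\<bar> \<le> 2 * (\<bar>t\<bar> * M)" for x
      proof (cases "0 \<le> N x - f x")
        case True
        have "\<bar>N x - f x\<bar> \<le> 1" using dev(1)[OF elim N(3), of x] dev(2)[OF elim N(3)] by linarith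
        then have "exp (N x - f x) \<le> 1 + (N x - f x) + (N x - f x)\<^sup>2" using True by (intro exp_bound) auto
        moreover have "(N x - f x)\<^sup>2 \<le> N x - f x"
          using True \<open>\<bar>N x - f x\<bar> \<le> 1\<close> by (simp add: power2_eq_square mult_left_le)
        ultimately show ?thesis using True dev(1)[OF elim N(3), of x] by simp
      next
        case False
        then have "exp (N x - f x) \<le> 1" by simp
        then show ?thesis using exp_ge_add_one_self[of "N x - f x"] dev(1)[OF elim N(3), of x] by linarith
      qed
      then show ?case using N normalized_Lip by blast
    qed
  qed
  \<comment> \<open>Up to order \<open>t\<close>, \<open>W t\<close> is minus the difference
    quotient of the entropy. Its second summand tends to 0, because \<eta> has integral 0 against
    the Gibbs measure of \<open>f\<close>.\<close>
  define W where "W t = (\<integral>x. ruelle \<nu> f (\<lambda>x. \<eta> x * \<zeta> x) x \<partial>\<mu> t) + (\<integral>x. \<eta> x \<partial>\<mu> t)" for t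
  have \<eta>\<zeta>L: "(\<lambda>x. \<eta> x * \<zeta> x) \<in> Lip" by (intro Lip_mult \<eta>L \<zeta>L)
  have W_lim: "(W \<longlongrightarrow> (\<integral>x. \<zeta> x * \<eta> x \<partial>\<mu> 0)) (at 0)"
  proof -
    have "W 0 = (\<integral>x. \<zeta> x * \<eta> x \<partial>\<mu> 0)"
      unfolding W_def kernel0[OF \<eta>] using \<mu>0 \<eta>\<zeta>L by (simp add: dual_eigenmeasure_def mult.commute)
    moreover have "(W \<longlongrightarrow> W 0) (at 0)"
      unfolding W_def[abs_def] by (intro tendsto_add lim ruelle_Lip fL \<eta>\<zeta>L \<eta>L)
    ultimately show ?thesis by simp
  qed
  \<comment> \<open>The summand \<open>A\<close> accounts for \<open>l\<close>. The rest is the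
    error in replacing \<open>exp (N - f)\<close> by \<open>1 + t \<eta>\<close>, multiplied by the
    bound \<open>S\<close> of \<zeta>.\<close>
  define Q where "Q = A + (2 * M\<^sup>2 + A) * S"
  have est: "\<bar>E t - E 0 + t * W t\<bar> \<le> Q * t\<^sup>2" if t: "\<bar>t\<bar> < t\<^sub>1" for t
  proof -
    from t have "\<bar>t\<bar> < t\<^sub>0" by (simp add: t\<^sub>1_def)
    from pert[OF this] obtain N l where N: "N \<in> normalized_potentials \<nu>" "dual_eigenmeasure \<nu> N 1 (\<mu> t)"
        "\<And>x. \<bar>N x - f x - t * \<eta> x\<bar> \<le> A * t\<^sup>2" and l: "\<bar>l\<bar> \<le> A * t\<^sup>2"
        and Et: "E t = l - c - (\<integral>x. \<zeta> x \<partial>\<mu> t) - t * (\<integral>x. \<eta> x \<partial>\<mu> t)" by blast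
    note NL = normalized_Lip[OF N(1)]
    have bp: "borel_prob (\<mu> t)" using N(2) by (simp add: dual_eigenmeasure_def)
    interpret P: prob_space "\<mu> t" using bp by (simp add: borel_prob_def)
    have "\<bar>exp (N x - f x) - (1 + t * \<eta> x)\<bar> \<le> (2 * M\<^sup>2 + A) * t\<^sup>2" for x
    proof -
      have "\<bar>N x - f x\<bar> \<le> 1" using dev(1)[OF t N(3), of x] dev(2)[OF t N(3)] by linarith
      then have "\<bar>exp (N x - f x) - 1 - (N x - f x)\<bar> \<le> 2 * (N x - f x)\<^sup>2"
        by (rule abs_exp_minus_one_minus_le)
      moreover have "(N x - f x)\<^sup>2 \<le> M\<^sup>2 * t\<^sup>2"
        using power_mono[OF dev(1)[OF t N(3), of x], of 2] by (simp add: power_mult_distrib mult.commute)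
      ultimately have "\<bar>exp (N x - f x) - 1 - t * \<eta> x\<bar> \<le> 2 * (M\<^sup>2 * t\<^sup>2) + A * t\<^sup>2"
        using N(3)[of x] by linarith
      then show ?thesis by (simp add: algebra_simps)
    qed
    from ruelle_approx[OF f NL \<zeta>L S(2) Lip_add[OF Lip_const Lip_scale[OF \<eta>L]] this]
    have "\<bar>ruelle \<nu> N \<zeta> x - ruelle \<nu> f (\<lambda>x. (1 + t * \<eta> x) * \<zeta> x) x\<bar> \<le> (2 * M\<^sup>2 + A) * t\<^sup>2 * S" for x .
    moreover have "ruelle \<nu> f (\<lambda>x. (1 + t * \<eta> x) * \<zeta> x) x = t * ruelle \<nu> f (\<lambda>x. \<eta> x * \<zeta> x) x" for x
      using ruelle_add[OF fL \<zeta>L Lip_scale[OF \<eta>\<zeta>L], of t x]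
      by (simp add: distrib_right mult.assoc ruelle_kernel_eq[OF \<zeta>] ruelle_scale)
    ultimately have d: "\<bar>ruelle \<nu> N \<zeta> x - t * ruelle \<nu> f (\<lambda>x. \<eta> x * \<zeta> x) x\<bar> \<le> (2 * M\<^sup>2 + A) * t\<^sup>2 * S" for x
      by simp
    have int: "integrable (\<mu> t) (ruelle \<nu> N \<zeta>)" "integrable (\<mu> t) (ruelle \<nu> f (\<lambda>x. \<eta> x * \<zeta> x))"
      using Lip_integrable[OF ruelle_Lip bp] NL \<zeta>L fL \<eta>\<zeta>L by auto
    have "(\<integral>x. \<zeta> x \<partial>\<mu> t) - t * (\<integral>x. ruelle \<nu> f (\<lambda>x. \<eta> x * \<zeta> x) x \<partial>\<mu> t)
        = (\<integral>x. ruelle \<nu> N \<zeta> x - t * ruelle \<nu> f (\<lambda>x. \<eta> x * \<zeta> x) x \<partial>\<mu> t)"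
      using N(2) \<zeta>L int by (simp add: dual_eigenmeasure_def)
    also have "\<bar>\<dots>\<bar> \<le> (\<integral>x. \<bar>ruelle \<nu> N \<zeta> x - t * ruelle \<nu> f (\<lambda>x. \<eta> x * \<zeta> x) x\<bar> \<partial>\<mu> t)"
      by (rule integral_abs_bound)
    also have "\<dots> \<le> (\<integral>x. (2 * M\<^sup>2 + A) * t\<^sup>2 * S \<partial>\<mu> t)"
      using d int by (intro integral_mono) auto
    also have "\<dots> = (2 * M\<^sup>2 + A) * S * t\<^sup>2" by (simp add: P.prob_space)
    finally have "\<bar>(\<integral>x. \<zeta> x \<partial>\<mu> t) - t * (\<integral>x. ruelle \<nu> f (\<lambda>x. \<eta> x * \<zeta> x) x \<partial>\<mu> t)\<bar> \<le> (2 * M\<^sup>2 + A) * S * t\<^sup>2" .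
    then show ?thesis
      unfolding Et E0 kernel0[OF \<zeta>] W_def Q_def distrib_left[of t] distrib_right[of A]
      using l by linarith
  qed
  have "((\<lambda>t. (E t - E 0) / t + W t) \<longlongrightarrow> 0) (at 0)"
  proof (rule Lim_null_comparison)
    show "((\<lambda>t. Q * \<bar>t\<bar>) \<longlongrightarrow> 0) (at 0)" by (auto intro!: tendsto_eq_intros)
    have "\<forall>\<^sub>F t :: real in at 0. t \<noteq> 0" by (simp add: eventually_at_filter)
    with small show "\<forall>\<^sub>F t in at 0. norm ((E t - E 0) / t + W t) \<le> Q * \<bar>t\<bar>"
    proof eventually_elim
      case (elim t)
      then have "(E t - E 0) / t + W t = (E t - E 0 + t * W t) / t" by (simp add: add_divide_distrib)
      then have "norm ((E t - E 0) / t + W t) = \<bar>E t - E 0 + t * W t\<bar> / \<bar>t\<bar>" by simp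
      also have "\<dots> \<le> Q * t\<^sup>2 / \<bar>t\<bar>" using est[OF elim(1)] by (intro divide_right_mono) auto
      also have "\<dots> = Q * (\<bar>t\<bar> * \<bar>t\<bar>) / \<bar>t\<bar>" unfolding power2_eq_square abs_mult_self_eq ..
      also have "\<dots> = Q * \<bar>t\<bar>" using elim(2) by (simp del: abs_mult_self_eq)
      finally show ?case .
    qed
  qed
  from tendsto_diff[OF this W_lim]
  have "((\<lambda>t. (E t - E 0) / t) \<longlongrightarrow> - (\<integral>x. \<zeta> x * \<eta> x \<partial>\<mu> 0)) (at 0)" by simp
  then have "(E has_real_derivative - (\<integral>x. \<zeta> x * \<eta> x \<partial>\<mu> 0)) (at 0)"
    by (simp add: DERIV_def)
  then show ?thesis by (simp add: E_def[abs_def] \<mu>_def)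
qed

end

theorem proposition23:
  fixes \<nu> :: "'a::metric_space measure"
    and f g \<zeta> \<eta> u v :: "(nat \<Rightarrow> 'a) \<Rightarrow> real" and c :: real
  assumes "compact (UNIV :: 'a set)"
    and "diameter (UNIV :: 'a set) = 1"
    and "borel_prob \<nu>"
    and "msupport \<nu> = UNIV"
    and "f \<in> normalized_potentials \<nu>"
    and "g \<in> Lip"
    and "\<zeta> \<in> ruelle_kernel \<nu> f"
    and "\<eta> \<in> ruelle_kernel \<nu> f"
    and "u \<in> Lip"
    and "v \<in> Lip"
    and "\<And>x. f x = \<zeta> x + (u x - u (shift_map x)) + c"
    and "\<And>x. g x = \<eta> x + (v x - v (shift_map x))"
  shows "((\<lambda>t. gibbs_entropy \<nu> (\<lambda>x. f x + t * g x)) has_real_derivative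
           - (\<integral>x. \<zeta> x * \<eta> x \<partial>lipschitz_gibbs \<nu> f)) (at 0)"
proof -
  interpret full_shift \<nu>
  proof
    show "dist a b \<le> 1" for a b :: 'a
      using diameter_bounded_bound[OF compact_imp_bounded[OF assms(1)], of a b] assms(2) by simp
  qed (rule assms)+
  show ?thesis by (rule gibbs_entropy_derivative) (rule assms)+
qed

end
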